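(* Let $F$ be a non-archimedean local field of characteristic zero and $\phi\in C_c^\infty(\mathfrak{gl}_n(F)\times\mathfrak{gl}_n(F))$. Set $\widetilde\phi(t)=\int_{\mathrm{GL}_n(F)}\phi(th,h^{-1})\,dh$ for $t\in F^\times$. If $\widetilde\phi(t)=0$ for all non-zero $t$ in some neighborhood of $0$ in $F$, then $\phi(0)=0$.
   Context: $dh$ is a Haar measure on $\mathrm{GL}_n(F)$. *)

theory Defs
  imports "HOL-Analysis.Analysis"
begin

definition (in field) nonarch_absolute_value :: "('a \<Rightarrow> real) \<Rightarrow> bool" where
  "nonarch_absolute_value v \<longleftrightarrow>
     (\<forall>x. 0 \<le> v x) \<and>
     (\<forall>x. v x = 0 \<longleftrightarrow> x = 0) \<and>
     (\<forall>x y. v (x * y) = v x * v y) \<and>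
     (\<forall>x y. v (x + y) \<le> max (v x) (v y)) \<and>
     (\<exists>x. x \<noteq> 0 \<and> v x \<noteq> 1)"

text \<open>
  A non-archimedean local field is a locally compact field whose topology is the metric topology
  of some nontrivial non-archimedean absolute value. The absolute value is not part of the
  structure. Nontriviality makes the topology non-discrete.
\<close>

class nonarch_local_field = field + topological_space +
  assumes ex_nonarch_absolute_value:
    "\<exists>v. nonarch_absolute_value v \<and>
       (\<forall>U. open U \<longleftrightarrow> (\<forall>x\<in>U. \<exists>e>0. \<forall>y. v (y - x) < e \<longrightarrow> y \<in> U))"
  and locally_compact: "\<exists>U K. open U \<and> compact K \<and> x \<in> U \<and> U \<subseteq> K"

text \<open>
  Smooth functions on a totally disconnected space are the locally constant ones.
\<close>

definition Cc_infty :: "('b::topological_space \<Rightarrow> complex) set" where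
  "Cc_infty = {\<phi>. (\<forall>x. \<exists>U. open U \<and> x \<in> U \<and> \<phi> constant_on U) \<and>
                   compact (closure {x. \<phi> x \<noteq> 0})}"

definition GL :: "('a::field ^ 'n ^ 'n) set" where
  "GL = {h. invertible h}"

text \<open>
  A Haar measure on \<open>GL\<close> is a nonzero left-invariant Radon measure. Over a topological field,
  inversion is continuous for the subspace topology inherited from all matrices, so this is the
  group topology.
\<close>

definition haar_measure_GL :: "('a::{field,topological_space} ^ 'n ^ 'n) measure \<Rightarrow> bool" where
  "haar_measure_GL \<mu> \<longleftrightarrow>
     sets \<mu> = sets (restrict_space borel GL) \<and>
     emeasure \<mu> (space \<mu>) \<noteq> 0 \<and>
     (\<forall>g\<in>GL. \<forall>A\<in>sets \<mu>. emeasure \<mu> ((\<lambda>h. g ** h) ` A) = emeasure \<mu> A) \<and>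
     (\<forall>K. compact K \<and> K \<subseteq> GL \<longrightarrow> emeasure \<mu> K < \<infinity>) \<and>
     (\<forall>A\<in>sets \<mu>. emeasure \<mu> A =
        (INF U\<in>{U. openin (top_of_set GL) U \<and> A \<subseteq> U}. emeasure \<mu> U)) \<and>
     (\<forall>U. openin (top_of_set GL) U \<longrightarrow> emeasure \<mu> U =
        (SUP K\<in>{K. compact K \<and> K \<subseteq> U}. emeasure \<mu> K))"

definition phi_tilde ::
  "('a::field ^ 'n ^ 'n) measure \<Rightarrow> (('a ^ 'n ^ 'n) \<times> ('a ^ 'n ^ 'n) \<Rightarrow> complex) \<Rightarrow> 'a \<Rightarrow> complex" where
  "phi_tilde \<mu> \<phi> t = (LINT h|\<mu>. \<phi> ((\<chi> i j. t * h $ i $ j), matrix_inv h))"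

end

theory Submission
  imports Defs "HOL-Library.Groups_Big_Fun"
begin

text \<open>
  The germ of \<open>\<phi>~\<close> at \<open>0\<close> depends only on \<open>\<phi>\<close> restricted to the pairs with \<open>X Y = Y X = 0\<close>, and it
  is unchanged under \<open>\<phi> \<mapsto> \<phi> (g X, Y g\<^sup>-\<^sup>1)\<close>, while \<open>\<phi> \<mapsto> \<phi> (\<pi> X, Y)\<close> acts on it as the shift
  \<open>T : f \<mapsto> f (\<pi> t)\<close>. Stratify these pairs by the rank of \<open>X\<close>. On the stratum of rank \<open>r\<close> with
  \<open>0 < r < n\<close> a matrix near a given one is \<open>(1 + b) P X\<close> with \<open>b\<close> in a unipotent block; translations in
  \<open>b\<close> come from \<open>GL\<close>, and scaling \<open>b\<close> multiplies sums over \<open>b\<close> by an index \<open>\<kappa> > 1\<close>. So up to such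
  translations \<open>T - \<kappa>\<close> pushes \<open>\<phi>\<close> to higher rank, and \<open>T - 1\<close> does so for \<open>r = 0\<close>. Applying
  finitely many of these operators leaves a function \<open>\<psi>\<close> supported on invertible \<open>X\<close>, whose germ is the
  constant \<open>\<integral> \<psi> (h, 0) dh\<close>.

  The same operators act on the zeta integral \<open>Z (z) = \<Sum> z ^ k \<integral> \<phi> (h, 0) dh\<close> over \<open>val (det h) = k\<close>
  through factors \<open>z ^ e - \<kappa>\<close> that do not vanish at \<open>1\<close>, and through \<open>z ^ -n - 1\<close> for \<open>T - 1\<close>; the
  constant above is the value at \<open>1\<close> of the resulting Laurent polynomial. If \<open>\<phi> (0, 0) = 0\<close> the factor
  \<open>z ^ -n - 1\<close> is not needed, so this value is \<open>\<phi> (0, 0)\<close> times that for the indicator \<open>\<omega>\<close> of the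
  integral matrices. Since \<open>D Z\<^sub>\<omega>\<close> is a nonzero constant for a Laurent polynomial \<open>D\<close> with
  \<open>D (1) = 0\<close>, the latter value is nonzero, and the vanishing of the germ forces \<open>\<phi> (0, 0) = 0\<close>.
\<close>

subsection \<open>Locally constant functions on zero-dimensional spaces\<close>

class zero_dimensional_space = topological_space +
  assumes ex_clopen_nhd: "open U \<Longrightarrow> x \<in> U \<Longrightarrow> \<exists>A. open A \<and> closed A \<and> x \<in> A \<and> A \<subseteq> U"

instance prod :: (zero_dimensional_space, zero_dimensional_space) zero_dimensional_space
proof
  fix U :: "('a \<times> 'b) set" and p
  assume "open U" "p \<in> U"
  then obtain S T where ST: "open S" "open T" "p \<in> S \<times> T" "S \<times> T \<subseteq> U"
    by (rule open_prod_elim)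
  obtain A where A: "open A" "closed A" "fst p \<in> A" "A \<subseteq> S"
    using ex_clopen_nhd[OF ST(1), of "fst p"] ST(3) by (auto simp: mem_Times_iff)
  obtain B where B: "open B" "closed B" "snd p \<in> B" "B \<subseteq> T"
    using ex_clopen_nhd[OF ST(2), of "snd p"] ST(3) by (auto simp: mem_Times_iff)
  show "\<exists>C. open C \<and> closed C \<and> p \<in> C \<and> C \<subseteq> U"
    using A B ST(4) by (intro exI[of _ "A \<times> B"]) (auto simp: open_Times closed_Times mem_Times_iff)
qed

instance vec :: (zero_dimensional_space, finite) zero_dimensional_space
proof
  fix U :: "('a ^ 'b) set" and x
  assume "open U" "x \<in> U"
  then obtain S where S: "\<And>i. open (S i)" "\<And>i. x $ i \<in> S i" "\<And>y. \<forall>i. y $ i \<in> S i \<Longrightarrow> y \<in> U"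
    unfolding open_vec_def by meson
  obtain A where A: "\<And>i. open (A i)" "\<And>i. closed (A i)" "\<And>i. x $ i \<in> A i" "\<And>i. A i \<subseteq> S i"
    using ex_clopen_nhd[OF S(1,2)] by metis
  show "\<exists>C. open C \<and> closed C \<and> x \<in> C \<and> C \<subseteq> U"
    using A S(3) by (intro exI[of _ "{y. \<forall>i. y $ i \<in> A i}"])
      (auto simp: open_vector_box closed_vector_box subset_iff)
qed

lemma compact_eventually_all:
  assumes "compact K" "\<And>x. x \<in> K \<Longrightarrow> \<forall>\<^sub>F (y, i) in nhds x \<times>\<^sub>F F. P y i"
  shows "\<forall>\<^sub>F i in F. \<forall>x\<in>K. P x i"
proof -
  have "\<exists>U Q. open U \<and> x \<in> U \<and> eventually Q F \<and> (\<forall>y\<in>U. \<forall>i. Q i \<longrightarrow> P y i)" if x: "x \<in> K" for x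
  proof -
    obtain R Q where "eventually R (nhds x)" "eventually Q F" "\<And>y i. R y \<Longrightarrow> Q i \<Longrightarrow> P y i"
      using assms(2)[OF x] unfolding eventually_prod_filter by auto
    then show ?thesis unfolding eventually_nhds by meson
  qed
  then obtain U Q where local_nhd: "\<And>x. x \<in> K \<Longrightarrow> open (U x)" "\<And>x. x \<in> K \<Longrightarrow> x \<in> U x"
    "\<And>x. x \<in> K \<Longrightarrow> eventually (Q x) F" "\<And>x y i. x \<in> K \<Longrightarrow> y \<in> U x \<Longrightarrow> Q x i \<Longrightarrow> P y i"
    by metis
  obtain C where finite_cover: "C \<subseteq> K" "finite C" "K \<subseteq> (\<Union>x\<in>C. U x)"
    by (rule compactE_image[OF assms(1), of K U]) (use local_nhd in auto)
  have "\<forall>\<^sub>F i in F. \<forall>x\<in>C. Q x i"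
    using finite_cover local_nhd(3) by (simp add: eventually_ball_finite subset_iff)
  then show ?thesis
    by (rule eventually_mono) (use finite_cover local_nhd(4) in blast)
qed

lemma finite_image_if_locally_constant:
  assumes "compact K" "\<And>x. x \<in> K \<Longrightarrow> \<forall>\<^sub>F y in nhds x. f y = f x"
  shows "finite (f ` K)"
proof -
  obtain U where local_nhd: "\<And>x. x \<in> K \<Longrightarrow> open (U x)" "\<And>x. x \<in> K \<Longrightarrow> x \<in> U x"
    "\<And>x y. x \<in> K \<Longrightarrow> y \<in> U x \<Longrightarrow> f y = f x"
    using assms(2) unfolding eventually_nhds by metis
  obtain C where "C \<subseteq> K" "finite C" "K \<subseteq> (\<Union>x\<in>C. U x)"
    by (rule compactE_image[OF assms(1), of K U]) (use local_nhd in auto)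
  then have "f ` K \<subseteq> f ` C" using local_nhd(3) by fastforce
  then show ?thesis using \<open>finite C\<close> by (simp add: finite_subset)
qed

lemma compact_ex_finite_clopen_cover:
  fixes K :: "'b::zero_dimensional_space set"
  assumes compact_K: "compact K" and local_Q: "\<And>x. x \<in> K \<Longrightarrow> \<exists>U. open U \<and> x \<in> U \<and> Q U"
    and mono: "\<And>A U. Q U \<Longrightarrow> A \<subseteq> U \<Longrightarrow> Q A"
  obtains \<C> where "finite \<C>" "\<And>C. C \<in> \<C> \<Longrightarrow> open C" "\<And>C. C \<in> \<C> \<Longrightarrow> closed C"
    "\<And>C. C \<in> \<C> \<Longrightarrow> Q C" "K \<subseteq> \<Union>\<C>"
proof -
  have "\<exists>C. open C \<and> closed C \<and> x \<in> C \<and> Q C" if "x \<in> K" for x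
    using local_Q[OF that] ex_clopen_nhd mono by metis
  then obtain C where clopen_nhd: "\<And>x. x \<in> K \<Longrightarrow> open (C x)" "\<And>x. x \<in> K \<Longrightarrow> closed (C x)"
    "\<And>x. x \<in> K \<Longrightarrow> x \<in> C x" "\<And>x. x \<in> K \<Longrightarrow> Q (C x)" by metis
  obtain I where finite_cover: "I \<subseteq> K" "finite I" "K \<subseteq> (\<Union>x\<in>I. C x)"
    by (rule compactE_image[OF compact_K, of K C]) (use clopen_nhd in auto)
  then show thesis using clopen_nhd by (intro that[of "C ` I"]) auto
qed

lemma clopen_restriction_induct:
  fixes f :: "'b::zero_dimensional_space \<Rightarrow> 'c::comm_monoid_add"
  assumes supp: "compact {x. f x \<noteq> 0}"
    and zero: "P (\<lambda>_. 0)"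
    and add: "\<And>g h. P g \<Longrightarrow> P h \<Longrightarrow> P (\<lambda>x. g x + h x)"
    and local: "\<And>x. f x \<noteq> 0 \<Longrightarrow>
      \<exists>U. open U \<and> x \<in> U \<and> (\<forall>A. open A \<longrightarrow> closed A \<longrightarrow> A \<subseteq> U \<longrightarrow> P (\<lambda>x. if x \<in> A then f x else 0))"
  shows "P f"
proof -
  let ?f = "\<lambda>A x. if x \<in> A then f x else 0"
  define good where "good U \<longleftrightarrow> (\<forall>A. open A \<longrightarrow> closed A \<longrightarrow> A \<subseteq> U \<longrightarrow> P (?f A))" for U
  have good_Un: "good (C \<union> D)" if clopen_C: "open C" "closed C" "good C" and good_D: "good D" for C D
    unfolding good_def
  proof (intro allI impI)
    fix A assume clopen_A: "open A" "closed A" "A \<subseteq> C \<union> D"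
    have "P (?f (A \<inter> C))" "P (?f (A - C))"
      using clopen_A clopen_C good_D unfolding good_def by (auto intro: open_Diff closed_Diff)
    then have "P (\<lambda>x. ?f (A \<inter> C) x + ?f (A - C) x)" by (rule add)
    also have "(\<lambda>x. ?f (A \<inter> C) x + ?f (A - C) x) = ?f A" by auto
    finally show "P (?f A)" .
  qed
  obtain \<C> where cover: "finite \<C>" "\<And>C. C \<in> \<C> \<Longrightarrow> open C" "\<And>C. C \<in> \<C> \<Longrightarrow> closed C"
    "\<And>C. C \<in> \<C> \<Longrightarrow> good C" "{x. f x \<noteq> 0} \<subseteq> \<Union>\<C>"
    by (rule compact_ex_finite_clopen_cover[OF supp, of good]) (use local in \<open>auto simp: good_def\<close>)
  have "good (\<Union>\<C>)"
    using cover(1-4)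
  proof (induction \<C> rule: finite_induct)
    case empty
    then show ?case using zero by (simp add: good_def)
  next
    case (insert C \<C>)
    then show ?case by (simp add: good_Un)
  qed
  moreover have "open (\<Union>\<C>)" "closed (\<Union>\<C>)" using cover(1-3) by auto
  ultimately have "P (?f (\<Union>\<C>))" unfolding good_def by blast
  also have "?f (\<Union>\<C>) = f" using cover(5) by (auto simp: fun_eq_iff)
  finally show ?thesis .
qed

lemma Cc_infty_eventually_eq:
  assumes "\<phi> \<in> Cc_infty" shows "\<forall>\<^sub>F y in nhds x. \<phi> y = \<phi> x"
proof -
  obtain U where "open U" "x \<in> U" "\<phi> constant_on U" using assms by (auto simp: Cc_infty_def)
  then show ?thesis unfolding eventually_nhds constant_on_def by (metis)
qed

lemma Cc_infty_continuous_on: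
  assumes "\<phi> \<in> Cc_infty" shows "continuous_on S \<phi>"
proof (rule continuous_on_subset[OF _ subset_UNIV], unfold continuous_on_def, rule ballI)
  fix x
  show "(\<phi> \<longlongrightarrow> \<phi> x) (at x within UNIV)"
    using Cc_infty_eventually_eq[OF assms, of x]
    by (intro tendsto_eventually) (simp add: eventually_at_filter eventually_mono)
qed

lemma Cc_infty_compact_support:
  assumes "\<phi> \<in> Cc_infty" shows "compact {x. \<phi> x \<noteq> 0}"
proof -
  have "open {x. \<phi> x = 0}"
  proof (subst open_subopen, rule ballI)
    fix x assume "x \<in> {x. \<phi> x = 0}"
    then show "\<exists>U. open U \<and> x \<in> U \<and> U \<subseteq> {x. \<phi> x = 0}"
      using Cc_infty_eventually_eq[OF assms, of x] unfolding eventually_nhds by auto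
  qed
  then have "closed {x. \<phi> x \<noteq> 0}" by (simp add: closed_def Collect_neg_eq)
  then show ?thesis using assms by (simp add: Cc_infty_def)
qed

lemma Cc_inftyI:
  fixes \<phi> :: "'b::t2_space \<Rightarrow> complex"
  assumes "\<And>x. \<forall>\<^sub>F y in nhds x. \<phi> y = \<phi> x" "compact K" "\<And>x. \<phi> x \<noteq> 0 \<Longrightarrow> x \<in> K"
  shows "\<phi> \<in> Cc_infty"
proof -
  have "closure {x. \<phi> x \<noteq> 0} \<subseteq> K"
    using assms by (intro closure_minimal compact_imp_closed) auto
  then have "compact (closure {x. \<phi> x \<noteq> 0})"
    using compact_Int_closed[OF assms(2), of "closure {x. \<phi> x \<noteq> 0}"] by (simp add: Int_absorb1)
  moreover have "\<exists>U. open U \<and> x \<in> U \<and> \<phi> constant_on U" for x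
    using assms(1)[of x] unfolding eventually_nhds constant_on_def by blast
  ultimately show ?thesis by (simp add: Cc_infty_def)
qed

lemma Cc_infty_zero: "(\<lambda>_. 0) \<in> Cc_infty"
  by (auto simp: Cc_infty_def constant_on_def intro: exI[of _ UNIV])

lemma Cc_infty_add:
  fixes \<phi> \<psi> :: "'b::t2_space \<Rightarrow> complex"
  assumes "\<phi> \<in> Cc_infty" "\<psi> \<in> Cc_infty" shows "(\<lambda>x. \<phi> x + \<psi> x) \<in> Cc_infty"
proof (rule Cc_inftyI)
  show "compact ({x. \<phi> x \<noteq> 0} \<union> {x. \<psi> x \<noteq> 0})"
    using assms by (intro compact_Un Cc_infty_compact_support)
  show "\<forall>\<^sub>F y in nhds x. \<phi> y + \<psi> y = \<phi> x + \<psi> x" for x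
    using assms[THEN Cc_infty_eventually_eq, of x] by eventually_elim simp
qed auto

lemma Cc_infty_cmult:
  fixes \<phi> :: "'b::t2_space \<Rightarrow> complex"
  assumes "\<phi> \<in> Cc_infty" shows "(\<lambda>x. c * \<phi> x) \<in> Cc_infty"
proof (rule Cc_inftyI)
  show "compact {x. \<phi> x \<noteq> 0}" using assms by (rule Cc_infty_compact_support)
  show "\<forall>\<^sub>F y in nhds x. c * \<phi> y = c * \<phi> x" for x
    using assms[THEN Cc_infty_eventually_eq, of x] by eventually_elim simp
qed auto

lemma Cc_infty_diff:
  fixes \<phi> \<psi> :: "'b::t2_space \<Rightarrow> complex"
  assumes "\<phi> \<in> Cc_infty" "\<psi> \<in> Cc_infty" shows "(\<lambda>x. \<phi> x - \<psi> x) \<in> Cc_infty"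
  using Cc_infty_add[OF assms(1) Cc_infty_cmult[OF assms(2), of "- 1"]] by simp

lemma Cc_infty_sum:
  fixes \<phi> :: "'i \<Rightarrow> 'b::t2_space \<Rightarrow> complex"
  shows "(\<And>i. i \<in> I \<Longrightarrow> \<phi> i \<in> Cc_infty) \<Longrightarrow> (\<lambda>x. \<Sum>i\<in>I. \<phi> i x) \<in> Cc_infty"
  by (induction I rule: infinite_finite_induct) (auto intro: Cc_infty_zero Cc_infty_add)

lemma eventually_mem_clopen_iff:
  assumes "open A" "closed A" shows "\<forall>\<^sub>F y in nhds x. y \<in> A \<longleftrightarrow> x \<in> A"
proof (cases "x \<in> A")
  case True
  then show ?thesis using assms(1) by (auto intro: eventually_mono[OF eventually_nhds_in_open])
next
  case False
  then have "\<forall>\<^sub>F y in nhds x. y \<in> - A"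
    using assms(2) by (intro eventually_nhds_in_open) auto
  then show ?thesis by (rule eventually_mono) (use False in auto)
qed

lemma Cc_infty_clopen_restriction:
  fixes \<phi> :: "'b::t2_space \<Rightarrow> complex"
  assumes "\<phi> \<in> Cc_infty" "open A" "closed A"
  shows "(\<lambda>x. if x \<in> A then \<phi> x else 0) \<in> Cc_infty"
proof (rule Cc_inftyI)
  show "compact {x. \<phi> x \<noteq> 0}" using assms(1) by (rule Cc_infty_compact_support)
  show "\<forall>\<^sub>F y in nhds x. (if y \<in> A then \<phi> y else 0) = (if x \<in> A then \<phi> x else 0)" for x
    using Cc_infty_eventually_eq[OF assms(1), of x] eventually_mem_clopen_iff[OF assms(2,3), of x]
    by eventually_elim auto
qed (auto split: if_splits)

lemma Cc_infty_compose:
  fixes \<phi> :: "'b::t2_space \<Rightarrow> complex" and f :: "'c::t2_space \<Rightarrow> 'b"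
  assumes "\<phi> \<in> Cc_infty" "continuous_on UNIV f" "compact K" "\<And>x. \<phi> (f x) \<noteq> 0 \<Longrightarrow> x \<in> K"
  shows "(\<lambda>x. \<phi> (f x)) \<in> Cc_infty"
proof (rule Cc_inftyI)
  show "\<forall>\<^sub>F y in nhds x. \<phi> (f y) = \<phi> (f x)" for x
  proof -
    have "filterlim f (nhds (f x)) (nhds x)"
      using assms(2)
      by (simp add: continuous_on_eq_continuous_at isCont_def tendsto_at_iff_tendsto_nhds)
    then show ?thesis
      by (rule eventually_compose_filterlim[OF Cc_infty_eventually_eq[OF assms(1)]])
  qed
qed (use assms in auto)

subsection \<open>Non-archimedean local fields\<close>

locale nonarch_valuation =
  fixes v :: "'a::nonarch_local_field \<Rightarrow> real"
  assumes nonarch: "nonarch_absolute_value v"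
    and open_iff_ball: "open U \<longleftrightarrow> (\<forall>x\<in>U. \<exists>e>0. \<forall>y. v (y - x) < e \<longrightarrow> y \<in> U)"
begin

lemma v_nonneg [simp]: "0 \<le> v x"
  and v_eq_0_iff [simp]: "v x = 0 \<longleftrightarrow> x = 0"
  and v_mult: "v (x * y) = v x * v y"
  and v_add_le_max: "v (x + y) \<le> max (v x) (v y)"
  using nonarch unfolding nonarch_absolute_value_def by blast+

lemma v_pos_iff [simp]: "0 < v x \<longleftrightarrow> x \<noteq> 0"
  using v_nonneg[of x] v_eq_0_iff[of x] by linarith

lemma v_1 [simp]: "v 1 = 1"
proof -
  have "v 1 = v 1 * v 1" using v_mult[of 1 1] by (simp only: mult_1)
  moreover have "v 1 \<noteq> 0" by simp
  ultimately show ?thesis by (metis mult_cancel_left1)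
qed

lemma v_0 [simp]: "v 0 = 0"
  using v_eq_0_iff by blast

lemma v_minus [simp]: "v (- x) = v x"
proof -
  have "v (-1) * v (-1) = 1"
    using v_mult[of "-1" "-1"] by simp
  then have "v (-1) = 1"
    using v_nonneg[of "-1"] by (metis abs_of_nonneg real_sqrt_abs2 real_sqrt_one)
  then show ?thesis
    using v_mult[of "-1" x] by simp
qed

lemma v_minus_commute: "v (x - y) = v (y - x)"
  using v_minus[of "x - y"] by simp

lemma v_add_le: "v x \<le> c \<Longrightarrow> v y \<le> c \<Longrightarrow> v (x + y) \<le> c"
  using v_add_le_max[of x y] by linarith

lemma v_diff_le: "v x \<le> c \<Longrightarrow> v y \<le> c \<Longrightarrow> v (x - y) \<le> c"
  using v_add_le[of x c "- y"] by simp

lemma v_sum_le: "(\<And>i. i \<in> I \<Longrightarrow> v (f i) \<le> c) \<Longrightarrow> 0 \<le> c \<Longrightarrow> v (sum f I) \<le> c"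
  by (induction I rule: infinite_finite_induct) (auto intro: v_add_le)

lemma v_prod: "v (prod f I) = (\<Prod>i\<in>I. v (f i))"
  by (induction I rule: infinite_finite_induct) (auto simp: v_mult)

lemma v_inverse: "v (inverse x) = inverse (v x)"
proof (cases "x = 0")
  case False
  then have "v x * v (inverse x) = 1"
    using v_mult[of x "inverse x"] by simp
  then show ?thesis
    by (simp add: inverse_unique)
qed simp

lemma v_divide: "v (x / y) = v x / v y"
  by (simp add: divide_inverse v_mult v_inverse)

lemma v_power: "v (x ^ n) = v x ^ n"
  by (induction n) (auto simp: v_mult)

lemma v_power_int: "v (x powi n) = v x powi n"
  by (simp add: power_int_def v_power v_inverse)

lemma v_eq_if_close:
  assumes "v (x - y) < v y" shows "v x = v y"
proof -
  have "v x \<le> max (v (x - y)) (v y)"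
    using v_add_le_max[of "x - y" y] by simp
  moreover have "v y \<le> max (v (y - x)) (v x)"
    using v_add_le_max[of "y - x" x] by simp
  ultimately show ?thesis
    using assms v_minus_commute[of x y] by linarith
qed

lemma v_add_le_sum: "v (x + y) \<le> v x + v y"
  using v_add_le_max[of x y] v_nonneg[of x] v_nonneg[of y] by linarith

lemma eventually_nhds_v: "eventually P (nhds x) \<longleftrightarrow> (\<exists>e>0. \<forall>y. v (y - x) < e \<longrightarrow> P y)"
proof
  assume "eventually P (nhds x)"
  then obtain U where "open U" "x \<in> U" "\<forall>y\<in>U. P y" by (auto simp: eventually_nhds)
  then show "\<exists>e>0. \<forall>y. v (y - x) < e \<longrightarrow> P y" using open_iff_ball by meson
next
  assume "\<exists>e>0. \<forall>y. v (y - x) < e \<longrightarrow> P y"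
  then obtain e where ball: "e > 0" "\<And>y. v (y - x) < e \<Longrightarrow> P y" by blast
  have "open {y. v (y - x) < e}"
    unfolding open_iff_ball
  proof clarsimp
    fix y assume "v (y - x) < e"
    moreover have "v (z - x) < e" if "v (z - y) < e" "v (y - x) < e" for z
      using v_add_le_max[of "z - y" "y - x"] that by simp
    ultimately show "\<exists>d>0. \<forall>z. v (z - y) < d \<longrightarrow> v (z - x) < e" using ball(1) by blast
  qed
  then show "eventually P (nhds x)"
    unfolding eventually_nhds using ball by (intro exI[of _ "{y. v (y - x) < e}"]) auto
qed

lemma open_contains_v_ball:
  assumes "open U" "x \<in> U" shows "\<exists>e>0. \<forall>y. v (y - x) < e \<longrightarrow> y \<in> U"
  using eventually_nhds_in_open[OF assms] unfolding eventually_nhds_v .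

lemma tendsto_iff_v: "(f \<longlongrightarrow> l) F \<longleftrightarrow> ((\<lambda>x. v (f x - l)) \<longlongrightarrow> 0) F"
proof -
  have "(f \<longlongrightarrow> l) F \<longleftrightarrow> (\<forall>e>0. \<forall>\<^sub>F x in F. v (f x - l) < e)"
  proof (intro iffI allI impI)
    fix e :: real assume f_lim: "(f \<longlongrightarrow> l) F" and "0 < e"
    then have "\<forall>\<^sub>F y in nhds l. v (y - l) < e" unfolding eventually_nhds_v by blast
    then show "\<forall>\<^sub>F x in F. v (f x - l) < e" using f_lim by (rule eventually_compose_filterlim)
  next
    assume f_lim: "\<forall>e>0. \<forall>\<^sub>F x in F. v (f x - l) < e"
    show "(f \<longlongrightarrow> l) F"
      unfolding filterlim_iff
    proof (intro allI impI)
      fix P assume "eventually P (nhds l)"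
      then obtain e where ball: "e > 0" "\<And>y. v (y - l) < e \<Longrightarrow> P y" by (auto simp: eventually_nhds_v)
      have "\<forall>\<^sub>F x in F. v (f x - l) < e" using f_lim ball(1) by blast
      then show "\<forall>\<^sub>F x in F. P (f x)" by (rule eventually_mono) (rule ball(2))
    qed
  qed
  then show ?thesis by (simp add: tendsto_iff)
qed

lemma tendsto_v: "(f \<longlongrightarrow> l) F \<Longrightarrow> ((\<lambda>x. v (f x)) \<longlongrightarrow> v l) F"
proof -
  assume "(f \<longlongrightarrow> l) F"
  then have lim: "((\<lambda>x. v (f x - l)) \<longlongrightarrow> 0) F" by (simp add: tendsto_iff_v)
  have "\<bar>v (f x) - v l\<bar> \<le> v (f x - l)" for x
    using v_add_le_sum[of "f x - l" l] v_add_le_sum[of "l - f x" "f x"] v_minus_commute[of l "f x"]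
    by simp
  then have "((\<lambda>x. v (f x) - v l) \<longlongrightarrow> 0) F"
    by (intro Lim_null_comparison[OF _ lim]) simp
  then show ?thesis by (rule Lim_null[THEN iffD2])
qed

lemma continuous_on_v [continuous_intros]:
  assumes "continuous_on S f" shows "continuous_on S (\<lambda>x. v (f x))"
  unfolding continuous_on_def
  by (intro ballI tendsto_v assms[unfolded continuous_on_def, rule_format])

lemma clopen_v_le:
  assumes "0 < c" shows "open {x. v (x - a) \<le> c}" "closed {x. v (x - a) \<le> c}"
proof -
  have "v (y - a) \<le> c \<longleftrightarrow> v (x - a) \<le> c" if "v (y - x) < c" for x y
    using v_add_le[of "y - x" c "x - a"] v_add_le[of "x - y" c "y - a"] that v_minus_commute[of x y]
    by auto
  then show "open {x. v (x - a) \<le> c}" "closed {x. v (x - a) \<le> c}"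
    unfolding closed_def open_iff_ball using assms by (auto intro!: exI[of _ c])
qed

lemma tendsto_add_v:
  fixes f g :: "'b \<Rightarrow> 'a"
  assumes "(f \<longlongrightarrow> a) F" "(g \<longlongrightarrow> b) F" shows "((\<lambda>x. f x + g x) \<longlongrightarrow> a + b) F"
proof -
  have lim: "((\<lambda>x. v (f x - a) + v (g x - b)) \<longlongrightarrow> 0) F"
    using tendsto_add[OF assms[unfolded tendsto_iff_v]] by simp
  have "v (f x + g x - (a + b)) \<le> v (f x - a) + v (g x - b)" for x
    using v_add_le_sum[of "f x - a" "g x - b"] by (simp add: algebra_simps)
  then have "((\<lambda>x. v (f x + g x - (a + b))) \<longlongrightarrow> 0) F"
    by (intro Lim_null_comparison[OF _ lim]) simp
  then show ?thesis by (simp only: tendsto_iff_v)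
qed

lemma tendsto_mult_v:
  fixes f g :: "'b \<Rightarrow> 'a"
  assumes "(f \<longlongrightarrow> a) F" "(g \<longlongrightarrow> b) F" shows "((\<lambda>x. f x * g x) \<longlongrightarrow> a * b) F"
proof -
  have "((\<lambda>x. v (f x - a) * v (g x) + v a * v (g x - b)) \<longlongrightarrow> 0 * v b + v a * 0) F"
    using assms by (intro tendsto_intros tendsto_v) (simp_all add: tendsto_iff_v)
  then have lim: "((\<lambda>x. v (f x - a) * v (g x) + v a * v (g x - b)) \<longlongrightarrow> 0) F" by simp
  have "f x * g x - a * b = (f x - a) * g x + a * (g x - b)" for x
    by (simp add: algebra_simps)
  then have "v (f x * g x - a * b) \<le> v (f x - a) * v (g x) + v a * v (g x - b)" for x
    using v_add_le_sum by (metis v_mult)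
  then have "((\<lambda>x. v (f x * g x - a * b)) \<longlongrightarrow> 0) F"
    by (intro Lim_null_comparison[OF _ lim]) simp
  then show ?thesis by (simp only: tendsto_iff_v)
qed

lemma tendsto_inverse_v:
  fixes f :: "'b \<Rightarrow> 'a"
  assumes "(f \<longlongrightarrow> a) F" "a \<noteq> 0" shows "((\<lambda>x. inverse (f x)) \<longlongrightarrow> inverse a) F"
proof -
  have "((\<lambda>x. v (f x - a) / (v (f x) * v a)) \<longlongrightarrow> 0 / (v a * v a)) F"
    using assms by (intro tendsto_intros tendsto_v) (simp_all add: tendsto_iff_v)
  then have lim: "((\<lambda>x. v (f x - a) / (v (f x) * v a)) \<longlongrightarrow> 0) F" by simp
  have "\<forall>\<^sub>F x in F. v (f x) \<noteq> 0"
    using assms by (intro tendsto_imp_eventually_ne[OF tendsto_v]) auto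
  then have "\<forall>\<^sub>F x in F. norm (v (inverse (f x) - inverse a)) \<le> v (f x - a) / (v (f x) * v a)"
  proof eventually_elim
    case (elim x)
    then have "inverse (f x) - inverse a = (a - f x) / (f x * a)"
      using assms(2) by (simp add: field_simps)
    then show ?case by (simp add: v_divide v_mult v_minus_commute[of a])
  qed
  then show ?thesis
    using Lim_null_comparison[OF _ lim] by (simp only: tendsto_iff_v)
qed

lemma ex_v_less:
  assumes "0 < e" obtains c where "c \<noteq> 0" "v c < e"
proof -
  obtain x where x_nontrivial: "x \<noteq> 0" "v x \<noteq> 1"
    using nonarch unfolding nonarch_absolute_value_def by blast
  define y where "y = (if v x < 1 then x else inverse x)"
  have y_small: "y \<noteq> 0" "v y < 1"
    using x_nontrivial by (auto simp: y_def v_inverse intro!: inverse_less_1_iff[THEN iffD2])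
  obtain n where "v y ^ n < e"
    using real_arch_pow_inv[OF assms y_small(2)] by blast
  then show thesis
    using y_small that[of "y ^ n"] by (simp add: v_power)
qed

end

lemma ex_nonarch_valuation: "\<exists>v::'a::nonarch_local_field \<Rightarrow> real. nonarch_valuation v"
  using ex_nonarch_absolute_value unfolding nonarch_valuation_def by blast

instance nonarch_local_field \<subseteq> topological_ab_group_add
proof
  obtain v :: "'a \<Rightarrow> real" where "nonarch_valuation v" using ex_nonarch_valuation by blast
  then interpret nonarch_valuation v .
  show "((\<lambda>x. fst x + snd x) \<longlongrightarrow> a + b) (nhds a \<times>\<^sub>F nhds b)" for a b :: 'a
    by (intro tendsto_add_v filterlim_fst filterlim_snd)
  show "(uminus \<longlongrightarrow> - a) (nhds a)" for a :: 'a
    using tendsto_mult_v[OF tendsto_const[of "- 1"] filterlim_ident[of "nhds a"]] by simp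
qed

instance nonarch_local_field \<subseteq> topological_comm_monoid_mult
proof
  obtain v :: "'a \<Rightarrow> real" where "nonarch_valuation v" using ex_nonarch_valuation by blast
  then interpret nonarch_valuation v .
  show "((\<lambda>x. fst x * snd x) \<longlongrightarrow> a * b) (nhds a \<times>\<^sub>F nhds b)" for a b :: 'a
    by (intro tendsto_mult_v filterlim_fst filterlim_snd)
qed

instance nonarch_local_field \<subseteq> zero_dimensional_space
proof
  obtain v :: "'a \<Rightarrow> real" where "nonarch_valuation v" using ex_nonarch_valuation by blast
  then interpret nonarch_valuation v .
  fix U :: "'a set" and x
  assume "open U" "x \<in> U"
  then obtain e where e: "e > 0" "\<And>y. v (y - x) < e \<Longrightarrow> y \<in> U" using open_contains_v_ball by blast
  let ?A = "{y. v (y - x) \<le> e / 2}"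
  have "0 < e / 2" using e(1) by simp
  then have "open ?A" "closed ?A" by (rule clopen_v_le)+
  moreover have "x \<in> ?A" using e(1) by simp
  moreover have "?A \<subseteq> U" using e by force
  ultimately show "\<exists>A. open A \<and> closed A \<and> x \<in> A \<and> A \<subseteq> U" by blast
qed

instance nonarch_local_field \<subseteq> t2_space
proof
  obtain v :: "'a \<Rightarrow> real" where "nonarch_valuation v" using ex_nonarch_valuation by blast
  then interpret nonarch_valuation v .
  fix x y :: 'a
  assume "x \<noteq> y"
  let ?A = "{z. v (z - x) \<le> v (y - x) / 2}"
  have "0 < v (y - x) / 2" using \<open>x \<noteq> y\<close> by simp
  then have "open ?A" "open (- ?A)" by (simp_all only: clopen_v_le open_Compl)
  moreover have "x \<in> ?A" "y \<in> - ?A" using \<open>x \<noteq> y\<close> by simp_all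
  ultimately show "\<exists>U V. open U \<and> open V \<and> x \<in> U \<and> y \<in> V \<and> U \<inter> V = {}" by (metis Compl_disjoint)
qed

instance nonarch_local_field \<subseteq> perfect_space
proof
  obtain v :: "'a \<Rightarrow> real" where "nonarch_valuation v" using ex_nonarch_valuation by blast
  then interpret nonarch_valuation v .
  fix x :: 'a
  show "\<not> open {x}"
  proof
    assume "open {x}"
    then obtain e where e: "e > 0" "\<And>y. v (y - x) < e \<Longrightarrow> y \<in> {x}"
      using open_contains_v_ball[of "{x}" x] by blast
    obtain c where "c \<noteq> 0" "v c < e" using ex_v_less[OF e(1)] .
    then show False using e(2)[of "x + c"] by simp
  qed
qed

lemma tendsto_inverse_nonarch [tendsto_intros]:
  fixes a :: "'a::nonarch_local_field"
  assumes "(f \<longlongrightarrow> a) F" "a \<noteq> 0" shows "((\<lambda>x. inverse (f x)) \<longlongrightarrow> inverse a) F"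
proof -
  obtain v :: "'a \<Rightarrow> real" where "nonarch_valuation v" using ex_nonarch_valuation by blast
  then interpret nonarch_valuation v .
  show ?thesis using assms by (rule tendsto_inverse_v)
qed

context nonarch_valuation
begin

lemma compact_v_le: "compact {x. v x \<le> r}"
proof (cases "0 < r")
  case True
  obtain U K where compact_nhd: "open U" "compact K" "0 \<in> U" "U \<subseteq> (K::'a set)"
    using locally_compact[of "0::'a"] by blast
  obtain e where ball: "e > 0" "\<And>y. v (y - 0) < e \<Longrightarrow> y \<in> U"
    using open_contains_v_ball[OF compact_nhd(1,3)] by blast
  obtain c where small: "c \<noteq> 0" "v c < e / r"
    using ex_v_less[of "e / r"] True ball by auto
  have "compact (K \<inter> {x. v (x - 0) \<le> r * v c})"
    using True small by (intro compact_Int_closed[OF compact_nhd(2)] clopen_v_le(2)) simp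
  moreover have "r * v c < e" using small True by (simp add: field_simps)
  then have "{x. v x \<le> r * v c} \<subseteq> K" using ball(2) compact_nhd(4) by auto
  ultimately have "compact {x. v x \<le> r * v c}" by (simp add: Int_absorb1)
  then have "compact ((\<lambda>x. x * inverse c) ` {x. v x \<le> r * v c})"
    by (intro compact_continuous_image continuous_on_mult' continuous_on_id continuous_on_const)
  also have "(\<lambda>x. x * inverse c) ` {x. v x \<le> r * v c} = {x. v x \<le> r}"
  proof (intro equalityI subsetI)
    fix x assume "x \<in> {x. v x \<le> r}"
    then show "x \<in> (\<lambda>x. x * inverse c) ` {x. v x \<le> r * v c}"
      using small by (intro image_eqI[of _ _ "x * c"]) (auto simp: v_mult)
  next
    fix x assume "x \<in> (\<lambda>x. x * inverse c) ` {x. v x \<le> r * v c}"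
    then show "x \<in> {x. v x \<le> r}" using small
      by (auto simp: v_divide divide_le_eq simp flip: divide_inverse)
  qed
  finally show ?thesis .
next
  case False
  then have "{x. v x \<le> r} \<subseteq> {0}"
    by (auto simp: not_less) (metis antisym order_trans v_eq_0_iff v_nonneg)
  then show ?thesis by (meson finite.emptyI finite_imp_compact finite_insert finite_subset)
qed

lemma ex_uniformizer: "\<exists>w. w \<noteq> 0 \<and> v w < 1 \<and> (\<forall>x. v x < 1 \<longrightarrow> v x \<le> v w)"
proof -
  have "v y < 1 \<longleftrightarrow> v x < 1" if "v (y - x) < 1" for x y
    using v_add_le_max[of "y - x" x] v_add_le_max[of "x - y" y] that v_minus_commute[of x y] by auto
  then have "closed {x. v x < 1}"
    unfolding closed_def open_iff_ball by (auto intro!: exI[of _ 1])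
  then have "compact ({x. v x \<le> 1} \<inter> {x. v x < 1})" by (rule compact_Int_closed[OF compact_v_le])
  moreover have "{x. v x \<le> 1} \<inter> {x. v x < 1} = {x. v x < 1}" by auto
  moreover have "{x. v x < 1} \<noteq> {}" using v_0 zero_less_one by (metis empty_iff mem_Collect_eq)
  ultimately obtain w where w_max: "v w < 1" "\<And>x. v x < 1 \<Longrightarrow> v x \<le> v w"
    using continuous_attains_sup[of "{x. v x < 1}" v] continuous_on_v[OF continuous_on_id] by auto
  obtain c where small: "c \<noteq> 0" "v c < 1" using ex_v_less[of 1] by auto
  then have "w \<noteq> 0" using w_max(2)[of c] v_pos_iff[of c] v_0 by fastforce
  with w_max show ?thesis by blast
qed

end

locale uniformized = nonarch_valuation v for v :: "'a::nonarch_local_field \<Rightarrow> real" +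
  fixes \<pi> :: 'a
  assumes unif_nz [simp]: "\<pi> \<noteq> 0" and unif_less: "v \<pi> < 1"
    and unif_max: "v x < 1 \<Longrightarrow> v x \<le> v \<pi>"
begin

abbreviation q :: "int \<Rightarrow> real" where "q k \<equiv> v \<pi> powi k"

lemma q_pos [simp]: "0 < q k"
  by (simp add: zero_less_power_int)

lemma q_add: "q (a + b) = q a * q b"
  by (simp add: power_int_add)

lemma q_less_iff [simp]: "q a < q b \<longleftrightarrow> b < a"
proof (cases a b rule: linorder_cases)
  case less
  then show ?thesis using power_int_strict_decreasing[of a b "v \<pi>"] unif_less by simp
next
  case greater
  then show ?thesis using power_int_strict_decreasing[of b a "v \<pi>"] unif_less by simp
qed simp

lemma q_le_iff [simp]: "q a \<le> q b \<longleftrightarrow> b \<le> a"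
  using q_less_iff[of b a] by linarith

lemma q_eq_iff [simp]: "q a = q b \<longleftrightarrow> a = b"
  using q_le_iff[of a b] q_le_iff[of b a] by linarith

lemma tendsto_q: "(\<lambda>k. q (int k)) \<longlonglongrightarrow> 0"
  using LIMSEQ_realpow_zero[of "v \<pi>"] unif_less by simp

lemma v_eq_q:
  assumes "x \<noteq> 0" shows "\<exists>k. v x = q k"
proof -
  define k where "k = \<lfloor>log (v \<pi>) (v x)\<rfloor>"
  have q_powr: "q j = v \<pi> powr real_of_int j" for j by (simp add: powr_real_of_int')
  have powr_log: "v \<pi> powr log (v \<pi>) (v x) = v x"
    using assms unif_less by simp
  have "v \<pi> powr log (v \<pi>) (v x) \<le> q k" "q (k + 1) < v \<pi> powr log (v \<pi>) (v x)"
    using unif_less unfolding q_powr by (auto simp: k_def intro!: powr_mono' powr_less_mono')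
  then have "v (x / \<pi> powi k) \<le> 1" "v \<pi> < v (x / \<pi> powi k)"
    using powr_log by (simp_all add: v_divide v_power_int q_add field_simps)
  then have "v (x / \<pi> powi k) = 1" using unif_max[of "x / \<pi> powi k"] by force
  then show ?thesis by (intro exI[of _ k]) (simp add: v_divide v_power_int field_simps)
qed

definition val :: "'a \<Rightarrow> int" where "val x = (SOME k. v x = q k)"

lemma v_eq_q_val: "x \<noteq> 0 \<Longrightarrow> v x = q (val x)"
  unfolding val_def by (rule someI_ex[OF v_eq_q])

lemma val_eqI: "v x = q k \<Longrightarrow> val x = k"
  unfolding val_def by (rule some_equality) auto

lemma val_mult: "x \<noteq> 0 \<Longrightarrow> y \<noteq> 0 \<Longrightarrow> val (x * y) = val x + val y"
  using v_eq_q_val[of x] v_eq_q_val[of y] by (intro val_eqI) (metis v_mult q_add)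

lemma val_locally_constant:
  assumes "x \<noteq> 0" shows "\<forall>\<^sub>F y in nhds x. val y = val x"
proof -
  have "val y = val x" if "v (y - x) < v x" for y
    using v_eq_if_close[OF that] by (simp add: val_def)
  then show ?thesis using assms unfolding eventually_nhds_v by (metis v_pos_iff)
qed

end

subsection \<open>Square matrices over a field\<close>

definition scale_mat :: "'a::semiring_1 \<Rightarrow> 'a^'n^'m \<Rightarrow> 'a^'n^'m" (infixr "*\<^sub>m" 75) where
  "c *\<^sub>m A = (\<chi> i j. c * A $ i $ j)"

lemma scale_mat_nth [simp]: "(c *\<^sub>m A) $ i $ j = c * A $ i $ j"
  by (simp add: scale_mat_def)

lemma matrix_add_rdistrib: "(A + B) ** C = A ** C + B ** (C :: 'a::ring_1^'n^'n)"
  and matrix_diff_ldistrib: "A ** (B - C) = A ** B - A ** C"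
  and matrix_diff_rdistrib: "(A - B) ** C = A ** C - B ** C"
  and matrix_minus_left: "(- A) ** C = - (A ** C)"
  and matrix_minus_right: "A ** (- C) = - (A ** C)"
  by (simp_all add: matrix_matrix_mult_def vec_eq_iff sum.distrib sum_subtractf sum_negf algebra_simps)

lemma scale_mat_mult_left: "c *\<^sub>m A ** B = c *\<^sub>m (A ** B)"
  and scale_mat_mult_right: "A ** c *\<^sub>m B = c *\<^sub>m (A ** B)" for c :: "'a::comm_ring_1"
  by (simp_all add: matrix_matrix_mult_def vec_eq_iff sum_distrib_left mult_ac)

lemma scale_mat_add: "c *\<^sub>m (A + B) = c *\<^sub>m A + c *\<^sub>m B"
  and scale_mat_diff: "c *\<^sub>m (A - B) = c *\<^sub>m A - c *\<^sub>m B"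
  and scale_mat_scale_mat: "c *\<^sub>m d *\<^sub>m A = (c * d) *\<^sub>m A"
  and scale_mat_1 [simp]: "1 *\<^sub>m A = A"
  and scale_mat_0_left [simp]: "0 *\<^sub>m A = 0"
  and scale_mat_0 [simp]: "c *\<^sub>m 0 = 0"
  and scale_mat_minus: "c *\<^sub>m (- A) = - (c *\<^sub>m A)"
  and scale_mat_minus_left: "(- c) *\<^sub>m A = - (c *\<^sub>m A)" for c :: "'a::comm_ring_1"
  by (simp_all add: vec_eq_iff algebra_simps)

lemmas mat_algebra = matrix_add_ldistrib matrix_add_rdistrib matrix_diff_ldistrib matrix_diff_rdistrib
  matrix_minus_left matrix_minus_right scale_mat_mult_left scale_mat_mult_right scale_mat_add
  scale_mat_diff scale_mat_scale_mat scale_mat_minus matrix_mul_assoc[symmetric]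

lemma matrix_mul_assoc_eq: "U ** W = D \<Longrightarrow> U ** (W ** C) = D ** C"
  by (simp add: matrix_mul_assoc)

lemma det_scale_mat: "det (c *\<^sub>m (A::'a::comm_ring_1^'n^'n)) = c ^ CARD('n) * det A"
  by (simp add: det_def scale_mat_def prod.distrib sum_distrib_left mult_ac)

lemma GL_iff_det: "h \<in> GL \<longleftrightarrow> det h \<noteq> 0"
  by (simp add: GL_def invertible_det_nz)

lemma matrix_inv_left_right:
  assumes "(A::'a::field^'n^'n) \<in> GL"
  shows "A ** matrix_inv A = mat 1" "matrix_inv A ** A = mat 1"
  using someI_ex[OF assms[unfolded GL_def invertible_def mem_Collect_eq]]
  by (simp_all add: matrix_inv_def)

lemma matrix_inv_eqI:
  assumes "(A::'a::field^'n^'n) ** B = mat 1"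
  shows "matrix_inv A = B" "A \<in> GL"
proof -
  show "A \<in> GL" using assms by (auto simp: GL_def invertible_right_inverse)
  then show "matrix_inv A = B"
    by (metis assms matrix_inv_left_right(2) matrix_mul_assoc matrix_mul_lid matrix_mul_rid)
qed

lemma GL_mult: "g \<in> GL \<Longrightarrow> h \<in> GL \<Longrightarrow> g ** h \<in> GL"
  by (simp add: GL_iff_det det_mul)

lemma GL_scale_mat: "c \<noteq> 0 \<Longrightarrow> h \<in> GL \<Longrightarrow> c *\<^sub>m h \<in> GL"
  by (simp add: GL_iff_det det_scale_mat)

lemma GL_one: "mat 1 \<in> GL"
  by (simp add: GL_iff_det)

lemma matrix_inv_GL: "h \<in> GL \<Longrightarrow> matrix_inv h \<in> GL"
  using matrix_inv_left_right(2) matrix_inv_eqI(2) by blast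

lemma matrix_inv_one: "matrix_inv (mat 1) = (mat 1 :: 'a::field^'n^'n)"
  by (intro matrix_inv_eqI) simp

lemma matrix_inv_mult:
  assumes "g \<in> GL" "h \<in> GL"
  shows "matrix_inv (g ** h) = matrix_inv h ** matrix_inv g"
  using assms matrix_inv_left_right[of g] matrix_inv_left_right[of h]
  by (intro matrix_inv_eqI) (metis matrix_mul_assoc matrix_mul_rid)

lemma matrix_inv_scale_mat:
  assumes "c \<noteq> 0" "h \<in> GL"
  shows "matrix_inv (c *\<^sub>m h) = inverse c *\<^sub>m matrix_inv h"
  using assms by (intro matrix_inv_eqI) (simp add: mat_algebra matrix_inv_left_right)

lemma det_replace_column:
  fixes g x :: "'a::field^'n^'n"
  assumes "g \<in> GL"
  shows "det (\<chi> i j. if j = k then x $ i $ l else g $ i $ j) = (matrix_inv g ** x) $ k $ l * det g"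
proof -
  define y where "y = column l (matrix_inv g ** x)"
  have "(g *v y) $ i = x $ i $ l" for i
  proof -
    have "(g *v y) $ i = (g ** (matrix_inv g ** x)) $ i $ l"
      by (simp add: y_def matrix_vector_mult_def matrix_matrix_mult_def column_def)
    then show ?thesis using assms by (simp add: matrix_mul_assoc matrix_inv_left_right)
  qed
  moreover have "y $ k = (matrix_inv g ** x) $ k $ l" by (simp add: y_def column_def)
  ultimately show ?thesis using cramer_lemma[of k g y] by (simp only:)
qed

text \<open>The library develops \<open>rank\<close>, the row rank, over the reals only.\<close>

definition col_rank :: "'a::field^'n^'m \<Rightarrow> nat" where
  "col_rank X = vec.dim (range ((*v) X))"

lemma col_rank_mult_le_left: "col_rank (A ** B) \<le> col_rank A"
  unfolding col_rank_def by (rule vec.dim_subset) (auto simp: matrix_vector_mul_assoc[symmetric])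

lemma col_rank_mult_le_right: "col_rank (A ** B) \<le> col_rank B"
proof -
  have "range ((*v) (A ** B)) = (*v) A ` range ((*v) B)"
    by (auto simp: matrix_vector_mul_assoc[symmetric])
  then show ?thesis
    unfolding col_rank_def by (simp add: vec.dim_image_le matrix_vector_mul_linear_gen)
qed

lemma col_rank_eq_0_iff: "col_rank X = 0 \<longleftrightarrow> X = 0"
proof -
  have "col_rank X = 0 \<longleftrightarrow> range ((*v) X) \<subseteq> {0}"
    unfolding col_rank_def by simp
  also have "\<dots> \<longleftrightarrow> X = 0"
    by (auto simp: matrix_eq)
  finally show ?thesis .
qed

lemma col_rank_less_iff: "col_rank (X::'a::field^'n^'n) < CARD('n) \<longleftrightarrow> X \<notin> GL"
proof -
  have "col_rank X \<le> CARD('n)"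
    unfolding col_rank_def using vec.dim_subset[of "range ((*v) X)" UNIV]
    by (simp only: vec_dim_card) simp
  moreover have "col_rank X = CARD('n) \<longleftrightarrow> surj ((*v) X)"
  proof
    assume "col_rank X = CARD('n)"
    then have "range ((*v) X) = UNIV"
      by (intro vec.subspace_dim_equal vec.subspace_UNIV vec.linear_subspace_image
            matrix_vector_mul_linear_gen) (auto simp: col_rank_def vec_dim_card simp del: vec.dim_UNIV)
    then show "surj ((*v) X)" .
  qed (simp add: col_rank_def vec_dim_card del: vec.dim_UNIV)
  moreover have "surj ((*v) X) \<longleftrightarrow> X \<in> GL"
    by (simp add: GL_def invertible_right_inverse matrix_right_invertible_surjective)
  ultimately show ?thesis by linarith
qed

lemma col_rank_mult_GL_left:
  fixes X :: "'a::field^'n^'n"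
  assumes "g \<in> GL" shows "col_rank (g ** X) = col_rank X"
proof (rule antisym[OF col_rank_mult_le_right])
  have "matrix_inv g ** (g ** X) = X"
    using assms by (simp add: matrix_mul_assoc matrix_inv_left_right)
  then show "col_rank X \<le> col_rank (g ** X)"
    by (metis col_rank_mult_le_right)
qed

lemma ex_generalized_inverse: "\<exists>R. X ** R ** X = (X::'a::field^'n^'n)"
proof -
  obtain g where right_inverse: "Vector_Spaces.linear (*s) (*s) g" "\<forall>v\<in>range ((*v) X). X *v (g v) = v"
    using vec.linear_exists_right_inverse_on[OF matrix_vector_mul_linear_gen[of X] vec.subspace_UNIV]
    by auto
  have "matrix g *v y = g y" for y
    using matrix_works[OF right_inverse(1)] by simp
  then have "X ** matrix g ** X = X"
    using right_inverse(2) by (auto simp: matrix_eq matrix_vector_mul_assoc[symmetric])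
  then show ?thesis by blast
qed

lemma mult_left_cancel_if_col_rank_le:
  fixes P X Y Z :: "'a::field^'n^'n"
  assumes rank: "col_rank X \<le> col_rank (P ** X)" and eq: "P ** X ** Y = P ** X ** Z"
  shows "X ** Y = X ** Z"
proof -
  let ?S = "range ((*v) X)"
  have subspace: "vec.subspace ?S"
    by (intro vec.linear_subspace_image matrix_vector_mul_linear_gen vec.subspace_UNIV)
  obtain B where basis: "B \<subseteq> ?S" "vec.independent B" "?S \<subseteq> vec.span B" "card B = vec.dim ?S"
    using vec.basis_exists by blast
  have finite_B: "finite B" using basis(2) by (rule vec.finiteI_independent)
  have span_B: "vec.span B = ?S" using basis subspace by (simp add: vec.span_subspace)
  have span_PB: "vec.span ((*v) P ` B) = (*v) P ` ?S"
    using vec.linear_span_image[OF matrix_vector_mul_linear_gen, of P B] span_B by simp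
  have "(*v) P ` ?S = range ((*v) (P ** X))" by (auto simp: matrix_vector_mul_assoc[symmetric])
  then have dim: "card B \<le> vec.dim ((*v) P ` ?S)" using rank basis(4) by (simp add: col_rank_def)
  also have "\<dots> \<le> card ((*v) P ` B)"
    using span_PB finite_B by (intro vec.dim_le_card) auto
  finally have "card ((*v) P ` B) = card B" using card_image_le[OF finite_B, of "(*v) P"] by linarith
  then have inj_B: "inj_on ((*v) P) B" using finite_B by (simp add: eq_card_imp_inj_on)
  have "vec.independent ((*v) P ` B)"
    using basis(1) span_PB finite_B dim card_image_le[OF finite_B, of "(*v) P"]
    by (intro vec.card_le_dim_spanning[of _ "(*v) P ` ?S"]) auto
  then have inj: "inj_on ((*v) P) ?S"
    using vec.linear_inj_on_span_independent_image[OF matrix_vector_mul_linear_gen _ inj_B] span_B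
    by simp
  have "X *v (Y *v z) = X *v (Z *v z)" for z
  proof (rule inj_onD[OF inj])
    have "(P ** X ** Y) *v z = (P ** X ** Z) *v z" by (simp add: eq)
    then show "P *v (X *v (Y *v z)) = P *v (X *v (Z *v z))"
      by (simp add: matrix_vector_mul_assoc matrix_mul_assoc)
  qed auto
  then show ?thesis by (simp add: matrix_eq matrix_vector_mul_assoc[symmetric])
qed

lemma ex_two_sided_mult_nz:
  fixes Q P :: "'a::field^'n^'n"
  assumes "Q \<noteq> 0" "P \<noteq> 0" shows "\<exists>E. Q ** E ** P \<noteq> 0"
proof -
  obtain i j where Q_nz: "Q $ i $ j \<noteq> 0" using assms(1) by (auto simp: vec_eq_iff)
  obtain k l where P_nz: "P $ k $ l \<noteq> 0" using assms(2) by (auto simp: vec_eq_iff)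
  define E :: "'a^'n^'n" where "E = (\<chi> a b. if a = j then if b = k then 1 else 0 else 0)"
  have "(Q ** E) $ i $ b = (if b = k then Q $ i $ j else 0)" for b
    by (simp add: matrix_matrix_mult_def E_def if_distrib cong: if_cong)
  then have "(Q ** E ** P) $ i $ l = (\<Sum>b\<in>UNIV. if b = k then Q $ i $ j * P $ b $ l else 0)"
    unfolding matrix_matrix_mult_def[of "Q ** E"] by (simp add: mult_delta_left)
  also have "\<dots> = Q $ i $ j * P $ k $ l" by simp
  finally have "(Q ** E ** P) $ i $ l \<noteq> 0" using Q_nz P_nz by simp
  then show ?thesis by (metis zero_index)
qed

subsection \<open>Topology of matrix spaces\<close>

instance vec :: (topological_monoid_add, finite) topological_monoid_add
proof
  show "((\<lambda>x. fst x + snd x) \<longlongrightarrow> a + b) (nhds a \<times>\<^sub>F nhds b)" for a b :: "'a^'b"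
    by (rule vec_tendstoI) (auto intro!: tendsto_add tendsto_vec_nth filterlim_fst filterlim_snd)
qed

instance vec :: (topological_comm_monoid_add, finite) topological_comm_monoid_add ..

instance vec :: (topological_group_add, finite) topological_group_add
proof
  show "(uminus \<longlongrightarrow> - a) (nhds a)" for a :: "'a^'b"
    by (rule vec_tendstoI) (auto intro!: tendsto_minus tendsto_vec_nth filterlim_ident)
qed

instance vec :: (topological_ab_group_add, finite) topological_ab_group_add ..

instance vec :: (t0_space, finite) t0_space
proof
  fix x y :: "'a^'b" assume "x \<noteq> y"
  then obtain i where i: "x $ i \<noteq> y $ i" by (auto simp: vec_eq_iff)
  obtain U where "open U" "\<not> (x $ i \<in> U \<longleftrightarrow> y $ i \<in> U)" using i separation_t0[of "x $ i" "y $ i"] by auto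
  then show "\<exists>U. open U \<and> \<not> (x \<in> U \<longleftrightarrow> y \<in> U)"
    by (intro exI[of _ "(\<lambda>x. x $ i) -` U"]) (simp add: open_vimage_vec_nth)
qed

instance vec :: (t1_space, finite) t1_space
proof
  fix x y :: "'a^'b" assume "x \<noteq> y"
  then obtain i where i: "x $ i \<noteq> y $ i" by (auto simp: vec_eq_iff)
  obtain U where "open U" "x $ i \<in> U" "y $ i \<notin> U" using i separation_t1[of "x $ i" "y $ i"] by auto
  then show "\<exists>U. open U \<and> x \<in> U \<and> y \<notin> U"
    by (intro exI[of _ "(\<lambda>x. x $ i) -` U"]) (simp add: open_vimage_vec_nth)
qed

instance vec :: (t2_space, finite) t2_space
proof
  fix x y :: "'a^'b" assume "x \<noteq> y"
  then obtain i where i: "x $ i \<noteq> y $ i" by (auto simp: vec_eq_iff)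
  obtain U V where "open U" "open V" "x $ i \<in> U" "y $ i \<in> V" "U \<inter> V = {}"
    using hausdorff[OF i] by auto
  then show "\<exists>U V. open U \<and> open V \<and> x \<in> U \<and> y \<in> V \<and> U \<inter> V = {}"
    by (intro exI[of _ "(\<lambda>x. x $ i) -` U"] exI[of _ "(\<lambda>x. x $ i) -` V"])
      (auto simp: open_vimage_vec_nth)
qed

lemma compact_vec_box:
  assumes "compact (S::'a::topological_space set)"
  shows "compact {x::'a^'n. \<forall>i. x $ i \<in> S}"
proof -
  have "compactin (product_topology (\<lambda>_. euclidean) UNIV) (PiE UNIV (\<lambda>_::'n. S))"
    using assms by (simp add: compactin_PiE)
  moreover have "continuous_map (product_topology (\<lambda>_. euclidean) UNIV) euclidean
      (vec_lambda :: ('n \<Rightarrow> 'a) \<Rightarrow> 'a^'n)"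
    unfolding continuous_map_def
  proof (intro conjI allI impI)
    fix U :: "('a^'n) set" assume "openin euclidean U"
    then have open_U: "open U" by simp
    have "\<exists>A. (\<forall>i\<in>UNIV. openin euclidean (A i)) \<and> f \<in> PiE UNIV A
        \<and> PiE UNIV A \<subseteq> {x. vec_lambda x \<in> U}" if f_in_U: "vec_lambda f \<in> U" for f
    proof -
      obtain A where box: "\<forall>i. open (A i) \<and> vec_lambda f $ i \<in> A i" "\<forall>y. (\<forall>i. y $ i \<in> A i) \<longrightarrow> y \<in> U"
        using open_U f_in_U unfolding open_vec_def by blast
      then show ?thesis by (intro exI[of _ A]) (auto simp: PiE_iff)
    qed
    then show "openin (product_topology (\<lambda>_. euclidean) UNIV)
        {x \<in> topspace (product_topology (\<lambda>_. euclidean) UNIV). vec_lambda x \<in> U}"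
      by (simp add: openin_product_topology_alt)
  qed simp
  ultimately have "compact (vec_lambda ` (PiE UNIV (\<lambda>_::'n. S)) :: ('a^'n) set)"
    using image_compactin compactin_euclidean_iff by blast
  moreover have "vec_lambda ` (PiE UNIV (\<lambda>_::'n. S)) = {x::'a^'n. \<forall>i. x $ i \<in> S}"
  proof (intro set_eqI iffI)
    fix x :: "'a^'n" assume "x \<in> {x. \<forall>i. x $ i \<in> S}"
    then show "x \<in> vec_lambda ` (PiE UNIV (\<lambda>_::'n. S))"
      by (intro image_eqI[of _ _ "\<lambda>i. x $ i"]) auto
  qed auto
  ultimately show ?thesis by simp
qed

lemma tendsto_matrix_mult [tendsto_intros]:
  fixes A :: "'a::{semiring_1,topological_semigroup_mult,topological_comm_monoid_add}^'n^'m"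
  assumes "(f \<longlongrightarrow> A) F" "(g \<longlongrightarrow> B) F" shows "((\<lambda>x. f x ** g x) \<longlongrightarrow> A ** B) F"
  unfolding matrix_matrix_mult_def by (intro tendsto_intros assms)

lemma tendsto_scale_mat [tendsto_intros]:
  fixes A :: "'a::{semiring_1,topological_semigroup_mult}^'n^'m"
  assumes "(f \<longlongrightarrow> c) F" "(g \<longlongrightarrow> A) F" shows "((\<lambda>x. f x *\<^sub>m g x) \<longlongrightarrow> c *\<^sub>m A) F"
  unfolding scale_mat_def by (intro tendsto_intros assms)

lemma tendsto_det [tendsto_intros]:
  fixes A :: "'a::{comm_ring_1,topological_comm_monoid_mult,topological_comm_monoid_add}^'n^'n"
  assumes "(f \<longlongrightarrow> A) F" shows "((\<lambda>x. det (f x)) \<longlongrightarrow> det A) F"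
  unfolding det_def by (intro tendsto_intros assms)

lemma eventually_GL:
  fixes A :: "'a::nonarch_local_field^'n^'n"
  assumes "(f \<longlongrightarrow> A) F" "A \<in> GL" shows "\<forall>\<^sub>F x in F. f x \<in> GL"
  using tendsto_imp_eventually_ne[OF tendsto_det[OF assms(1)], of 0] assms(2) by (simp add: GL_iff_det)

lemma open_GL: "open (GL :: ('a::nonarch_local_field^'n^'n) set)"
proof (subst open_subopen, rule ballI)
  fix h :: "'a^'n^'n" assume "h \<in> GL"
  then have "\<forall>\<^sub>F x in nhds h. x \<in> GL" by (rule eventually_GL[OF filterlim_ident])
  then show "\<exists>U. open U \<and> h \<in> U \<and> U \<subseteq> GL" by (auto simp: eventually_nhds)
qed

lemma tendsto_matrix_inv [tendsto_intros]:
  fixes A :: "'a::nonarch_local_field^'n^'n"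
  assumes f_lim: "(f \<longlongrightarrow> A) F" and A_GL: "A \<in> GL" shows "((\<lambda>x. matrix_inv (f x)) \<longlongrightarrow> matrix_inv A) F"
proof (intro vec_tendstoI)
  fix k l
  define minor where "minor B = det (\<chi> i j. if j = k then (mat 1 :: 'a^'n^'n) $ i $ l else B $ i $ j)"
    for B :: "'a^'n^'n"
  have inv: "matrix_inv B $ k $ l = minor B * inverse (det B)" if "B \<in> GL" for B
    using det_replace_column[OF that, of k "mat 1" l] that
    by (simp add: minor_def GL_iff_det field_simps)
  have "((\<lambda>x. if j = k then (mat 1 :: 'a^'n^'n) $ i $ l else f x $ i $ j)
      \<longlongrightarrow> (if j = k then mat 1 $ i $ l else A $ i $ j)) F" for i j
    by (cases "j = k") (simp_all add: f_lim tendsto_intros)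
  then have "((\<lambda>x. minor (f x)) \<longlongrightarrow> minor A) F"
    unfolding minor_def by (intro tendsto_det tendsto_vec_lambda)
  then have "((\<lambda>x. minor (f x) * inverse (det (f x))) \<longlongrightarrow> minor A * inverse (det A)) F"
    using A_GL by (intro tendsto_intros f_lim) (simp_all add: GL_iff_det)
  then show "((\<lambda>x. matrix_inv (f x) $ k $ l) \<longlongrightarrow> matrix_inv A $ k $ l) F"
    unfolding inv[OF A_GL]
  proof (rule Lim_transform_eventually)
    show "\<forall>\<^sub>F x in F. minor (f x) * inverse (det (f x)) = matrix_inv (f x) $ k $ l"
      using eventually_GL[OF f_lim A_GL] by eventually_elim (simp add: inv)
  qed
qed

lemma continuous_on_matrix_mult [continuous_intros]:
  fixes f :: "'b::topological_space \<Rightarrow> 'a::{semiring_1,topological_semigroup_mult,topological_comm_monoid_add}^'n^'m"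
  shows "continuous_on S f \<Longrightarrow> continuous_on S g \<Longrightarrow> continuous_on S (\<lambda>x. f x ** g x)"
  by (simp add: continuous_on_def tendsto_matrix_mult)

lemma continuous_on_scale_mat [continuous_intros]:
  fixes f :: "'b::topological_space \<Rightarrow> 'a::{semiring_1,topological_semigroup_mult}"
  shows "continuous_on S f \<Longrightarrow> continuous_on S g \<Longrightarrow> continuous_on S (\<lambda>x. f x *\<^sub>m g x)"
  by (simp add: continuous_on_def tendsto_scale_mat)

lemma continuous_on_det [continuous_intros]:
  fixes f :: "'b::topological_space \<Rightarrow> 'a::{comm_ring_1,topological_comm_monoid_mult,topological_comm_monoid_add}^'n^'n"
  shows "continuous_on S f \<Longrightarrow> continuous_on S (\<lambda>x. det (f x))"
  by (simp add: continuous_on_def tendsto_det)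

lemma continuous_on_matrix_inv [continuous_intros]:
  fixes f :: "'b::topological_space \<Rightarrow> 'a::nonarch_local_field^'n^'n"
  shows "continuous_on S f \<Longrightarrow> f ` S \<subseteq> GL \<Longrightarrow> continuous_on S (\<lambda>x. matrix_inv (f x))"
  by (simp add: continuous_on_def tendsto_matrix_inv image_subset_iff)

subsection \<open>Lattices of integral matrices\<close>

context uniformized
begin

definition lattice :: "int \<Rightarrow> ('a^'n^'n) set" where
  "lattice k = {X. \<forall>i j. v (X $ i $ j) \<le> q k}"

lemma lattice_add: "X \<in> lattice k \<Longrightarrow> Y \<in> lattice k \<Longrightarrow> X + Y \<in> lattice k"
  by (auto simp: lattice_def intro!: v_add_le)

lemma lattice_diff: "X \<in> lattice k \<Longrightarrow> Y \<in> lattice k \<Longrightarrow> X - Y \<in> lattice k"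
  by (auto simp: lattice_def intro!: v_diff_le)

lemma lattice_minus_iff [simp]: "- X \<in> lattice k \<longleftrightarrow> X \<in> lattice k"
  by (simp add: lattice_def)

lemma zero_in_lattice [simp]: "0 \<in> lattice k"
  by (simp add: lattice_def)

lemma one_in_lattice [simp]: "mat 1 \<in> lattice 0"
  by (auto simp: lattice_def mat_def)

lemma lattice_antimono: "X \<in> lattice k \<Longrightarrow> l \<le> k \<Longrightarrow> X \<in> lattice l"
  unfolding lattice_def using q_le_iff order_trans by blast

lemma lattice_mult: "X \<in> lattice k \<Longrightarrow> Y \<in> lattice l \<Longrightarrow> X ** Y \<in> lattice (k + l)"
  unfolding lattice_def matrix_matrix_mult_def
  by (auto simp: v_mult q_add intro!: v_sum_le mult_mono)

lemma lattice_mult_integral_left: "X \<in> lattice 0 \<Longrightarrow> Y \<in> lattice k \<Longrightarrow> X ** Y \<in> lattice k"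
  using lattice_mult[of X 0 Y k] by simp

lemma lattice_mult_integral_right: "X \<in> lattice k \<Longrightarrow> Y \<in> lattice 0 \<Longrightarrow> X ** Y \<in> lattice k"
  using lattice_mult[of X k Y 0] by simp

lemma scale_unif_powi_in_lattice_iff: "(\<pi> powi a) *\<^sub>m X \<in> lattice (a + k) \<longleftrightarrow> X \<in> lattice k"
  unfolding lattice_def by (auto simp: v_mult v_power_int q_add)

lemma scale_unif_in_lattice_iff: "\<pi> *\<^sub>m X \<in> lattice (k + 1) \<longleftrightarrow> X \<in> lattice k"
  using scale_unif_powi_in_lattice_iff[of 1 X k] by (simp add: add.commute)

lemma ex_lattice_boundary:
  assumes "X \<noteq> 0" shows "\<exists>k. X \<in> lattice k \<and> X \<notin> lattice (k + 1)"
proof -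
  define f where "f p = v (X $ fst p $ snd p)" for p
  have "Max (range f) \<in> range f" by (rule Max_in) auto
  then obtain p where "Max (range f) = f p" by blast
  then obtain i j where max_entry: "Max (range f) = v (X $ i $ j)" by (simp add: f_def)
  have max: "v (X $ a $ b) \<le> v (X $ i $ j)" for a b
    unfolding max_entry[symmetric] by (rule Max_ge) (auto simp: f_def intro: rev_image_eqI[of "(a, b)"])
  obtain a b where "X $ a $ b \<noteq> 0" using assms by (auto simp: vec_eq_iff)
  then have "X $ i $ j \<noteq> 0" using max[of a b] v_pos_iff[of "X $ a $ b"] by fastforce
  then have v_max: "v (X $ i $ j) = q (val (X $ i $ j))" by (rule v_eq_q_val)
  then have "X \<in> lattice (val (X $ i $ j))" using max by (auto simp: lattice_def)
  moreover have "X \<notin> lattice (val (X $ i $ j) + 1)"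
    using v_max unfolding lattice_def
    by (metis (mono_tags, lifting) mem_Collect_eq q_le_iff not_less zless_add1_eq)
  ultimately show ?thesis by blast
qed

lemma v_det_le_1:
  fixes A :: "'a^'n^'n"
  assumes "A \<in> lattice 0" shows "v (det A) \<le> 1"
  unfolding det_def
proof (intro v_sum_le)
  fix p :: "'n \<Rightarrow> 'n"
  have "v (of_int (sign p)) = 1" by (auto simp: sign_def)
  moreover have "(\<Prod>i\<in>UNIV. v (A $ i $ p i)) \<le> 1"
    using assms by (intro prod_le_1) (auto simp: lattice_def)
  ultimately show "v (of_int (sign p) * (\<Prod>i\<in>UNIV. A $ i $ p i)) \<le> 1" by (simp add: v_mult v_prod)
qed simp

lemma open_lattice: "open (lattice k :: ('a^'n^'n) set)"
  and closed_lattice: "closed (lattice k :: ('a^'n^'n) set)"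
proof -
  have ball: "open {z. v z \<le> q k}" "closed {z. v z \<le> q k}" using clopen_v_le[of "q k" 0] by simp_all
  have "open {X::'a^'n^'n. \<forall>i. X $ i \<in> {y. \<forall>j. y $ j \<in> {z. v z \<le> q k}}}"
    by (intro open_vector_box allI ball)
  then show "open (lattice k :: ('a^'n^'n) set)" by (simp add: lattice_def)
  have "closed {X::'a^'n^'n. \<forall>i. X $ i \<in> {y. \<forall>j. y $ j \<in> {z. v z \<le> q k}}}"
    by (intro closed_vector_box allI ball)
  then show "closed (lattice k :: ('a^'n^'n) set)" by (simp add: lattice_def)
qed

lemma compact_lattice: "compact (lattice k :: ('a^'n^'n) set)"
proof -
  have "compact {X::'a^'n^'n. \<forall>i. X $ i \<in> {y. \<forall>j. y $ j \<in> {z. v z \<le> q k}}}"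
    by (intro compact_vec_box compact_v_le)
  then show ?thesis by (simp add: lattice_def)
qed

lemma ex_lattice_subset_nhd:
  assumes "\<forall>\<^sub>F X in nhds 0. P X" obtains k where "\<And>X. X \<in> lattice k \<Longrightarrow> P X"
proof (rule ccontr)
  assume "\<not> thesis"
  then have "\<exists>X\<in>lattice (int k). \<not> P X" for k using that by blast
  then obtain X where counterexample: "\<And>k. X k \<in> lattice (int k)" "\<And>k. \<not> P (X k)" by metis
  have "X \<longlonglongrightarrow> 0"
  proof (intro vec_tendstoI)
    fix i j
    have "(\<lambda>k. v (X k $ i $ j - 0 $ i $ j)) \<longlonglongrightarrow> 0"
      using counterexample(1) by (intro Lim_null_comparison[OF _ tendsto_q]) (simp add: lattice_def)
    then show "(\<lambda>k. X k $ i $ j) \<longlonglongrightarrow> 0 $ i $ j" by (simp only: tendsto_iff_v)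
  qed
  then have "\<forall>\<^sub>F k in sequentially. P (X k)" by (rule eventually_compose_filterlim[OF assms])
  then show False using counterexample(2) by (simp add: eventually_False)
qed

definition GL_int :: "('a^'n^'n) set" where
  "GL_int = {h \<in> lattice 0. v (det h) = 1}"

lemma GL_int_subset_GL: "GL_int \<subseteq> GL"
  by (auto simp: GL_int_def GL_iff_det)

lemma open_GL_int: "open (GL_int :: ('a^'n^'n) set)"
proof -
  have "open {x. v x = 1}"
  proof (subst open_subopen, rule ballI)
    fix x assume "x \<in> {x. v x = 1}"
    then have "v y = 1" if "v (y - x) < 1" for y using v_eq_if_close[of y x] that by simp
    then have "\<forall>\<^sub>F y in nhds x. v y = 1" unfolding eventually_nhds_v by (metis zero_less_one)
    then show "\<exists>U. open U \<and> x \<in> U \<and> U \<subseteq> {x. v x = 1}" by (auto simp: eventually_nhds)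
  qed
  then have "open ((\<lambda>h::'a^'n^'n. det h) -` {x. v x = 1})"
    by (rule open_vimage[OF _ continuous_on_det[OF continuous_on_id]])
  then have "open (lattice 0 \<inter> (\<lambda>h::'a^'n^'n. det h) -` {x. v x = 1})"
    by (rule open_Int[OF open_lattice])
  then show ?thesis by (simp add: GL_int_def vimage_def Int_def)
qed

lemma compact_GL_int: "compact (GL_int :: ('a^'n^'n) set)"
proof -
  have "closed ((\<lambda>h::'a^'n^'n. v (det h)) -` {1})"
    by (intro closed_vimage continuous_intros)
  then have "compact (lattice 0 \<inter> (\<lambda>h::'a^'n^'n. v (det h)) -` {1})"
    by (intro compact_Int_closed compact_lattice)
  then show ?thesis by (simp add: GL_int_def vimage_def Int_def)
qed

end

subsection \<open>Transversals\<close>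

definition add_subgroup :: "'g::ab_group_add set \<Rightarrow> bool" where
  "add_subgroup H \<longleftrightarrow> 0 \<in> H \<and> (\<forall>x\<in>H. \<forall>y\<in>H. x - y \<in> H)"

lemma add_subgroup_diff: "add_subgroup H \<Longrightarrow> x \<in> H \<Longrightarrow> y \<in> H \<Longrightarrow> x - y \<in> H"
  by (simp add: add_subgroup_def)

lemma add_subgroup_minus: "add_subgroup H \<Longrightarrow> x \<in> H \<Longrightarrow> - x \<in> H"
  using add_subgroup_diff[of H 0 x] by (simp add: add_subgroup_def)

lemma add_subgroup_add: "add_subgroup H \<Longrightarrow> x \<in> H \<Longrightarrow> y \<in> H \<Longrightarrow> x + y \<in> H"
  using add_subgroup_diff[of H x "- y"] add_subgroup_minus by auto

lemma add_subgroup_minus_commute: "add_subgroup H \<Longrightarrow> x - y \<in> H \<longleftrightarrow> y - x \<in> H"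
  using add_subgroup_minus[of H "x - y"] add_subgroup_minus[of H "y - x"] by auto

definition transversal :: "'g::ab_group_add set \<Rightarrow> 'g set \<Rightarrow> 'g set \<Rightarrow> bool" where
  "transversal R H K \<longleftrightarrow> finite R \<and> R \<subseteq> H \<and> (\<forall>x\<in>H. \<exists>!r. r \<in> R \<and> x - r \<in> K)"

lemma ex_transversal:
  fixes H K :: "'g::topological_ab_group_add set"
  assumes compact_H: "compact H" and subgroup_K: "add_subgroup K" "open K"
  shows "\<exists>R. transversal R H K"
proof -
  have coset_open: "open {x. x - y \<in> K}" for y
    using open_vimage[OF subgroup_K(2), of "\<lambda>x. x - y"] by (simp add: vimage_def continuous_intros)
  have in_coset: "x - x \<in> K" for x using subgroup_K(1) by (simp add: add_subgroup_def)
  obtain F where finite_cover: "F \<subseteq> H" "finite F" "H \<subseteq> (\<Union>y\<in>F. {x. x - y \<in> K})"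
    by (rule compactE_image[OF compact_H, of H "\<lambda>y. {x. x - y \<in> K}"]) (use coset_open in_coset in auto)
  define cls where "cls x = {y \<in> F. x - y \<in> K}" for x
  define rep where "rep x = (SOME y. y \<in> cls x)" for x
  have rep: "rep x \<in> F" "x - rep x \<in> K" if "x \<in> H" for x
  proof -
    have "\<exists>y. y \<in> cls x" using finite_cover(3) that by (auto simp: cls_def)
    then have "rep x \<in> cls x" unfolding rep_def by (rule someI_ex)
    then show "rep x \<in> F" "x - rep x \<in> K" by (auto simp: cls_def)
  qed
  have rep_eq: "rep x = rep x'" if "x - x' \<in> K" for x x'
  proof -
    have "x - y \<in> K \<longleftrightarrow> x' - y \<in> K" for y
      using add_subgroup_add[OF subgroup_K(1) that, of "x' - y"]
          add_subgroup_diff[OF subgroup_K(1) _ that, of "x - y"] by auto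
    then show ?thesis by (simp add: rep_def cls_def)
  qed
  have "\<exists>!r. r \<in> rep ` H \<and> x - r \<in> K" if x_in_H: "x \<in> H" for x
  proof (rule ex1I[of _ "rep x"])
    show "rep x \<in> rep ` H \<and> x - rep x \<in> K" using rep x_in_H by blast
    fix r assume "r \<in> rep ` H \<and> x - r \<in> K"
    then obtain x' where x'_rep: "x' \<in> H" "r = rep x'" "x - r \<in> K" by blast
    then have "x - x' \<in> K"
      using rep(2)[OF x'_rep(1)] add_subgroup_diff[OF subgroup_K(1), of "x - r" "x' - r"] by simp
    then show "r = rep x" using rep_eq x'_rep(2) by simp
  qed
  moreover have "rep ` H \<subseteq> F" using rep by blast
  ultimately show ?thesis
    unfolding transversal_def using finite_cover
    by (intro exI[of _ "rep ` H"]) (auto intro: finite_subset)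
qed

lemma transversal_expansion:
  fixes f :: "'g::ab_group_add \<Rightarrow> 'c::comm_semiring_1"
  assumes transversal: "transversal R H K" and f_cong: "\<And>x y. x \<in> H \<Longrightarrow> y \<in> H \<Longrightarrow> x - y \<in> K \<Longrightarrow> f x = f y"
    and x_in_H: "x \<in> H"
  shows "f x = (\<Sum>r\<in>R. of_bool (x - r \<in> K) * f r)"
proof -
  obtain r where rep: "r \<in> R" "x - r \<in> K" "\<And>s. s \<in> R \<Longrightarrow> x - s \<in> K \<Longrightarrow> s = r"
  proof -
    have "\<exists>!r. r \<in> R \<and> x - r \<in> K" using transversal x_in_H by (simp add: transversal_def)
    then show thesis using that by (elim ex1E) blast
  qed
  have "of_bool (x - s \<in> K) * f s = (if s = r then f r else 0)" if "s \<in> R" for s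
  proof (cases "x - s \<in> K")
    case True
    then show ?thesis using rep(3)[OF that] by simp
  next
    case False
    then show ?thesis using rep(2) by auto
  qed
  then have "(\<Sum>s\<in>R. of_bool (x - s \<in> K) * f s) = (\<Sum>s\<in>R. if s = r then f r else 0)"
    by (simp cong: sum.cong)
  also have "\<dots> = f r" using transversal rep(1) by (simp add: transversal_def)
  also have "\<dots> = f x" using f_cong[OF x_in_H, of r] transversal rep(1,2) by (auto simp: transversal_def)
  finally show ?thesis by simp
qed

lemma transversal_sum_shift:
  fixes f :: "'g::ab_group_add \<Rightarrow> 'c::comm_semiring_1"
  assumes subgroup_H: "add_subgroup H" and subgroup_K: "add_subgroup K"
    and transversal: "transversal R H K"
    and f_cong: "\<And>x y. x \<in> H \<Longrightarrow> y \<in> H \<Longrightarrow> x - y \<in> K \<Longrightarrow> f x = f y" and y_in_H: "y \<in> H"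
  shows "(\<Sum>r\<in>R. f (y + r)) = sum f R"
proof -
  have R_in_H: "R \<subseteq> H" using transversal by (simp add: transversal_def)
  have unique_rep: "(\<Sum>r\<in>R. of_bool (y + r - s \<in> K)) = (1::'c)" if "s \<in> R" for s
  proof -
    have "y + r - s \<in> K \<longleftrightarrow> s - y - r \<in> K" for r
      using add_subgroup_minus_commute[OF subgroup_K, of "y + r" s] by (simp add: algebra_simps)
    moreover have "s - y \<in> H" using add_subgroup_diff[OF subgroup_H] R_in_H that y_in_H by auto
    ultimately show ?thesis using transversal_expansion[OF transversal, of "\<lambda>_. 1::'c" "s - y"] by simp
  qed
  have "(\<Sum>r\<in>R. f (y + r)) = (\<Sum>r\<in>R. \<Sum>s\<in>R. of_bool (y + r - s \<in> K) * f s)"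
    using R_in_H y_in_H
    by (intro sum.cong refl transversal_expansion[OF transversal f_cong]
      add_subgroup_add[OF subgroup_H]) auto
  also have "\<dots> = (\<Sum>s\<in>R. (\<Sum>r\<in>R. of_bool (y + r - s \<in> K)) * f s)"
    by (subst sum.swap) (simp add: sum_distrib_right)
  finally show ?thesis by (simp add: unique_rep)
qed

text \<open>For an endomorphism \<open>h\<close> of the finite group \<open>H / K\<close>, summing \<open>f \<circ> h\<close> counts each value of \<open>f\<close>
  on the image of \<open>h\<close> once per element of the kernel.\<close>

lemma transversal_sum_endomorphism:
  fixes f :: "'g::ab_group_add \<Rightarrow> 'c::comm_semiring_1"
  assumes subgroup_H: "add_subgroup H" and subgroup_K: "add_subgroup K"
    and transversal: "transversal R H K"
    and f_cong: "\<And>x y. x \<in> H \<Longrightarrow> y \<in> H \<Longrightarrow> x - y \<in> K \<Longrightarrow> f x = f y"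
    and h_endo: "\<And>x y. h (x - y) = h x - h y" "h ` H \<subseteq> H" "h ` (H \<inter> K) \<subseteq> K"
    and supp: "\<And>x. x \<in> H \<Longrightarrow> x \<notin> h ` H \<Longrightarrow> f x = 0"
  shows "(\<Sum>r\<in>R. f (h r)) = of_nat (card {r \<in> R. h r \<in> K}) * sum f R"
proof -
  have R_in_H: "finite R" "R \<subseteq> H" using transversal by (simp_all add: transversal_def)
  have ker: "of_bool (h x \<in> K) = (of_bool (h y \<in> K) :: 'c)" if "x \<in> H" "y \<in> H" "x - y \<in> K" for x y
  proof -
    have "h x - h y \<in> K"
      using h_endo(1)[of x y] h_endo(3) add_subgroup_diff[OF subgroup_H that(1,2)] that(3) by auto
    then show ?thesis
      using add_subgroup_add[OF subgroup_K, of "h x - h y" "h y"]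
          add_subgroup_diff[OF subgroup_K, of "h x" "h x - h y"] by auto
  qed
  have fibre: "(\<Sum>r\<in>R. of_bool (h r - s \<in> K)) * f s = of_nat (card {r \<in> R. h r \<in> K}) * f s"
    if "s \<in> R" for s
  proof (cases "s \<in> h ` H")
    case True
    then obtain x where preimage: "x \<in> H" "s = h x" by blast
    have "h (- x + r) = h r - s" for r using h_endo(1)[of r x] preimage(2) by simp
    then have "(\<Sum>r\<in>R. of_bool (h r - s \<in> K)) = (\<Sum>r\<in>R. of_bool (h (- x + r) \<in> K) :: 'c)" by simp
    also have "\<dots> = (\<Sum>r\<in>R. of_bool (h r \<in> K))"
      by (rule transversal_sum_shift[OF subgroup_H subgroup_K transversal ker
            add_subgroup_minus[OF subgroup_H preimage(1)]])
    finally show ?thesis using R_in_H by (simp add: of_bool_def sum.If_cases Int_def)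
  qed (use supp R_in_H that in auto)
  have "(\<Sum>r\<in>R. f (h r)) = (\<Sum>r\<in>R. \<Sum>s\<in>R. of_bool (h r - s \<in> K) * f s)"
    using R_in_H h_endo(2) by (intro sum.cong refl transversal_expansion[OF transversal f_cong]) auto
  also have "\<dots> = (\<Sum>s\<in>R. (\<Sum>r\<in>R. of_bool (h r - s \<in> K)) * f s)"
    by (subst sum.swap) (simp add: sum_distrib_right)
  also have "\<dots> = (\<Sum>s\<in>R. of_nat (card {r \<in> R. h r \<in> K}) * f s)"
    by (intro sum.cong refl fibre)
  finally show ?thesis by (simp add: sum_distrib_left)
qed

lemma transversal_sum_endomorphism_shift:
  fixes f :: "'g::ab_group_add \<Rightarrow> 'c::comm_semiring_1"
  assumes subgroup_H: "add_subgroup H" and subgroup_K: "add_subgroup K"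
    and transversal: "transversal R H K"
    and f_cong: "\<And>x y. x \<in> H \<Longrightarrow> y \<in> H \<Longrightarrow> x - y \<in> K \<Longrightarrow> f x = f y"
    and h_endo: "\<And>x y. h (x - y) = h x - h y" "h ` H \<subseteq> H" "h ` (H \<inter> K) \<subseteq> K"
    and supp: "\<And>x. x \<in> H \<Longrightarrow> x \<notin> h ` H \<Longrightarrow> f x = 0" and y_in_H: "y \<in> H"
  shows "(\<Sum>r\<in>R. f (h (y + r))) = of_nat (card {r \<in> R. h r \<in> K}) * (\<Sum>r\<in>R. f (y + r))"
proof -
  have "(\<Sum>r\<in>R. f (h (y + r))) = (\<Sum>r\<in>R. f (h r))"
  proof (rule transversal_sum_shift[OF subgroup_H subgroup_K transversal _ y_in_H])
    fix x x' assume "x \<in> H" "x' \<in> H" "x - x' \<in> K"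
    then show "f (h x) = f (h x')"
      using h_endo(2,3) add_subgroup_diff[OF subgroup_H]
      by (intro f_cong) (auto simp: h_endo(1)[symmetric])
  qed
  also have "\<dots> = of_nat (card {r \<in> R. h r \<in> K}) * sum f R"
    by (rule transversal_sum_endomorphism[OF subgroup_H subgroup_K transversal f_cong h_endo supp])
  also have "sum f R = (\<Sum>r\<in>R. f (y + r))"
    by (rule transversal_sum_shift[OF subgroup_H subgroup_K transversal f_cong y_in_H, symmetric])
  finally show ?thesis .
qed

subsection \<open>Haar measure\<close>

locale haar_GL =
  fixes \<mu> :: "('a::nonarch_local_field^'n^'n) measure"
  assumes haar: "haar_measure_GL \<mu>"
begin

lemma sets_mu: "sets \<mu> = sets (restrict_space borel GL)"
  and emeasure_left_mult_image: "g \<in> GL \<Longrightarrow> A \<in> sets \<mu> \<Longrightarrow> emeasure \<mu> ((\<lambda>h. g ** h) ` A) = emeasure \<mu> A"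
  and emeasure_compact_finite: "compact K \<Longrightarrow> K \<subseteq> GL \<Longrightarrow> emeasure \<mu> K < \<infinity>"
  and emeasure_inner_regular: "openin (top_of_set GL) U \<Longrightarrow>
    emeasure \<mu> U = (SUP K\<in>{K. compact K \<and> K \<subseteq> U}. emeasure \<mu> K)"
  and emeasure_space_nonzero: "emeasure \<mu> (space \<mu>) \<noteq> 0"
  using haar unfolding haar_measure_GL_def by simp_all

lemma space_mu: "space \<mu> = GL"
  using sets_eq_imp_space_eq[OF sets_mu] by (simp add: space_restrict_space)

lemma borel_in_sets: "A \<in> sets borel \<Longrightarrow> A \<subseteq> GL \<Longrightarrow> A \<in> sets \<mu>"
  unfolding sets_mu sets_restrict_space by (auto intro!: image_eqI[of _ _ A])

lemma measurable_if_continuous_on_GL: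
  fixes f :: "'a^'n^'n \<Rightarrow> 'b::topological_space"
  assumes "continuous_on GL f" shows "f \<in> borel_measurable \<mu>"
  using borel_measurable_continuous_on_restrict[OF assms] measurable_cong_sets[OF sets_mu] by blast

lemma integrable_if_compact_support:
  fixes f :: "'a^'n^'n \<Rightarrow> 'b::{banach,second_countable_topology}"
  assumes f_cont: "continuous_on GL f" and K_supp: "compact K" "K \<subseteq> GL" "\<And>h. h \<in> GL \<Longrightarrow> f h \<noteq> 0 \<Longrightarrow> h \<in> K"
  shows "integrable \<mu> f"
proof -
  have "bounded (f ` K)"
    using K_supp by (intro compact_imp_bounded compact_continuous_image continuous_on_subset[OF f_cont])
  then obtain B where bound: "\<And>h. h \<in> K \<Longrightarrow> norm (f h) \<le> B" by (auto simp: bounded_iff)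
  show ?thesis
  proof (rule integrableI_bounded_set[of K _ _ B])
    show "K \<in> sets \<mu>" using K_supp by (intro borel_in_sets borel_closed compact_imp_closed)
    show "f \<in> borel_measurable \<mu>" using f_cont by (rule measurable_if_continuous_on_GL)
    show "emeasure \<mu> K < \<infinity>" using K_supp by (intro emeasure_compact_finite)
    show "AE h in \<mu>. h \<in> K \<longrightarrow> norm (f h) \<le> B" using bound by simp
    show "AE h in \<mu>. h \<notin> K \<longrightarrow> f h = 0"
      using K_supp(3) by (intro AE_I2) (auto simp: space_mu)
  qed
qed

lemma left_mult_vimage:
  assumes "g \<in> GL" "A \<subseteq> GL" shows "(\<lambda>h. g ** h) -` A \<inter> GL = (\<lambda>h. matrix_inv g ** h) ` A"
proof (intro equalityI subsetI)
  fix h assume "h \<in> (\<lambda>h. g ** h) -` A \<inter> GL"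
  then show "h \<in> (\<lambda>h. matrix_inv g ** h) ` A"
    using assms by (intro image_eqI[of _ _ "g ** h"])
        (auto simp: matrix_mul_assoc matrix_inv_left_right)
next
  fix h assume "h \<in> (\<lambda>h. matrix_inv g ** h) ` A"
  then show "h \<in> (\<lambda>h. g ** h) -` A \<inter> GL"
    using assms by (auto simp: matrix_mul_assoc matrix_inv_left_right intro!: GL_mult matrix_inv_GL)
qed

lemma left_mult_measurable: "g \<in> GL \<Longrightarrow> (\<lambda>h. g ** h) \<in> measurable \<mu> \<mu>"
  by (intro measurable_cong_sets[OF sets_mu sets_mu, THEN eqset_imp_iff, THEN iffD2]
      measurable_restrict_space2 borel_measurable_continuous_on_restrict continuous_intros)
    (auto simp: space_restrict_space GL_mult)

lemma distr_left_mult: assumes "g \<in> GL" shows "distr \<mu> \<mu> (\<lambda>h. g ** h) = \<mu>"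
proof (rule measure_eqI)
  fix A assume "A \<in> sets (distr \<mu> \<mu> (\<lambda>h. g ** h))"
  then have A_sets: "A \<in> sets \<mu>" "A \<subseteq> GL" using sets.sets_into_space[of A \<mu>] by (auto simp: space_mu)
  then have "emeasure (distr \<mu> \<mu> (\<lambda>h. g ** h)) A = emeasure \<mu> ((\<lambda>h. matrix_inv g ** h) ` A)"
    using emeasure_distr[OF left_mult_measurable[OF assms]] left_mult_vimage[OF assms]
    by (simp add: space_mu)
  also have "\<dots> = emeasure \<mu> A"
    using matrix_inv_GL[OF assms] A_sets(1) by (rule emeasure_left_mult_image)
  finally show "emeasure (distr \<mu> \<mu> (\<lambda>h. g ** h)) A = emeasure \<mu> A" .
qed simp

lemma integral_left_mult:
  fixes f :: "'a^'n^'n \<Rightarrow> 'b::{banach,second_countable_topology}"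
  assumes "g \<in> GL" "f \<in> borel_measurable \<mu>"
  shows "(LINT h|\<mu>. f (g ** h)) = (LINT h|\<mu>. f h)"
  using integral_distr[OF left_mult_measurable[OF assms(1)] assms(2)] distr_left_mult[OF assms(1)]
  by simp

lemma emeasure_compact_eq_0_if_open_null:
  assumes null_nhd: "open U" "U \<subseteq> GL" "U \<noteq> {}" "emeasure \<mu> U = 0" and compact_C: "compact C" "C \<subseteq> GL"
  shows "emeasure \<mu> C = 0"
proof -
  obtain u where u_in_U: "u \<in> U" "u \<in> GL" using null_nhd by blast
  define V where "V g = (\<lambda>h. u ** matrix_inv g ** h) -` U \<inter> GL" for g
  have V_open: "open (V g)" for g
    unfolding V_def by (intro open_Int open_GL open_vimage[OF null_nhd(1)] continuous_intros)
  then have V_sets: "V g \<in> sets \<mu>" for g by (intro borel_in_sets borel_open) (auto simp: V_def)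
  have V_nhd: "g \<in> V g" "emeasure \<mu> (V g) = 0" if "g \<in> GL" for g
  proof -
    show "g \<in> V g" using u_in_U that
      by (simp add: V_def matrix_mul_assoc[symmetric] matrix_inv_left_right)
    have g_GL: "u ** matrix_inv g \<in> GL" using u_in_U that by (intro GL_mult matrix_inv_GL)
    have "U \<in> sets \<mu>" using null_nhd by (intro borel_in_sets borel_open)
    then show "emeasure \<mu> (V g) = 0"
      unfolding V_def left_mult_vimage[OF g_GL null_nhd(2)]
      using emeasure_left_mult_image[OF matrix_inv_GL[OF g_GL]] null_nhd(4) by simp
  qed
  then have cover: "C \<subseteq> (\<Union>g\<in>C. V g)" using compact_C(2) by blast
  obtain F where finite_cover: "F \<subseteq> C" "finite F" "C \<subseteq> (\<Union>g\<in>F. V g)"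
    by (rule compactE_image[OF compact_C(1) V_open cover])
  have "emeasure \<mu> C \<le> emeasure \<mu> (\<Union>g\<in>F. V g)"
    using finite_cover V_sets by (intro emeasure_mono sets.finite_UN) auto
  also have "\<dots> \<le> (\<Sum>g\<in>F. emeasure \<mu> (V g))"
    using finite_cover V_sets by (intro emeasure_subadditive_finite) auto
  also have "\<dots> = 0" using finite_cover compact_C V_nhd by (intro sum.neutral) auto
  finally show ?thesis by simp
qed

lemma emeasure_open_pos:
  assumes "open U" "U \<subseteq> GL" "U \<noteq> {}" shows "0 < emeasure \<mu> U"
proof (rule ccontr)
  assume "\<not> 0 < emeasure \<mu> U"
  then have "emeasure \<mu> U = 0" by simp
  then have "emeasure \<mu> C = 0" if "compact C" "C \<subseteq> GL" for C
    using emeasure_compact_eq_0_if_open_null[OF assms _ that] by blast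
  then have "emeasure \<mu> GL = 0"
    by (subst emeasure_inner_regular) (auto simp: bot_ennreal[symmetric] intro!: SUP_eqI)
  then show False using emeasure_space_nonzero by (simp add: space_mu)
qed

end

locale test_functions = uniformized v \<pi> + haar_GL \<mu>
  for v :: "'a::nonarch_local_field \<Rightarrow> real" and \<pi> and \<mu> :: "('a^'n^'n) measure"
begin

lemma phi_tilde_eq: "phi_tilde \<mu> \<phi> t = (LINT h|\<mu>. \<phi> (t *\<^sub>m h, matrix_inv h))"
  by (simp add: phi_tilde_def scale_mat_def)

text \<open>The coefficient of \<open>z ^ k\<close> in the Godement-Jacquet zeta integral of \<open>\<phi> (\<cdot>, 0)\<close>, graded by
  the valuation of the determinant; no convergence question arises coefficientwise.\<close>

definition zeta_coeff :: "(('a^'n^'n) \<times> ('a^'n^'n) \<Rightarrow> complex) \<Rightarrow> int \<Rightarrow> complex" where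
  "zeta_coeff \<phi> k = (LINT h|\<mu>. (if val (det h) = k then \<phi> (h, 0) else 0))"

lemma continuous_on_phi_tilde_integrand:
  fixes \<phi> :: "('a^'n^'n) \<times> ('a^'n^'n) \<Rightarrow> complex"
  assumes "\<phi> \<in> Cc_infty" shows "continuous_on GL (\<lambda>h. \<phi> (t *\<^sub>m h, matrix_inv h))"
proof (rule continuous_on_compose2[OF Cc_infty_continuous_on[OF assms]])
  show "continuous_on GL (\<lambda>h. (t *\<^sub>m h, matrix_inv h))"
    by (intro continuous_intros) simp
qed (rule subset_UNIV)

lemma integrable_phi_tilde_integrand:
  fixes \<phi> :: "('a^'n^'n) \<times> ('a^'n^'n) \<Rightarrow> complex"
  assumes smooth: "\<phi> \<in> Cc_infty" and t_nz: "t \<noteq> 0"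
  shows "integrable \<mu> (\<lambda>h. \<phi> (t *\<^sub>m h, matrix_inv h))"
proof (rule integrable_if_compact_support)
  show "continuous_on GL (\<lambda>h. \<phi> (t *\<^sub>m h, matrix_inv h))" using smooth
    by (rule continuous_on_phi_tilde_integrand)
  define S where "S = {p. \<phi> p \<noteq> 0} \<inter> (\<lambda>p. fst p ** snd p) -` {t *\<^sub>m mat 1}"
  have "compact S"
    unfolding S_def using Cc_infty_compact_support[OF smooth]
    by (intro compact_Int_closed closed_vimage continuous_intros) auto
  then show "compact ((\<lambda>p. inverse t *\<^sub>m fst p) ` S)"
    by (intro compact_continuous_image continuous_intros)
  show "(\<lambda>p. inverse t *\<^sub>m fst p) ` S \<subseteq> GL"
  proof clarify
    fix X Y assume "(X, Y) \<in> S"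
    then have "(inverse t *\<^sub>m X) ** Y = mat 1"
      using t_nz by (simp add: S_def scale_mat_mult_left scale_mat_scale_mat)
    then show "inverse t *\<^sub>m fst (X, Y) \<in> GL" using matrix_inv_eqI(2) by simp
  qed
  fix h :: "'a^'n^'n" assume "h \<in> GL" "\<phi> (t *\<^sub>m h, matrix_inv h) \<noteq> 0"
  then show "h \<in> (\<lambda>p. inverse t *\<^sub>m fst p) ` S"
    using t_nz by (intro image_eqI[of _ _ "(t *\<^sub>m h, matrix_inv h)"])
      (auto simp: S_def scale_mat_scale_mat scale_mat_mult_left matrix_inv_left_right)
qed

lemma continuous_on_zeta_integrand:
  fixes \<phi> :: "('a^'n^'n) \<times> ('a^'n^'n) \<Rightarrow> complex"
  assumes "\<phi> \<in> Cc_infty" shows "continuous_on GL (\<lambda>h. if val (det h) = k then \<phi> (h, 0) else 0)"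
  unfolding continuous_on_def
proof
  fix h :: "'a^'n^'n" assume "h \<in> GL"
  then have "\<forall>\<^sub>F x in nhds (det h). val x = val (det h)"
    by (intro val_locally_constant) (simp add: GL_iff_det)
  then have "\<forall>\<^sub>F x in nhds h. val (det x) = val (det h)"
    by (rule eventually_compose_filterlim) (intro tendsto_intros filterlim_ident)
  moreover have "\<forall>\<^sub>F x in nhds h. \<phi> (x, 0) = \<phi> (h, 0)"
    using Cc_infty_eventually_eq[OF assms]
    by (rule eventually_compose_filterlim) (intro tendsto_intros filterlim_ident)
  ultimately have "\<forall>\<^sub>F x in nhds h. (if val (det x) = k then \<phi> (x, 0) else 0)
      = (if val (det h) = k then \<phi> (h, 0) else 0)"
    by eventually_elim simp
  then show "((\<lambda>x. if val (det x) = k then \<phi> (x, 0) else 0)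
      \<longlongrightarrow> (if val (det h) = k then \<phi> (h, 0) else 0)) (at h within GL)"
    by (intro tendsto_eventually) (simp add: eventually_at_filter eventually_mono)
qed

lemma integrable_zeta_integrand:
  fixes \<phi> :: "('a^'n^'n) \<times> ('a^'n^'n) \<Rightarrow> complex"
  assumes smooth: "\<phi> \<in> Cc_infty"
  shows "integrable \<mu> (\<lambda>h. if val (det h) = k then \<phi> (h, 0) else 0)"
proof (rule integrable_if_compact_support)
  show "continuous_on GL (\<lambda>h. if val (det h) = k then \<phi> (h, 0) else 0)"
    using smooth by (rule continuous_on_zeta_integrand)
  define S where "S = fst ` {p. \<phi> p \<noteq> 0} \<inter> (\<lambda>h. v (det h)) -` {q k}"
  show "compact S"
    unfolding S_def using Cc_infty_compact_support[OF smooth]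
    by (intro compact_Int_closed closed_vimage compact_continuous_image continuous_intros) auto
  show "S \<subseteq> GL"
    using q_pos[of k] by (auto simp: S_def GL_iff_det)
  fix h :: "'a^'n^'n" assume "h \<in> GL" "(if val (det h) = k then \<phi> (h, 0) else 0) \<noteq> 0"
  then show "h \<in> S"
    using v_eq_q_val[of "det h"] by (auto simp: S_def GL_iff_det image_iff split: if_splits)
qed

lemma phi_tilde_add:
  "\<phi> \<in> Cc_infty \<Longrightarrow> \<psi> \<in> Cc_infty \<Longrightarrow> t \<noteq> 0 \<Longrightarrow>
    phi_tilde \<mu> (\<lambda>p. \<phi> p + \<psi> p) t = phi_tilde \<mu> \<phi> t + phi_tilde \<mu> \<psi> t"
  by (simp add: phi_tilde_eq integrable_phi_tilde_integrand)

lemma phi_tilde_cmult: "phi_tilde \<mu> (\<lambda>p. c * \<phi> p) t = c * phi_tilde \<mu> \<phi> t"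
  by (simp add: phi_tilde_eq)

lemma phi_tilde_diff:
  "\<phi> \<in> Cc_infty \<Longrightarrow> \<psi> \<in> Cc_infty \<Longrightarrow> t \<noteq> 0 \<Longrightarrow>
    phi_tilde \<mu> (\<lambda>p. \<phi> p - \<psi> p) t = phi_tilde \<mu> \<phi> t - phi_tilde \<mu> \<psi> t"
  by (simp add: phi_tilde_eq integrable_phi_tilde_integrand)

lemma phi_tilde_sum:
  "(\<And>i. i \<in> I \<Longrightarrow> \<phi> i \<in> Cc_infty) \<Longrightarrow> t \<noteq> 0 \<Longrightarrow>
    phi_tilde \<mu> (\<lambda>p. \<Sum>i\<in>I. \<phi> i p) t = (\<Sum>i\<in>I. phi_tilde \<mu> (\<phi> i) t)"
  by (simp add: phi_tilde_eq integrable_phi_tilde_integrand)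

lemma zeta_coeff_cmult: "zeta_coeff (\<lambda>p. c * \<phi> p) k = c * zeta_coeff \<phi> k"
  unfolding zeta_coeff_def integral_mult_right_zero[symmetric]
  by (intro Bochner_Integration.integral_cong) auto

lemma zeta_coeff_sum:
  assumes "\<And>i. i \<in> I \<Longrightarrow> \<phi> i \<in> Cc_infty"
  shows "zeta_coeff (\<lambda>p. \<Sum>i\<in>I. \<phi> i p) k = (\<Sum>i\<in>I. zeta_coeff (\<phi> i) k)"
proof -
  have "(\<Sum>i\<in>I. zeta_coeff (\<phi> i) k) = (LINT h|\<mu>. (\<Sum>i\<in>I. if val (det h) = k then \<phi> i (h, 0) else 0))"
    unfolding zeta_coeff_def using assms
    by (intro Bochner_Integration.integral_sum[symmetric] integrable_zeta_integrand)
  also have "\<dots> = zeta_coeff (\<lambda>p. \<Sum>i\<in>I. \<phi> i p) k"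
    unfolding zeta_coeff_def by (intro Bochner_Integration.integral_cong) auto
  finally show ?thesis by simp
qed

lemma zeta_coeff_add:
  assumes "\<phi> \<in> Cc_infty" "\<psi> \<in> Cc_infty"
  shows "zeta_coeff (\<lambda>p. \<phi> p + \<psi> p) k = zeta_coeff \<phi> k + zeta_coeff \<psi> k"
  using zeta_coeff_sum[of UNIV "\<lambda>b. if b then \<phi> else \<psi>" k] assms by (simp add: UNIV_bool add.commute)

lemma zeta_coeff_diff:
  assumes "\<phi> \<in> Cc_infty" "\<psi> \<in> Cc_infty"
  shows "zeta_coeff (\<lambda>p. \<phi> p - \<psi> p) k = zeta_coeff \<phi> k - zeta_coeff \<psi> k"
  using zeta_coeff_add[OF assms(1) Cc_infty_cmult[OF assms(2), of "- 1"], of k]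
      zeta_coeff_cmult[of "- 1" \<psi> k]
  by simp

definition translate :: "'a^'n^'n \<Rightarrow> 'a^'n^'n \<Rightarrow> (('a^'n^'n) \<times> ('a^'n^'n) \<Rightarrow> complex) \<Rightarrow>
    ('a^'n^'n) \<times> ('a^'n^'n) \<Rightarrow> complex" where
  "translate g h \<phi> p = \<phi> (g ** fst p, snd p ** h)"

lemma Cc_infty_translate:
  assumes smooth: "\<phi> \<in> Cc_infty" and gh_GL: "g \<in> GL" "h \<in> GL" shows "translate g h \<phi> \<in> Cc_infty"
  unfolding translate_def[abs_def]
proof (rule Cc_infty_compose[OF smooth])
  show "continuous_on UNIV (\<lambda>p::('a^'n^'n) \<times> ('a^'n^'n). (g ** fst p, snd p ** h))"
    by (intro continuous_intros)
  show "compact ((\<lambda>p. (matrix_inv g ** fst p, snd p ** matrix_inv h)) ` {p. \<phi> p \<noteq> 0})"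
    using Cc_infty_compact_support[OF smooth] by (intro compact_continuous_image continuous_intros)
  fix p assume "\<phi> (g ** fst p, snd p ** h) \<noteq> 0"
  moreover have "p = (matrix_inv g ** (g ** fst p), snd p ** h ** matrix_inv h)"
    by (cases p) (use gh_GL in \<open>simp add: matrix_mul_assoc matrix_inv_left_right,
      simp add: matrix_mul_assoc[symmetric] matrix_inv_left_right\<close>)
  ultimately show "p \<in> (\<lambda>p. (matrix_inv g ** fst p, snd p ** matrix_inv h)) ` {p. \<phi> p \<noteq> 0}"
    by (intro image_eqI[of _ _ "(g ** fst p, snd p ** h)"]) simp_all
qed

lemma phi_tilde_translate:
  assumes "\<phi> \<in> Cc_infty" "g \<in> GL"
  shows "phi_tilde \<mu> (translate (c *\<^sub>m g) (matrix_inv g) \<phi>) t = phi_tilde \<mu> \<phi> (c * t)"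
proof -
  have "phi_tilde \<mu> (translate (c *\<^sub>m g) (matrix_inv g) \<phi>) t
      = (LINT h|\<mu>. \<phi> ((c * t) *\<^sub>m (g ** h), matrix_inv (g ** h)))"
    unfolding phi_tilde_eq
    by (intro Bochner_Integration.integral_cong)
      (simp_all add: translate_def space_mu matrix_inv_mult[OF assms(2)] mat_algebra mult.commute)
  also have "\<dots> = phi_tilde \<mu> \<phi> (c * t)"
    unfolding phi_tilde_eq using assms
    by (intro integral_left_mult measurable_if_continuous_on_GL continuous_on_phi_tilde_integrand)
  finally show ?thesis .
qed

lemma zeta_coeff_translate:
  assumes "\<phi> \<in> Cc_infty" "g \<in> GL"
  shows "zeta_coeff (translate g g' \<phi>) k = zeta_coeff \<phi> (k + val (det g))"
proof -
  have "val (det (g ** h)) = val (det g) + val (det h)" if "h \<in> GL" for h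
    using assms(2) that by (simp add: det_mul GL_iff_det val_mult)
  then have "zeta_coeff (translate g g' \<phi>) k
     = (LINT h|\<mu>. (if val (det (g ** h)) = k + val (det g) then \<phi> (g ** h, 0) else 0))"
    unfolding zeta_coeff_def
    by (intro Bochner_Integration.integral_cong) (auto simp: translate_def space_mu)
  also have "\<dots> = zeta_coeff \<phi> (k + val (det g))"
    unfolding zeta_coeff_def using assms
    by (intro integral_left_mult measurable_if_continuous_on_GL continuous_on_zeta_integrand)
  finally show ?thesis .
qed

end

subsection \<open>Reduction to higher rank\<close>

definition shift_diff :: "('x \<Rightarrow> 'x) \<Rightarrow> 'c::comm_ring_1 \<Rightarrow> ('x \<Rightarrow> 'c) \<Rightarrow> 'x \<Rightarrow> 'c" where
  "shift_diff \<tau> \<kappa> f x = f (\<tau> x) - \<kappa> * f x"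

lemma shift_diff_commute:
  assumes "\<And>x. \<sigma> (\<tau> x) = \<tau> (\<sigma> x)"
  shows "shift_diff \<sigma> \<kappa> (shift_diff \<tau> \<rho> f) = shift_diff \<tau> \<rho> (shift_diff \<sigma> \<kappa> f)"
  by (simp add: shift_diff_def fun_eq_iff assms algebra_simps)

lemma shift_diff_add:
  "shift_diff \<tau> \<kappa> (\<lambda>x. f x + g x) = (\<lambda>x. shift_diff \<tau> \<kappa> f x + shift_diff \<tau> \<kappa> g x)"
  by (simp add: shift_diff_def fun_eq_iff algebra_simps)

lemma shift_diff_cmult: "shift_diff \<tau> \<kappa> (\<lambda>x. c * f x) = (\<lambda>x. c * shift_diff \<tau> \<kappa> f x)"
  by (simp add: shift_diff_def fun_eq_iff algebra_simps)

lemma shift_diff_eventually_cong: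
  assumes \<tau>: "filterlim \<tau> F F" and eq: "\<forall>\<^sub>F x in F. f x = g x"
  shows "\<forall>\<^sub>F x in F. shift_diff \<tau> \<kappa> f x = shift_diff \<tau> \<kappa> g x"
  using eq eventually_compose_filterlim[OF eq \<tau>] by eventually_elim (simp add: shift_diff_def)

context test_functions
begin

lemma filterlim_mult_unif: "filterlim ((*) \<pi>) (at 0) (at 0)"
proof (rule filterlim_atI)
  show "((*) \<pi> \<longlongrightarrow> 0) (at 0)"
    using tendsto_mult[OF tendsto_const tendsto_ident_at, of \<pi> 0 UNIV] by simp
  show "\<forall>\<^sub>F t in at 0. \<pi> * t \<noteq> 0" by (simp add: eventually_at_filter)
qed

definition hecke_diff :: "'a^'n^'n \<Rightarrow> complex \<Rightarrow> (('a^'n^'n) \<times> ('a^'n^'n) \<Rightarrow> complex) \<Rightarrow>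
    ('a^'n^'n) \<times> ('a^'n^'n) \<Rightarrow> complex" where
  "hecke_diff g \<kappa> \<phi> p = translate (\<pi> *\<^sub>m g) (matrix_inv g) \<phi> p - \<kappa> * \<phi> p"

definition hecke_degree :: "'a^'n^'n \<Rightarrow> int" where
  "hecke_degree g = val (det (\<pi> *\<^sub>m g))"

lemma Cc_infty_hecke_diff: "\<phi> \<in> Cc_infty \<Longrightarrow> g \<in> GL \<Longrightarrow> hecke_diff g \<kappa> \<phi> \<in> Cc_infty"
  unfolding hecke_diff_def[abs_def]
  by (intro Cc_infty_diff Cc_infty_translate Cc_infty_cmult GL_scale_mat matrix_inv_GL unif_nz)

lemma phi_tilde_hecke_diff:
  assumes "\<phi> \<in> Cc_infty" "g \<in> GL" "t \<noteq> 0"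
  shows "phi_tilde \<mu> (hecke_diff g \<kappa> \<phi>) t = shift_diff ((*) \<pi>) \<kappa> (phi_tilde \<mu> \<phi>) t"
  using assms unfolding hecke_diff_def[abs_def]
  by (simp add: phi_tilde_diff Cc_infty_translate Cc_infty_cmult GL_scale_mat matrix_inv_GL
      phi_tilde_translate phi_tilde_cmult shift_diff_def)

lemma zeta_coeff_hecke_diff:
  assumes "\<phi> \<in> Cc_infty" "g \<in> GL"
  shows "zeta_coeff (hecke_diff g \<kappa> \<phi>) = shift_diff (\<lambda>k. k + hecke_degree g) \<kappa> (zeta_coeff \<phi>)"
  using assms unfolding hecke_diff_def[abs_def]
  by (simp add: zeta_coeff_diff Cc_infty_translate Cc_infty_cmult GL_scale_mat matrix_inv_GL
      zeta_coeff_translate zeta_coeff_cmult shift_diff_def hecke_degree_def fun_eq_iff)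

definition average :: "'i set \<Rightarrow> ('i \<Rightarrow> 'a^'n^'n) \<Rightarrow> (('a^'n^'n) \<times> ('a^'n^'n) \<Rightarrow> complex) \<Rightarrow>
    ('a^'n^'n) \<times> ('a^'n^'n) \<Rightarrow> complex" where
  "average I u \<phi> p = inverse (of_nat (card I)) * (\<Sum>i\<in>I. translate (u i) (matrix_inv (u i)) \<phi> p)"

lemma Cc_infty_average:
  "\<phi> \<in> Cc_infty \<Longrightarrow> u ` I \<subseteq> GL \<Longrightarrow> average I u \<phi> \<in> Cc_infty"
  unfolding average_def[abs_def]
  by (intro Cc_infty_cmult Cc_infty_sum Cc_infty_translate matrix_inv_GL) auto

lemma phi_tilde_average:
  assumes "\<phi> \<in> Cc_infty" "u ` I \<subseteq> GL" "finite I" "I \<noteq> {}" "t \<noteq> 0"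
  shows "phi_tilde \<mu> (average I u \<phi>) t = phi_tilde \<mu> \<phi> t"
proof -
  have u_GL: "u i \<in> GL" if "i \<in> I" for i using assms(2) that by blast
  have "phi_tilde \<mu> (translate (u i) (matrix_inv (u i)) \<phi>) t = phi_tilde \<mu> \<phi> t" if "i \<in> I" for i
    using phi_tilde_translate[OF assms(1) u_GL[OF that], of 1 t] by simp
  then show ?thesis
    unfolding average_def[abs_def] using assms u_GL
    by (simp add: phi_tilde_cmult phi_tilde_sum Cc_infty_translate matrix_inv_GL)
qed

lemma zeta_coeff_average:
  assumes "\<phi> \<in> Cc_infty" "u ` I \<subseteq> GL" "finite I" "I \<noteq> {}" "\<And>i. i \<in> I \<Longrightarrow> val (det (u i)) = 0"
  shows "zeta_coeff (average I u \<phi>) = zeta_coeff \<phi>"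
proof
  fix k
  have u_GL: "u i \<in> GL" if "i \<in> I" for i using assms(2) that by blast
  then show "zeta_coeff (average I u \<phi>) k = zeta_coeff \<phi> k"
    unfolding average_def[abs_def] using assms
    by (simp add: zeta_coeff_cmult zeta_coeff_sum Cc_infty_translate matrix_inv_GL zeta_coeff_translate)
qed

definition vanishes_below_rank :: "nat \<Rightarrow> (('a^'n^'n) \<times> ('a^'n^'n) \<Rightarrow> complex) \<Rightarrow> bool" where
  "vanishes_below_rank r \<phi> \<longleftrightarrow> \<phi> \<in> Cc_infty \<and>
    (\<forall>X Y. X ** Y = 0 \<longrightarrow> Y ** X = 0 \<longrightarrow> col_rank X < r \<longrightarrow> \<phi> (X, Y) = 0)"

lemma vanishes_below_rank_Cc_infty: "vanishes_below_rank r \<phi> \<Longrightarrow> \<phi> \<in> Cc_infty"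
  by (simp add: vanishes_below_rank_def)

lemma vanishes_below_rank_zero: "vanishes_below_rank r (\<lambda>_. 0)"
  by (simp add: vanishes_below_rank_def Cc_infty_zero)

lemma vanishes_below_rank_add:
  "vanishes_below_rank r \<phi> \<Longrightarrow> vanishes_below_rank r \<psi> \<Longrightarrow> vanishes_below_rank r (\<lambda>p. \<phi> p + \<psi> p)"
  by (simp add: vanishes_below_rank_def Cc_infty_add)

lemma vanishes_below_rank_hecke_diff:
  assumes "vanishes_below_rank r \<phi>" "g \<in> GL" shows "vanishes_below_rank r (hecke_diff g \<kappa> \<phi>)"
  unfolding vanishes_below_rank_def
proof (intro conjI allI impI)
  show "hecke_diff g \<kappa> \<phi> \<in> Cc_infty"
    using assms by (simp add: Cc_infty_hecke_diff vanishes_below_rank_Cc_infty)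
  fix X Y :: "'a^'n^'n" assume low_rank_pair: "X ** Y = 0" "Y ** X = 0" "col_rank X < r"
  have "(\<pi> *\<^sub>m g ** X) ** (Y ** matrix_inv g) = \<pi> *\<^sub>m (g ** ((X ** Y) ** matrix_inv g))"
    by (simp add: mat_algebra)
  moreover have "(Y ** matrix_inv g) ** (\<pi> *\<^sub>m g ** X) = \<pi> *\<^sub>m (Y ** X)"
    using assms(2) by (simp add: mat_algebra matrix_mul_assoc_eq[OF matrix_inv_left_right(2)])
  moreover have "col_rank (\<pi> *\<^sub>m g ** X) = col_rank X"
    using assms(2) by (intro col_rank_mult_GL_left GL_scale_mat unif_nz)
  ultimately show "hecke_diff g \<kappa> \<phi> (X, Y) = 0"
    using assms(1) low_rank_pair by (simp add: hecke_diff_def translate_def vanishes_below_rank_def)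
qed

text \<open>Up to operators \<open>T - \<kappa>\<close> the germ \<open>f\<close> and the coefficients \<open>a\<close> come from a function that
  vanishes below rank \<open>r\<close>. The condition \<open>\<kappa> \<noteq> 1\<close> keeps the factors \<open>z ^ - e - \<kappa>\<close> by which the operators
  act on \<open>a\<close> from vanishing at \<open>z = 1\<close>.\<close>

inductive reducible_to :: "nat \<Rightarrow> ('a \<Rightarrow> complex) \<Rightarrow> (int \<Rightarrow> complex) \<Rightarrow> bool" for r where
  base: "vanishes_below_rank r \<phi> \<Longrightarrow> \<forall>\<^sub>F t in at 0. f t = phi_tilde \<mu> \<phi> t \<Longrightarrow>
    reducible_to r f (zeta_coeff \<phi>)"
| step: "g \<in> GL \<Longrightarrow> \<kappa> \<noteq> 1 \<Longrightarrow>
    reducible_to r (shift_diff ((*) \<pi>) \<kappa> f) (shift_diff (\<lambda>k. k + hecke_degree g) \<kappa> a) \<Longrightarrow>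
    reducible_to r f a"

lemma reducible_to_if_vanishes:
    "vanishes_below_rank r \<phi> \<Longrightarrow> reducible_to r (phi_tilde \<mu> \<phi>) (zeta_coeff \<phi>)"
  by (rule base) simp_all

lemma reducible_to_cong_germ:
  "reducible_to r f a \<Longrightarrow> \<forall>\<^sub>F t in at 0. f' t = f t \<Longrightarrow> reducible_to r f' a"
proof (induction arbitrary: f' rule: reducible_to.induct)
  case (base \<phi> f)
  from base(3,2) have "\<forall>\<^sub>F t in at 0. f' t = phi_tilde \<mu> \<phi> t" by eventually_elim simp
  then show ?case by (rule reducible_to.base[OF base(1)])
next
  case (step g \<kappa> f a)
  show ?case
    by (rule reducible_to.step[OF step(1,2)])
      (intro step.IH shift_diff_eventually_cong filterlim_mult_unif step.prems)
qed

lemma germ_hecke_diff: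
  assumes "\<phi> \<in> Cc_infty" "g \<in> GL" "\<forall>\<^sub>F t in at 0. f t = phi_tilde \<mu> \<phi> t"
  shows "\<forall>\<^sub>F t in at 0. shift_diff ((*) \<pi>) \<kappa> f t = phi_tilde \<mu> (hecke_diff g \<kappa> \<phi>) t"
  using shift_diff_eventually_cong[OF filterlim_mult_unif assms(3)] assms(1,2)
  by (simp add: eventually_at_filter phi_tilde_hecke_diff)

lemma reducible_to_shift_diff:
  assumes "reducible_to r f a" "g \<in> GL"
  shows "reducible_to r (shift_diff ((*) \<pi>) \<kappa> f) (shift_diff (\<lambda>k. k + hecke_degree g) \<kappa> a)"
  using assms(1)
proof induction
  case (base \<phi> f)
  have smooth: "\<phi> \<in> Cc_infty" using base(1) by (rule vanishes_below_rank_Cc_infty)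
  show ?case
    unfolding zeta_coeff_hecke_diff[OF smooth assms(2), symmetric]
    using vanishes_below_rank_hecke_diff[OF base(1) assms(2)]
        germ_hecke_diff[OF smooth assms(2) base(2)]
    by (rule reducible_to.base)
next
  case (step h \<rho> f a)
  have commute: "shift_diff ((*) \<pi>) \<kappa> (shift_diff ((*) \<pi>) \<rho> f)
      = shift_diff ((*) \<pi>) \<rho> (shift_diff ((*) \<pi>) \<kappa> f)"
    "shift_diff (\<lambda>k. k + hecke_degree g) \<kappa> (shift_diff (\<lambda>k. k + hecke_degree h) \<rho> a)
      = shift_diff (\<lambda>k. k + hecke_degree h) \<rho> (shift_diff (\<lambda>k. k + hecke_degree g) \<kappa> a)"
    by (rule shift_diff_commute, simp)+
  show ?case using step.IH unfolding commute by (rule reducible_to.step[OF step(1,2)])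
qed

lemma reducible_to_add_vanishing:
  assumes "reducible_to r f a" "vanishes_below_rank r \<psi>" "\<forall>\<^sub>F t in at 0. g t = phi_tilde \<mu> \<psi> t"
  shows "reducible_to r (\<lambda>t. g t + f t) (\<lambda>k. zeta_coeff \<psi> k + a k)"
  using assms
proof (induction arbitrary: g \<psi> rule: reducible_to.induct)
  case (base \<phi> f)
  have smooth: "\<psi> \<in> Cc_infty" "\<phi> \<in> Cc_infty" using base(3,1)
    by (auto dest: vanishes_below_rank_Cc_infty)
  have "\<forall>\<^sub>F t in at 0. g t + f t = phi_tilde \<mu> (\<lambda>p. \<psi> p + \<phi> p) t"
    using base(2,4) eventually_neq_at_within[of 0 0 UNIV]
    by eventually_elim (simp add: phi_tilde_add smooth)
  then have "reducible_to r (\<lambda>t. g t + f t) (zeta_coeff (\<lambda>p. \<psi> p + \<phi> p))"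
    by (rule reducible_to.base[OF vanishes_below_rank_add[OF base(3,1)]])
  moreover have "zeta_coeff (\<lambda>p. \<psi> p + \<phi> p) = (\<lambda>k. zeta_coeff \<psi> k + zeta_coeff \<phi> k)"
    using zeta_coeff_add[OF smooth] by (rule ext)
  ultimately show ?case by (simp only:)
next
  case (step h \<kappa> f a)
  have \<psi>: "\<psi> \<in> Cc_infty" using step.prems(1) by (rule vanishes_below_rank_Cc_infty)
  show ?case
  proof (rule reducible_to.step[OF step(1,2)])
    show "reducible_to r (shift_diff ((*) \<pi>) \<kappa> (\<lambda>t. g t + f t))
        (shift_diff (\<lambda>k. k + hecke_degree h) \<kappa> (\<lambda>k. zeta_coeff \<psi> k + a k))"
      using step.IH[OF vanishes_below_rank_hecke_diff[OF step.prems(1) step(1)]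
          germ_hecke_diff[OF \<psi> step(1) step.prems(2)]]
      unfolding shift_diff_add zeta_coeff_hecke_diff[OF \<psi> step(1)] .
  qed
qed

lemma reducible_to_add:
  assumes "reducible_to r f a" "reducible_to r f' a'"
  shows "reducible_to r (\<lambda>t. f t + f' t) (\<lambda>k. a k + a' k)"
  using assms
proof (induction arbitrary: f' a' rule: reducible_to.induct)
  case (base \<phi> f)
  show ?case by (rule reducible_to_add_vanishing[OF base(3,1,2)])
next
  case (step g \<kappa> f a)
  show ?case
  proof (rule reducible_to.step[OF step(1,2)])
    show "reducible_to r (shift_diff ((*) \<pi>) \<kappa> (\<lambda>t. f t + f' t))
        (shift_diff (\<lambda>k. k + hecke_degree g) \<kappa> (\<lambda>k. a k + a' k))"
      unfolding shift_diff_add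
      by (rule step.IH[OF reducible_to_shift_diff[OF step.prems step(1)]])
  qed
qed

lemma reducible_to_trans:
  assumes "reducible_to r f a"
    and "\<And>\<phi>. vanishes_below_rank r \<phi> \<Longrightarrow> reducible_to s (phi_tilde \<mu> \<phi>) (zeta_coeff \<phi>)"
  shows "reducible_to s f a"
  using assms(1)
proof induction
  case (base \<phi> f)
  show ?case by (rule reducible_to_cong_germ[OF assms(2)[OF base(1)] base(2)])
next
  case (step g \<kappa> f a)
  show ?case by (rule reducible_to.step[OF step(1,2) step.IH])
qed

end

subsection \<open>Graphs over the column space of a matrix\<close>

definition unipotent_block :: "'a::field^'n^'n \<Rightarrow> ('a^'n^'n) set" where
  "unipotent_block P = {c. P ** c = 0 \<and> c ** P = c}"

lemma unipotent_blockD: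
  assumes "c \<in> unipotent_block P" shows "P ** c = 0" "c ** P = c"
  using assms by (simp_all add: unipotent_block_def)

lemma unipotent_block_mult:
  assumes "c \<in> unipotent_block P" "c' \<in> unipotent_block P" shows "c ** c' = 0"
proof -
  have "c ** c' = (c ** P) ** c'" using assms(1) by (simp add: unipotent_blockD)
  also have "\<dots> = c ** (P ** c')" by (simp add: matrix_mul_assoc)
  also have "\<dots> = 0" using assms(2) by (simp add: unipotent_blockD)
  finally show ?thesis .
qed

lemma unipotent_block_scale_mat: "c \<in> unipotent_block P \<Longrightarrow> s *\<^sub>m c \<in> unipotent_block P"
  by (simp add: unipotent_block_def mat_algebra)

lemma add_subgroup_unipotent_block: "add_subgroup (unipotent_block P)"
  by (simp add: add_subgroup_def unipotent_block_def mat_algebra)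

lemma unipotent_inverse:
  assumes "(c::'a::field^'n^'n) ** c = 0"
  shows "(mat 1 + c) ** (mat 1 - c) = mat 1" "(mat 1 - c) ** (mat 1 + c) = mat 1"
  using assms by (simp_all add: mat_algebra)

definition dilation :: "'a::field^'n^'n \<Rightarrow> 'a \<Rightarrow> 'a^'n^'n" where
  "dilation P s = P + s *\<^sub>m (mat 1 - P)"

lemma dilation_mult:
  assumes "P ** P = P" shows "dilation P s ** dilation P t = dilation P (s * t)"
  using assms by (simp add: dilation_def mat_algebra) (simp add: vec_eq_iff algebra_simps)

lemma dilation_1: "dilation P 1 = mat 1"
  by (simp add: dilation_def)

lemma dilation_conj_unipotent:
  assumes "c \<in> unipotent_block P"
  shows "dilation P s ** (mat 1 + c) = (mat 1 + s *\<^sub>m c) ** dilation P s"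
  using unipotent_blockD[OF assms] by (simp add: dilation_def mat_algebra)

definition shear :: "'a::field^'n^'n \<Rightarrow> ('a^'n^'n) \<times> ('a^'n^'n) \<Rightarrow> ('a^'n^'n) \<times> ('a^'n^'n)" where
  "shear c p = ((mat 1 + c) ** fst p, snd p ** (mat 1 - c))"

lemma shear_0 [simp]: "shear 0 p = p"
  by (simp add: shear_def)

lemma shear_shear:
  assumes "x \<in> unipotent_block P" "y \<in> unipotent_block P" shows "shear x (shear y p) = shear (x + y) p"
  using unipotent_block_mult[OF assms] unipotent_block_mult[OF assms(2,1)]
  by (simp add: shear_def mat_algebra matrix_mul_assoc_eq[of x y 0])

lemma shear_minus_shear: "c ** c = 0 \<Longrightarrow> shear (- c) (shear c p) = p"
  by (cases p) (simp add: shear_def mat_algebra matrix_mul_assoc_eq[of c c 0])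

definition dilate :: "'a::field^'n^'n \<Rightarrow> 'a \<Rightarrow> ('a^'n^'n) \<times> ('a^'n^'n) \<Rightarrow> ('a^'n^'n) \<times> ('a^'n^'n)" where
  "dilate P s p = (dilation P s ** fst p, snd p ** (s *\<^sub>m dilation P (inverse s)))"

lemma dilate_1: "dilate P 1 p = p"
  by (simp add: dilate_def dilation_1)

lemma dilate_shear:
  assumes c_block: "c \<in> unipotent_block P" and s_nz: "s \<noteq> 0"
  shows "dilate P s (shear c p) = shear (s *\<^sub>m c) (dilate P s p)"
proof -
  have "dilation P (inverse s) ** (mat 1 + (- s) *\<^sub>m c)
      = (mat 1 + inverse s *\<^sub>m ((- s) *\<^sub>m c)) ** dilation P (inverse s)"
    by (rule dilation_conj_unipotent[OF unipotent_block_scale_mat[OF c_block]])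
  then have "(mat 1 - c) ** dilation P (inverse s) = dilation P (inverse s) ** (mat 1 - s *\<^sub>m c)"
    using s_nz by (simp add: scale_mat_scale_mat scale_mat_minus scale_mat_minus_left)
  then show ?thesis
    using dilation_conj_unipotent[OF c_block, of s]
    by (simp add: dilate_def shear_def scale_mat_mult_left scale_mat_mult_right)
      (metis matrix_mul_assoc)
qed

text \<open>Conjugating by dilations contracts \<open>c\<close> to \<open>0\<close> without changing the determinant.\<close>

lemma det_unipotent:
  fixes P :: "'a::nonarch_local_field^'n^'n"
  assumes idem: "P ** P = P" and c_block: "c \<in> unipotent_block P" shows "det (mat 1 + c) = 1"
proof -
  have "det (mat 1 + s *\<^sub>m c) = det (mat 1 + c)" if "s \<noteq> 0" for s
  proof -
    have "det (dilation P s) * det (dilation P (inverse s)) = 1"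
      using that by (simp add: det_mul[symmetric] dilation_mult[OF idem] dilation_1)
    moreover have "det (dilation P s) * det (mat 1 + c) = det (mat 1 + s *\<^sub>m c) * det (dilation P s)"
      unfolding det_mul[symmetric] dilation_conj_unipotent[OF c_block] ..
    ultimately show ?thesis by (auto simp: mult.commute)
  qed
  then have "((\<lambda>s. det (mat 1 + s *\<^sub>m c)) \<longlongrightarrow> det (mat 1 + c)) (at 0)"
    by (intro tendsto_eventually) (simp add: eventually_at_filter)
  moreover have "((\<lambda>s. det (mat 1 + s *\<^sub>m c)) \<longlongrightarrow> det (mat 1 + 0 *\<^sub>m c)) (at 0)"
    by (intro tendsto_intros)
  ultimately have "det (mat 1 + c) = det (mat 1 + 0 *\<^sub>m c)"
    by (intro tendsto_unique[of "at 0"]) auto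
  then show ?thesis by simp
qed

text \<open>The column space of \<open>X\<close> is the graph of \<open>B\<close> over that of the projection \<open>P\<close>.\<close>

definition is_graph :: "'a::field^'n^'n \<Rightarrow> 'a^'n^'n \<Rightarrow> 'a^'n^'n \<Rightarrow> bool" where
  "is_graph P B X \<longleftrightarrow> B \<in> unipotent_block P \<and> B ** X = X - P ** X \<and> (\<exists>S. P ** X ** S = P)"

lemma is_graph_unique:
  assumes "is_graph P B X" "is_graph P B' X" shows "B = B'"
proof -
  obtain S where section_S: "P ** X ** S = P" using assms(1) by (auto simp: is_graph_def)
  have "C = (X - P ** X) ** S" if "is_graph P C X" for C
  proof -
    have "C = C ** (P ** X ** S)" using that by (simp add: section_S is_graph_def unipotent_blockD)
    also have "\<dots> = C ** P ** X ** S" by (simp add: matrix_mul_assoc)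
    also have "\<dots> = (X - P ** X) ** S" using that by (simp add: is_graph_def unipotent_blockD)
    finally show ?thesis .
  qed
  then show ?thesis using assms by metis
qed

lemma is_graph_translate:
  assumes "is_graph P B X" "c \<in> unipotent_block P"
  shows "is_graph P (B + c) ((mat 1 + c) ** X)"
  unfolding is_graph_def
proof (intro conjI)
  have B_block: "B \<in> unipotent_block P" "B ** X = X - P ** X" using assms(1)
    by (simp_all add: is_graph_def)
  show "B + c \<in> unipotent_block P"
    by (intro add_subgroup_add[OF add_subgroup_unipotent_block] B_block assms(2))
  have P_mult: "P ** ((mat 1 + c) ** X) = P ** X"
    using assms(2) by (simp add: mat_algebra matrix_mul_assoc_eq[OF unipotent_blockD(1)])
  then show "\<exists>S. P ** ((mat 1 + c) ** X) ** S = P" using assms(1) by (simp add: is_graph_def)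
  have "(B + c) ** ((mat 1 + c) ** X) = B ** X + c ** X"
    using unipotent_block_mult[OF B_block(1) assms(2)] unipotent_block_mult[OF assms(2) assms(2)]
    by (simp add: mat_algebra matrix_mul_assoc_eq)
  then show "(B + c) ** ((mat 1 + c) ** X) = (mat 1 + c) ** X - P ** ((mat 1 + c) ** X)"
    unfolding P_mult by (simp add: B_block(2) mat_algebra)
qed

lemma is_graph_dilate:
  assumes idem: "P ** P = P" and graph: "is_graph P B X"
  shows "is_graph P (s *\<^sub>m B) (dilation P s ** X)"
  unfolding is_graph_def
proof (intro conjI)
  have B_block: "B \<in> unipotent_block P" "B ** X = X - P ** X" using graph
    by (simp_all add: is_graph_def)
  show "s *\<^sub>m B \<in> unipotent_block P" using B_block(1) by (rule unipotent_block_scale_mat)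
  have P_mult: "P ** (dilation P s ** X) = P ** X"
    by (simp add: dilation_def mat_algebra matrix_mul_assoc_eq[OF idem])
  then show "\<exists>S. P ** (dilation P s ** X) ** S = P" using graph by (simp add: is_graph_def)
  have "B ** (dilation P s ** X) = B ** X"
    by (simp add: dilation_def mat_algebra matrix_mul_assoc_eq[OF unipotent_blockD(2)[OF B_block(1)]])
  then show "(s *\<^sub>m B) ** (dilation P s ** X) = dilation P s ** X - P ** (dilation P s ** X)"
    unfolding P_mult scale_mat_mult_left B_block(2) by (simp add: dilation_def mat_algebra B_block(2))
qed

lemma dilate_shear_minus_graph:
  assumes idem: "P ** P = P" and graph: "is_graph P B X" and orth: "Y ** X = 0" and s_nz: "s \<noteq> 0"
  shows "dilate P s (shear (- B) (X, Y)) = shear (- B) (X, Y)"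
proof -
  obtain S where B_block: "B \<in> unipotent_block P" "B ** X = X - P ** X" and section_S: "P ** X ** S = P"
    using graph by (auto simp: is_graph_def)
  have foot: "(mat 1 - B) ** X = P ** X" by (simp add: mat_algebra B_block(2))
  have "(Y ** (mat 1 + B)) ** ((mat 1 - B) ** X) = Y ** ((mat 1 + B) ** (mat 1 - B)) ** X"
    by (simp add: matrix_mul_assoc)
  then have "Y ** (mat 1 + B) ** (P ** X) ** S = 0"
    unfolding foot unipotent_inverse(1)[OF unipotent_block_mult[OF B_block(1,1)]] using orth by simp
  then have "Y ** (mat 1 + B) ** P = 0" using section_S by (simp add: matrix_mul_assoc[symmetric])
  then have "(Y ** (mat 1 + B)) ** (s *\<^sub>m dilation P (inverse s)) = Y ** (mat 1 + B)"
    using s_nz by (simp add: dilation_def matrix_add_ldistrib matrix_diff_ldistrib scale_mat_mult_right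
        scale_mat_add scale_mat_scale_mat)
  moreover have "dilation P s ** (P ** X) = P ** X"
    by (simp add: dilation_def mat_algebra matrix_mul_assoc_eq[OF idem])
  ultimately show ?thesis by (simp add: dilate_def shear_def foot)
qed

text \<open>In the coordinate \<open>b = B + c\<close> translations of \<open>c\<close> become translations and dilations become scalings.\<close>

lemma dilate_shear_graph:
  assumes idem: "P ** P = P" and graph: "is_graph P B X" and orth: "Y ** X = 0"
    and c_block: "c \<in> unipotent_block P" and s_nz: "s \<noteq> 0"
  shows "dilate P s (shear c (X, Y)) = shear (s *\<^sub>m (B + c)) (shear (- B) (X, Y))"
proof -
  have B_block: "B \<in> unipotent_block P" "- B \<in> unipotent_block P"
    using graph add_subgroup_minus[OF add_subgroup_unipotent_block] by (auto simp: is_graph_def)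
  have b_block: "B + c \<in> unipotent_block P"
    by (intro add_subgroup_add[OF add_subgroup_unipotent_block] B_block c_block)
  have "shear c (X, Y) = shear (B + c) (shear (- B) (X, Y))"
    by (simp add: shear_shear[OF b_block B_block(2)])
  then show ?thesis
    by (simp add: dilate_shear[OF b_block s_nz] dilate_shear_minus_graph[OF idem graph orth s_nz])
qed

lemma ex_continuous_section:
  fixes X0 R :: "'a::nonarch_local_field^'n^'n"
  defines "P \<equiv> X0 ** R"
  assumes gen_inv: "X0 ** R ** X0 = X0"
  obtains S where "(S \<longlongrightarrow> R ** P) (nhds X0)"
    "\<forall>\<^sub>F X in nhds X0. P ** X ** S X = P \<and> S X ** P = S X"
proof -
  have idem: "P ** P = P" using gen_inv by (simp add: P_def matrix_mul_assoc)
  define A where "A X = P ** X ** R + (mat 1 - P)" for X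
  have "(A \<longlongrightarrow> A X0) (nhds X0)"
    unfolding A_def by (intro tendsto_intros filterlim_ident)
  moreover have "A X0 = mat 1"
    by (simp add: A_def P_def matrix_mul_assoc[symmetric]) (simp add: matrix_mul_assoc gen_inv)
  ultimately have A_lim: "(A \<longlongrightarrow> mat 1) (nhds X0)" by simp
  define S where "S X = R ** matrix_inv (A X) ** P" for X
  have "(S \<longlongrightarrow> R ** matrix_inv (mat 1) ** P) (nhds X0)"
    unfolding S_def[abs_def] by (intro tendsto_intros A_lim GL_one)
  moreover have "\<forall>\<^sub>F X in nhds X0. P ** X ** S X = P \<and> S X ** P = S X"
    using eventually_GL[OF A_lim GL_one]
  proof eventually_elim
    case (elim X)
    have "P ** X ** R = P ** A X" by (simp add: A_def mat_algebra idem matrix_mul_assoc_eq[OF idem])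
    then have "P ** X ** S X = P ** (A X ** matrix_inv (A X)) ** P"
      by (simp add: S_def matrix_mul_assoc)
    then show ?case
      using elim by (simp add: matrix_inv_left_right idem) (simp add: S_def mat_algebra idem)
  qed
  ultimately show thesis using that by (simp add: matrix_inv_one)
qed

lemma col_rank_lower_semicontinuous:
  fixes X0 :: "'a::nonarch_local_field^'n^'n"
  shows "\<forall>\<^sub>F X in nhds X0. col_rank X0 \<le> col_rank X"
proof -
  obtain R where gen_inv: "X0 ** R ** X0 = X0" using ex_generalized_inverse by blast
  obtain S where "\<forall>\<^sub>F X in nhds X0. X0 ** R ** X ** S X = X0 ** R \<and> S X ** (X0 ** R) = S X"
    using ex_continuous_section[OF gen_inv] by blast
  then show ?thesis
  proof eventually_elim
    case (elim X)
    have "col_rank X0 \<le> col_rank (X0 ** R)" using col_rank_mult_le_left[of "X0 ** R" X0] gen_inv by simp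
    also have "\<dots> \<le> col_rank (X0 ** R ** X)" using col_rank_mult_le_left[of "X0 ** R ** X" "S X"] elim
      by simp
    also have "\<dots> \<le> col_rank X" by (rule col_rank_mult_le_right)
    finally show ?case .
  qed
qed

text \<open>Near \<open>X0\<close>, a matrix of the same rank is the graph of a block that is small because it depends
  continuously on the matrix and vanishes at \<open>X0\<close>.\<close>

lemma (in uniformized) eventually_is_graph:
  fixes X0 R :: "'a^'n^'n"
  defines "P \<equiv> X0 ** R"
  assumes gen_inv: "X0 ** R ** X0 = X0"
  shows "\<forall>\<^sub>F X in nhds X0. col_rank X \<le> col_rank X0 \<longrightarrow> (\<exists>B\<in>lattice 0. is_graph P B X)"
proof -
  have PX0: "P ** X0 = X0" and idem: "P ** P = P" using gen_inv
    by (simp_all add: P_def matrix_mul_assoc)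
  obtain S where section_S: "(S \<longlongrightarrow> R ** P) (nhds X0)"
    "\<forall>\<^sub>F X in nhds X0. P ** X ** S X = P \<and> S X ** P = S X"
    using ex_continuous_section[OF gen_inv] unfolding P_def by blast
  have "((\<lambda>X. (mat 1 - P) ** X ** S X) \<longlongrightarrow> (mat 1 - P) ** X0 ** (R ** P)) (nhds X0)"
    by (intro tendsto_intros filterlim_ident section_S)
  also have "(mat 1 - P) ** X0 ** (R ** P) = 0" by (simp add: mat_algebra PX0)
  finally have "\<forall>\<^sub>F X in nhds X0. (mat 1 - P) ** X ** S X \<in> lattice 0"
    by (rule topological_tendstoD[OF _ open_lattice]) simp
  with section_S(2) show ?thesis
  proof eventually_elim
    case (elim X)
    let ?B = "(mat 1 - P) ** X ** S X"
    have "is_graph P ?B X" if rank: "col_rank X \<le> col_rank X0"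
      unfolding is_graph_def
    proof (intro conjI)
      show "?B \<in> unipotent_block P"
        using elim by (simp add: unipotent_block_def mat_algebra matrix_mul_assoc_eq[OF idem] idem)
      show "\<exists>T. P ** X ** T = P" using elim by blast
      note rank
      also have "col_rank X0 \<le> col_rank P" using col_rank_mult_le_left[of P X0] PX0 by simp
      also have "col_rank P \<le> col_rank (P ** X)" using col_rank_mult_le_left[of "P ** X" "S X"] elim
        by simp
      finally have "X ** (S X ** X) = X ** mat 1"
      proof (rule mult_left_cancel_if_col_rank_le)
        have "P ** X ** (S X ** X) = P ** X" using elim by (simp add: matrix_mul_assoc)
        then show "P ** X ** (S X ** X) = P ** X ** mat 1" by simp
      qed
      then have "?B ** X = (mat 1 - P) ** X" by (simp add: matrix_mul_assoc[symmetric])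
      then show "?B ** X = X - P ** X" by (simp add: mat_algebra)
    qed
    then show ?case using elim by blast
  qed
qed

subsection \<open>Averaging over unipotent blocks\<close>

context uniformized
begin

lemma scale_mat_in_lattice: "v c \<le> q a \<Longrightarrow> X \<in> lattice k \<Longrightarrow> c *\<^sub>m X \<in> lattice (a + k)"
  unfolding lattice_def by (auto simp: v_mult q_add intro!: mult_mono)

lemma scale_unif_in_lattice: "X \<in> lattice k \<Longrightarrow> \<pi> *\<^sub>m X \<in> lattice k"
  using scale_unif_in_lattice_iff[of X k] lattice_antimono[of "\<pi> *\<^sub>m X" "k + 1" k] by simp

lemma add_subgroup_lattice: "add_subgroup (lattice k)"
  by (simp add: add_subgroup_def lattice_diff)

definition unipotent_invariant :: "int \<Rightarrow> (('a^'n^'n) \<times> ('a^'n^'n) \<Rightarrow> complex) \<Rightarrow> bool" where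
  "unipotent_invariant l \<psi> \<longleftrightarrow> (\<forall>c\<in>lattice l. c ** c = 0 \<longrightarrow> (\<forall>p. \<psi> (shear c p) = \<psi> p))"

lemma ex_unipotent_invariant:
  fixes \<psi> :: "('a^'n^'n) \<times> ('a^'n^'n) \<Rightarrow> complex"
  assumes smooth: "\<psi> \<in> Cc_infty" shows "\<exists>l\<ge>0. unipotent_invariant l \<psi>"
proof -
  have "\<forall>\<^sub>F (x, c) in nhds p \<times>\<^sub>F nhds 0. \<psi> (shear c x) = \<psi> x" for p
  proof -
    have "((\<lambda>y. shear (snd y) (fst y)) \<longlongrightarrow> shear 0 p) (nhds p \<times>\<^sub>F nhds 0)"
      unfolding shear_def by (intro tendsto_intros filterlim_fst filterlim_snd)
    then have "filterlim (\<lambda>y. shear (snd y) (fst y)) (nhds p) (nhds p \<times>\<^sub>F nhds 0)" by simp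
    then have "\<forall>\<^sub>F y in nhds p \<times>\<^sub>F nhds 0. \<psi> (shear (snd y) (fst y)) = \<psi> p"
      by (rule eventually_compose_filterlim[OF Cc_infty_eventually_eq[OF smooth]])
    moreover have "\<forall>\<^sub>F y in nhds p \<times>\<^sub>F nhds 0. \<psi> (fst y) = \<psi> p"
      by (rule eventually_compose_filterlim[OF Cc_infty_eventually_eq[OF smooth] filterlim_fst])
    ultimately show ?thesis by eventually_elim (simp add: case_prod_unfold)
  qed
  then have "\<forall>\<^sub>F c in nhds 0. \<forall>x\<in>{x. \<psi> x \<noteq> 0}. \<psi> (shear c x) = \<psi> x"
    by (intro compact_eventually_all Cc_infty_compact_support[OF smooth])
  then obtain k where inv_on_support: "\<And>c x. c \<in> lattice k \<Longrightarrow> \<psi> x \<noteq> 0 \<Longrightarrow> \<psi> (shear c x) = \<psi> x"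
    by (rule ex_lattice_subset_nhd) blast
  have "\<psi> (shear c x) = \<psi> x" if c_small: "c \<in> lattice (max 0 k)" "c ** c = 0" for c x
  proof (cases "\<psi> x = 0")
    case True
    have c_k: "c \<in> lattice k" by (rule lattice_antimono[OF c_small(1)]) simp
    show ?thesis
      using inv_on_support[of "- c" "shear c x"] c_k True
      by (auto simp: shear_minus_shear[OF c_small(2)])
  next
    case False
    then show ?thesis using inv_on_support lattice_antimono[OF c_small(1)] by simp
  qed
  then show ?thesis by (intro exI[of _ "max 0 k"]) (simp add: unipotent_invariant_def)
qed

lemma unipotent_invariant_congruent:
  assumes inv: "unipotent_invariant l \<psi>"
    and xy_block: "x \<in> unipotent_block P" "y \<in> unipotent_block P" "x - y \<in> lattice l"
  shows "\<psi> (shear x p) = \<psi> (shear y p)"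
proof -
  have diff: "x - y \<in> unipotent_block P"
    using add_subgroup_diff[OF add_subgroup_unipotent_block] xy_block(1,2) .
  have "\<psi> (shear (x - y) (shear y p)) = \<psi> (shear y p)"
    using inv xy_block(3) unipotent_block_mult[OF diff diff] unfolding unipotent_invariant_def by blast
  then show ?thesis by (simp add: shear_shear[OF diff xy_block(2)])
qed

definition supported_on_graphs :: "'a^'n^'n \<Rightarrow> (('a^'n^'n) \<times> ('a^'n^'n) \<Rightarrow> complex) \<Rightarrow> bool" where
  "supported_on_graphs P \<psi> \<longleftrightarrow>
    (\<forall>X Y. \<psi> (X, Y) \<noteq> 0 \<longrightarrow> col_rank X \<le> col_rank P \<longrightarrow> (\<exists>B\<in>lattice 0. is_graph P B X))"

lemma is_graph_if_dilate_shear_nonzero: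
  assumes idem: "P ** P = P" and graph: "supported_on_graphs P \<psi>"
    and c_block: "c \<in> unipotent_block P" "c \<in> lattice (- 1)"
    and s_bound: "s \<noteq> 0" "v (inverse s) \<le> q (- 1)"
    and rank: "col_rank X \<le> col_rank P"
    and nonzero: "\<psi> (dilate P s (shear c (X, Y))) \<noteq> 0"
  shows "\<exists>B\<in>lattice (- 1). is_graph P B X"
proof -
  have "col_rank (dilation P s ** ((mat 1 + c) ** X)) \<le> col_rank P"
    using col_rank_mult_le_right rank by (meson order_trans)
  with nonzero obtain B where B_graph: "B \<in> lattice 0"
      "is_graph P B (dilation P s ** ((mat 1 + c) ** X))"
    using graph by (auto simp: supported_on_graphs_def dilate_def shear_def)
  have c_minus: "- c \<in> unipotent_block P"
    using add_subgroup_minus[OF add_subgroup_unipotent_block c_block(1)] .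
  have "dilation P (inverse s) ** (dilation P s ** ((mat 1 + c) ** X)) = (mat 1 + c) ** X"
    using s_bound(1) by (simp add: matrix_mul_assoc dilation_mult[OF idem] dilation_1)
  then have "is_graph P (inverse s *\<^sub>m B) ((mat 1 + c) ** X)"
    using is_graph_dilate[OF idem B_graph(2), of "inverse s"] by simp
  then have "is_graph P (inverse s *\<^sub>m B + - c) ((mat 1 + - c) ** ((mat 1 + c) ** X))"
    using c_minus by (rule is_graph_translate)
  also have "(mat 1 + - c) ** ((mat 1 + c) ** X) = X"
    using unipotent_inverse(2)[OF unipotent_block_mult[OF c_block(1,1)]] by (simp add: matrix_mul_assoc)
  finally have "is_graph P (inverse s *\<^sub>m B - c) X" by simp
  moreover have "inverse s *\<^sub>m B - c \<in> lattice (- 1)"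
    using scale_mat_in_lattice[OF s_bound(2) B_graph(1)] c_block(2) by (intro lattice_diff) simp_all
  ultimately show ?thesis by blast
qed

lemma in_lattice_if_shear_nonzero:
  assumes graph: "supported_on_graphs P \<psi>" and B_graph: "is_graph P B X"
    and rank: "col_rank X \<le> col_rank P"
    and b_block: "b \<in> unipotent_block P" and nonzero: "\<psi> (shear b (shear (- B) (X, Y))) \<noteq> 0"
  shows "b \<in> lattice 0"
proof -
  have "- B \<in> unipotent_block P"
    using B_graph add_subgroup_minus[OF add_subgroup_unipotent_block] by (auto simp: is_graph_def)
  then have "is_graph P b ((mat 1 + b) ** ((mat 1 + - B) ** X))"
    using is_graph_translate[OF is_graph_translate[OF B_graph] b_block, of "- B"] by simp
  moreover have "col_rank ((mat 1 + b) ** ((mat 1 + - B) ** X)) \<le> col_rank P"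
    using col_rank_mult_le_right rank by (meson order_trans)
  ultimately show ?thesis
    using graph nonzero is_graph_unique by (fastforce simp: supported_on_graphs_def shear_def)
qed

lemma sum_shear_off_graphs:
  assumes idem: "P ** P = P" and graph: "supported_on_graphs P \<psi>" and rank: "col_rank X \<le> col_rank P"
    and off: "\<not> (\<exists>B\<in>lattice (- 1). is_graph P B X)"
    and R_subset: "R \<subseteq> unipotent_block P \<inter> lattice (- 1)"
  shows "(\<Sum>c\<in>R. \<psi> (dilate P \<pi> (shear c (X, Y)))) = 0" "(\<Sum>c\<in>R. \<psi> (shear c (X, Y))) = 0"
proof -
  have zero: "\<psi> (dilate P s (shear c (X, Y))) = 0" if "c \<in> R" "s = 1 \<or> s = \<pi>" for c s
  proof -
    have "s \<noteq> 0" "v (inverse s) \<le> q (- 1)"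
      using that(2) unif_less by (auto simp: v_inverse power_int_minus one_le_inverse_iff less_imp_le)
    then show ?thesis
      using is_graph_if_dilate_shear_nonzero[OF idem graph _ _ _ _ rank, of c s Y] off that(1)
          R_subset by blast
  qed
  show "(\<Sum>c\<in>R. \<psi> (dilate P \<pi> (shear c (X, Y)))) = 0" using zero by (simp add: sum.neutral)
  show "(\<Sum>c\<in>R. \<psi> (shear c (X, Y))) = 0" using zero[of _ 1] by (simp add: sum.neutral dilate_1)
qed

lemma scale_unif_image_unipotent_block:
  assumes "b \<in> unipotent_block P" "b \<in> lattice (k + 1)"
  shows "b \<in> (*\<^sub>m) \<pi> ` (unipotent_block P \<inter> lattice k)"
proof (rule image_eqI)
  show "b = \<pi> *\<^sub>m (inverse \<pi> *\<^sub>m b)" by (simp add: scale_mat_scale_mat)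
  then show "inverse \<pi> *\<^sub>m b \<in> unipotent_block P \<inter> lattice k"
    using assms scale_unif_in_lattice_iff[of "inverse \<pi> *\<^sub>m b" k]
    by (simp add: unipotent_block_scale_mat)
qed

lemma sum_shear_dilate:
  assumes idem: "P ** P = P" and graph: "supported_on_graphs P \<psi>" and inv: "unipotent_invariant l \<psi>"
    and transversal: "transversal R (unipotent_block P \<inter> lattice (- 1)) (lattice l)"
    and orth: "Y ** X = 0" and rank: "col_rank X \<le> col_rank P"
  shows "(\<Sum>c\<in>R. \<psi> (dilate P \<pi> (shear c (X, Y)))) =
     of_nat (card {c \<in> R. \<pi> *\<^sub>m c \<in> lattice l}) * (\<Sum>c\<in>R. \<psi> (shear c (X, Y)))"
proof (cases "\<exists>B\<in>lattice (- 1). is_graph P B X")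
  case False
  then show ?thesis using transversal
    by (simp add: sum_shear_off_graphs[OF idem graph rank] transversal_def)
next
  case True
  then obtain B where B_graph: "B \<in> lattice (- 1)" "is_graph P B X" by blast
  define H where "H = unipotent_block P \<inter> lattice (- 1)"
  define \<eta> where "\<eta> b = \<psi> (shear b (shear (- B) (X, Y)))" for b
  have B_in_H: "B \<in> H" using B_graph by (simp add: is_graph_def H_def)
  have H_props: "add_subgroup H" "R \<subseteq> H" "transversal R H (lattice l)"
    using transversal add_subgroup_unipotent_block[of P] add_subgroup_lattice[of "- 1"]
    by (auto simp: add_subgroup_def H_def transversal_def)
  have \<pi>H_props: "(*\<^sub>m) \<pi> ` H \<subseteq> H" "(*\<^sub>m) \<pi> ` (H \<inter> lattice l) \<subseteq> lattice l"
    by (auto simp: H_def unipotent_block_scale_mat scale_unif_in_lattice)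
  have \<eta>_cong: "\<eta> x = \<eta> y" if "x \<in> H" "y \<in> H" "x - y \<in> lattice l" for x y
    unfolding \<eta>_def using that by (intro unipotent_invariant_congruent[OF inv]) (auto simp: H_def)
  have \<eta>_supp: "\<eta> b = 0" if b_H: "b \<in> H" "b \<notin> (*\<^sub>m) \<pi> ` H" for b
  proof (rule ccontr)
    assume "\<eta> b \<noteq> 0"
    then have "b \<in> lattice 0"
      using b_H(1) by (intro in_lattice_if_shear_nonzero[OF graph B_graph(2) rank]) (auto simp: \<eta>_def H_def)
    then show False using scale_unif_image_unipotent_block[of b P "- 1"] b_H by (simp add: H_def)
  qed
  have coords: "\<psi> (dilate P s (shear c (X, Y))) = \<eta> (s *\<^sub>m (B + c))" if "c \<in> R" "s \<noteq> 0" for c s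
    using that H_props(2) dilate_shear_graph[OF idem B_graph(2) orth, of c s]
    by (auto simp: \<eta>_def H_def)
  have "(\<Sum>c\<in>R. \<psi> (dilate P \<pi> (shear c (X, Y)))) = (\<Sum>c\<in>R. \<eta> (\<pi> *\<^sub>m (B + c)))"
    by (intro sum.cong refl coords unif_nz)
  also have "\<dots> = of_nat (card {c \<in> R. \<pi> *\<^sub>m c \<in> lattice l}) * (\<Sum>c\<in>R. \<eta> (B + c))"
    by (rule transversal_sum_endomorphism_shift[OF H_props(1) add_subgroup_lattice H_props(3) \<eta>_cong
          scale_mat_diff \<pi>H_props \<eta>_supp B_in_H])
  also have "(\<Sum>c\<in>R. \<eta> (B + c)) = (\<Sum>c\<in>R. \<psi> (shear c (X, Y)))"
    using coords[of _ 1] by (intro sum.cong) (simp_all add: dilate_1)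
  finally show ?thesis .
qed

lemma card_transversal_kernel_ne_1:
  fixes P :: "'a^'n^'n"
  assumes proj: "P ** P = P" "P \<noteq> 0" "P \<noteq> mat 1" and l_nonneg: "0 \<le> l"
    and transversal: "transversal R (unipotent_block P \<inter> lattice (- 1)) (lattice l)"
  shows "card {c \<in> R. \<pi> *\<^sub>m c \<in> lattice l} \<noteq> 1"
proof
  assume "card {c \<in> R. \<pi> *\<^sub>m c \<in> lattice l} = 1"
  then obtain r where unique_r: "\<And>c. c \<in> R \<Longrightarrow> \<pi> *\<^sub>m c \<in> lattice l \<Longrightarrow> c = r"
    by (auto simp: card_1_singleton_iff)
  obtain E where D_nz: "(mat 1 - P) ** E ** P \<noteq> 0"
    using ex_two_sided_mult_nz[of "mat 1 - P" P] proj by auto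
  define D where "D = (mat 1 - P) ** E ** P"
  have D_block: "D \<in> unipotent_block P"
    by (simp add: D_def unipotent_block_def mat_algebra proj(1) matrix_mul_assoc_eq[OF proj(1)])
  obtain k where D_boundary: "D \<in> lattice k" "D \<notin> lattice (k + 1)"
    using ex_lattice_boundary D_nz by (auto simp: D_def)
  define c where "c = (\<pi> powi (l - 1 - k)) *\<^sub>m D"
  have c_kernel: "c \<in> unipotent_block P \<inter> lattice (- 1)" "\<pi> *\<^sub>m c \<in> lattice l" "c \<notin> lattice l"
    using D_boundary D_block l_nonneg scale_unif_powi_in_lattice_iff[of "l - 1 - k" D k]
      scale_unif_powi_in_lattice_iff[of "l - 1 - k" D "k + 1"]
      scale_unif_in_lattice_iff[of c "l - 1"] lattice_antimono[of c "l - 1" "- 1"]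
    by (auto simp: c_def unipotent_block_scale_mat)
  have rep: "x - r \<in> lattice l"
      if x_kernel: "x \<in> unipotent_block P \<inter> lattice (- 1)" "\<pi> *\<^sub>m x \<in> lattice l" for x
  proof -
    obtain r' where r'_rep: "r' \<in> R" "x - r' \<in> lattice l" using transversal x_kernel(1)
      unfolding transversal_def by blast
    then have "\<pi> *\<^sub>m r' \<in> lattice l"
      using lattice_diff[OF x_kernel(2) scale_unif_in_lattice[OF r'_rep(2)]]
      by (simp add: scale_mat_diff)
    then show ?thesis using unique_r[OF r'_rep(1)] r'_rep(2) by simp
  qed
  have "0 - r \<in> lattice l" by (rule rep) (simp_all add: unipotent_block_def)
  then show False using lattice_diff[OF rep[OF c_kernel(1,2)], of "0 - r"] c_kernel(3) by simp
qed

end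

context test_functions
begin

lemma ex_transversal_unipotent_block:
  fixes P :: "'a^'n^'n"
  shows "\<exists>R. transversal R (unipotent_block P \<inter> lattice k) (lattice l)"
proof -
  have "closed (unipotent_block P :: ('a^'n^'n) set)"
    unfolding unipotent_block_def by (intro closed_Collect_conj closed_Collect_eq continuous_intros)
  then have "compact (unipotent_block P \<inter> lattice k)"
    using compact_Int_closed[OF compact_lattice] by (simp add: Int_commute)
  then show ?thesis by (rule ex_transversal[OF _ add_subgroup_lattice open_lattice])
qed

lemma dilation_unif_GL:
  fixes P :: "'a^'n^'n"
  assumes "P ** P = P"
  shows "inverse \<pi> *\<^sub>m dilation P \<pi> \<in> GL"
    and "matrix_inv (inverse \<pi> *\<^sub>m dilation P \<pi>) = \<pi> *\<^sub>m dilation P (inverse \<pi>)"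
proof -
  have "(inverse \<pi> *\<^sub>m dilation P \<pi>) ** (\<pi> *\<^sub>m dilation P (inverse \<pi>)) = mat 1"
    by (simp add: mat_algebra dilation_mult[OF assms] dilation_1)
  then show "inverse \<pi> *\<^sub>m dilation P \<pi> \<in> GL"
    "matrix_inv (inverse \<pi> *\<^sub>m dilation P \<pi>) = \<pi> *\<^sub>m dilation P (inverse \<pi>)"
    by (rule matrix_inv_eqI)+
qed

lemma hecke_diff_dilation:
  fixes P :: "'a^'n^'n"
  assumes "P ** P = P"
  shows "hecke_diff (inverse \<pi> *\<^sub>m dilation P \<pi>) \<kappa> \<psi> p = \<psi> (dilate P \<pi> p) - \<kappa> * \<psi> p"
  by (simp add: hecke_diff_def translate_def dilate_def dilation_unif_GL(2)[OF assms]
    scale_mat_scale_mat)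

lemma translate_unipotent:
  fixes c :: "'a^'n^'n"
  assumes "c ** c = 0"
  shows "mat 1 + c \<in> GL" "translate (mat 1 + c) (matrix_inv (mat 1 + c)) \<psi> p = \<psi> (shear c p)"
  using matrix_inv_eqI[OF unipotent_inverse(1)[OF assms]] by (simp_all add: translate_def shear_def)

lemma vanishes_below_rank_block_average:
  fixes \<psi> :: "('a^'n^'n) \<times> ('a^'n^'n) \<Rightarrow> complex"
  assumes smooth: "\<psi> \<in> Cc_infty" and idem: "P ** P = P"
    and graph: "supported_on_graphs P \<psi>" and inv: "unipotent_invariant l \<psi>"
    and transversal: "transversal R (unipotent_block P \<inter> lattice (- 1)) (lattice l)"
  defines "\<kappa> \<equiv> of_nat (card {c \<in> R. \<pi> *\<^sub>m c \<in> lattice l})"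
  shows "vanishes_below_rank (Suc (col_rank P))
    (average R ((+) (mat 1)) (hecke_diff (inverse \<pi> *\<^sub>m dilation P \<pi>) \<kappa> \<psi>))"
    (is "vanishes_below_rank _ (average R _ ?\<xi>)")
  unfolding vanishes_below_rank_def
proof (intro conjI allI impI)
  have c_sq: "c ** c = 0" if "c \<in> R" for c
    using transversal that by (auto simp: transversal_def unipotent_block_mult)
  have "((+) (mat 1)) ` R \<subseteq> GL" using translate_unipotent(1)[OF c_sq] by blast
  then show "average R ((+) (mat 1)) ?\<xi> \<in> Cc_infty"
    by (intro Cc_infty_average Cc_infty_hecke_diff smooth dilation_unif_GL(1) idem)
  fix X Y :: "'a^'n^'n" assume low_rank_pair: "X ** Y = 0" "Y ** X = 0" "col_rank X < Suc (col_rank P)"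
  have "(\<Sum>c\<in>R. translate (mat 1 + c) (matrix_inv (mat 1 + c)) ?\<xi> (X, Y))
      = (\<Sum>c\<in>R. \<psi> (dilate P \<pi> (shear c (X, Y))) - \<kappa> * \<psi> (shear c (X, Y)))"
    by (rule sum.cong[OF refl])
      (simp only: translate_unipotent(2)[OF c_sq] hecke_diff_dilation[OF idem])
  also have "\<dots> = 0"
    using low_rank_pair(3) unfolding sum_subtractf sum_distrib_left[symmetric] \<kappa>_def
    by (simp add: sum_shear_dilate[OF idem graph inv transversal low_rank_pair(2)])
  finally show "average R ((+) (mat 1)) ?\<xi> (X, Y) = 0" by (simp add: average_def)
qed

lemma reducible_to_if_supported_on_graphs:
  fixes \<psi> :: "('a^'n^'n) \<times> ('a^'n^'n) \<Rightarrow> complex"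
  assumes smooth: "\<psi> \<in> Cc_infty" and proj: "P ** P = P" "P \<noteq> 0" "P \<noteq> mat 1"
    and graph: "supported_on_graphs P \<psi>"
  shows "reducible_to (Suc (col_rank P)) (phi_tilde \<mu> \<psi>) (zeta_coeff \<psi>)"
proof -
  obtain l where radius: "0 \<le> l" "unipotent_invariant l \<psi>" using ex_unipotent_invariant[OF smooth]
    by blast
  obtain R where transversal: "transversal R (unipotent_block P \<inter> lattice (- 1)) (lattice l)"
    using ex_transversal_unipotent_block by blast
  define \<kappa> :: complex where "\<kappa> = of_nat (card {c \<in> R. \<pi> *\<^sub>m c \<in> lattice l})"
  have \<kappa>_ne_1: "\<kappa> \<noteq> 1"
    using card_transversal_kernel_ne_1[OF proj radius(1) transversal] by (simp add: \<kappa>_def)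
  define g where "g = inverse \<pi> *\<^sub>m dilation P \<pi>"
  have g_GL: "g \<in> GL" unfolding g_def by (rule dilation_unif_GL(1)[OF proj(1)])
  have "0 \<in> unipotent_block P \<inter> lattice (- 1)" by (simp add: unipotent_block_def)
  then have R_block: "finite R" "R \<noteq> {}" "R \<subseteq> unipotent_block P"
    using transversal unfolding transversal_def by blast+
  have "det (mat 1 + c) = 1" if "c \<in> R" for c
    using R_block(3) that by (intro det_unipotent[OF proj(1)]) blast
  then have unipotent: "(+) (mat 1) ` R \<subseteq> GL" "\<And>c. c \<in> R \<Longrightarrow> val (det (mat 1 + c)) = 0"
    by (auto simp: GL_iff_det val_eqI)
  define \<xi> where "\<xi> = average R ((+) (mat 1)) (hecke_diff g \<kappa> \<psi>)"
  have hecke: "hecke_diff g \<kappa> \<psi> \<in> Cc_infty" by (intro Cc_infty_hecke_diff smooth g_GL)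
  have "vanishes_below_rank (Suc (col_rank P)) \<xi>"
    unfolding \<xi>_def \<kappa>_def g_def
    by (rule vanishes_below_rank_block_average[OF smooth proj(1) graph radius(2) transversal])
  moreover have "\<forall>\<^sub>F t in at 0. shift_diff ((*) \<pi>) \<kappa> (phi_tilde \<mu> \<psi>) t = phi_tilde \<mu> \<xi> t"
    unfolding \<xi>_def using unipotent R_block hecke smooth g_GL
    by (auto simp: eventually_at_filter phi_tilde_average phi_tilde_hecke_diff)
  ultimately have
      "reducible_to (Suc (col_rank P)) (shift_diff ((*) \<pi>) \<kappa> (phi_tilde \<mu> \<psi>)) (zeta_coeff \<xi>)"
    by (rule reducible_to.base)
  also have "zeta_coeff \<xi> = shift_diff (\<lambda>k. k + hecke_degree g) \<kappa> (zeta_coeff \<psi>)"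
    unfolding \<xi>_def zeta_coeff_hecke_diff[OF smooth g_GL, symmetric]
    using unipotent R_block by (intro zeta_coeff_average hecke) auto
  finally show ?thesis by (rule reducible_to.step[OF g_GL \<kappa>_ne_1])
qed

lemma reducible_to_if_supported_near:
  fixes X0 :: "'a^'n^'n"
  assumes rank: "1 \<le> col_rank X0" "col_rank X0 < CARD('n)"
  obtains U where "open U" "X0 \<in> U"
    "\<And>\<psi>. \<psi> \<in> Cc_infty \<Longrightarrow> (\<And>X Y. \<psi> (X, Y) \<noteq> 0 \<Longrightarrow> X \<in> U) \<Longrightarrow>
      reducible_to (Suc (col_rank X0)) (phi_tilde \<mu> \<psi>) (zeta_coeff \<psi>)"
proof -
  obtain R where gen_inv: "X0 ** R ** X0 = X0" using ex_generalized_inverse by blast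
  define P where "P = X0 ** R"
  have PX0: "P ** X0 = X0" and idem: "P ** P = P" using gen_inv
    by (simp_all add: P_def matrix_mul_assoc)
  have rank_P: "col_rank P = col_rank X0"
    using col_rank_mult_le_left[of X0 R] col_rank_mult_le_left[of P X0] PX0 by (simp add: P_def)
  have "P \<noteq> 0" using rank(1) rank_P col_rank_eq_0_iff[of P] by auto
  moreover have "P \<noteq> mat 1" using rank(2) rank_P col_rank_less_iff[of P] GL_one by auto
  moreover obtain U where nhd: "open U" "X0 \<in> U"
    "\<And>X. X \<in> U \<Longrightarrow> col_rank X \<le> col_rank X0 \<Longrightarrow> \<exists>B\<in>lattice 0. is_graph P B X"
    using eventually_is_graph[OF gen_inv] unfolding eventually_nhds P_def by blast
  ultimately have reducible: "reducible_to (Suc (col_rank X0)) (phi_tilde \<mu> \<psi>) (zeta_coeff \<psi>)"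
    if "\<psi> \<in> Cc_infty" "supported_on_graphs P \<psi>" for \<psi>
    using reducible_to_if_supported_on_graphs[OF that(1) idem _ _ that(2)] rank_P by simp
  show thesis
  proof (rule that[OF nhd(1,2)])
    fix \<psi> :: "('a^'n^'n) \<times> ('a^'n^'n) \<Rightarrow> complex"
    assume "\<psi> \<in> Cc_infty" "\<And>X Y. \<psi> (X, Y) \<noteq> 0 \<Longrightarrow> X \<in> U"
    then show "reducible_to (Suc (col_rank X0)) (phi_tilde \<mu> \<psi>) (zeta_coeff \<psi>)"
      using nhd(3) rank_P by (intro reducible) (auto simp: supported_on_graphs_def)
  qed
qed

lemma vanishes_below_rank_if_supported_off:
  assumes "\<psi> \<in> Cc_infty" "\<And>X Y. \<psi> (X, Y) \<noteq> 0 \<Longrightarrow> X ** Y \<noteq> 0 \<or> Y ** X \<noteq> 0 \<or> r \<le> col_rank X"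
  shows "vanishes_below_rank r \<psi>"
  using assms by (force simp: vanishes_below_rank_def)

lemma eventually_off_lower_strata:
  fixes X0 Y0 :: "'a^'n^'n"
  assumes "X0 ** Y0 \<noteq> 0 \<or> Y0 ** X0 \<noteq> 0 \<or> r \<le> col_rank X0"
  shows "\<forall>\<^sub>F p in nhds (X0, Y0). fst p ** snd p \<noteq> 0 \<or> snd p ** fst p \<noteq> 0 \<or> r \<le> col_rank (fst p)"
proof -
  have lim: "(fst \<longlongrightarrow> X0) (nhds (X0, Y0))" "(snd \<longlongrightarrow> Y0) (nhds (X0, Y0))"
    using tendsto_fst[OF filterlim_ident] tendsto_snd[OF filterlim_ident] by fastforce+
  consider (left) "X0 ** Y0 \<noteq> 0" | (right) "Y0 ** X0 \<noteq> 0" | (rank) "r \<le> col_rank X0" using assms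
    by blast
  then show ?thesis
  proof cases
    case left
    then have "\<forall>\<^sub>F p in nhds (X0, Y0). fst p ** snd p \<noteq> 0"
      by (rule tendsto_imp_eventually_ne[rotated]) (intro tendsto_intros lim)
    then show ?thesis by eventually_elim simp
  next
    case right
    then have "\<forall>\<^sub>F p in nhds (X0, Y0). snd p ** fst p \<noteq> 0"
      by (rule tendsto_imp_eventually_ne[rotated]) (intro tendsto_intros lim)
    then show ?thesis by eventually_elim simp
  next
    case rank
    have "\<forall>\<^sub>F p in nhds (X0, Y0). col_rank X0 \<le> col_rank (fst p)"
      by (rule eventually_compose_filterlim[OF col_rank_lower_semicontinuous lim(1)])
    then show ?thesis by eventually_elim (use rank in simp)
  qed
qed

lemma reducible_to_phi_tilde_add:
  fixes \<psi> \<psi>' :: "('a^'n^'n) \<times> ('a^'n^'n) \<Rightarrow> complex"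
  assumes "\<psi> \<in> Cc_infty" "\<psi>' \<in> Cc_infty"
    and "reducible_to r (phi_tilde \<mu> \<psi>) (zeta_coeff \<psi>)"
        "reducible_to r (phi_tilde \<mu> \<psi>') (zeta_coeff \<psi>')"
  shows "reducible_to r (phi_tilde \<mu> (\<lambda>p. \<psi> p + \<psi>' p)) (zeta_coeff (\<lambda>p. \<psi> p + \<psi>' p))"
proof -
  have "zeta_coeff (\<lambda>p. \<psi> p + \<psi>' p) = (\<lambda>k. zeta_coeff \<psi> k + zeta_coeff \<psi>' k)"
    using zeta_coeff_add[OF assms(1,2)] by (rule ext)
  moreover have "\<forall>\<^sub>F t in at 0. phi_tilde \<mu> (\<lambda>p. \<psi> p + \<psi>' p) t = phi_tilde \<mu> \<psi> t + phi_tilde \<mu> \<psi>' t"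
    by (simp add: eventually_at_filter phi_tilde_add assms(1,2))
  ultimately show ?thesis
    using reducible_to_cong_germ[OF reducible_to_add[OF assms(3,4)]] by (simp only:)
qed

lemma reducible_to_Suc_locally:
  fixes \<phi> :: "('a^'n^'n) \<times> ('a^'n^'n) \<Rightarrow> complex"
  assumes vanishes: "vanishes_below_rank r \<phi>" and r_range: "1 \<le> r" "r < CARD('n)" and p_supp: "\<phi> p \<noteq> 0"
  obtains U where "open U" "p \<in> U"
    "\<And>\<psi>. \<psi> \<in> Cc_infty \<Longrightarrow> (\<And>p. \<psi> p \<noteq> 0 \<Longrightarrow> p \<in> U) \<Longrightarrow> reducible_to (Suc r) (phi_tilde \<mu> \<psi>) (zeta_coeff \<psi>)"
proof -
  obtain X0 Y0 where p_eq: "p = (X0, Y0)" by fastforce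
  show thesis
  proof (cases "col_rank X0 = r")
    case True
    obtain U where nhd: "open U" "X0 \<in> U" "\<And>\<psi>. \<psi> \<in> Cc_infty \<Longrightarrow>
        (\<And>X Y. \<psi> (X, Y) \<noteq> 0 \<Longrightarrow> X \<in> U) \<Longrightarrow> reducible_to (Suc r) (phi_tilde \<mu> \<psi>) (zeta_coeff \<psi>)"
      using reducible_to_if_supported_near[of X0] r_range True by blast
    show thesis
    proof (rule that[of "U \<times> UNIV"])
      fix \<psi> :: "('a^'n^'n) \<times> ('a^'n^'n) \<Rightarrow> complex"
      assume "\<psi> \<in> Cc_infty" and supp: "\<And>p. \<psi> p \<noteq> 0 \<Longrightarrow> p \<in> U \<times> UNIV"
      then show "reducible_to (Suc r) (phi_tilde \<mu> \<psi>) (zeta_coeff \<psi>)" by (intro nhd(3)) auto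
    qed (use nhd(1,2) p_eq in \<open>auto simp: open_Times\<close>)
  next
    case False
    have "X0 ** Y0 \<noteq> 0 \<or> Y0 ** X0 \<noteq> 0 \<or> Suc r \<le> col_rank X0"
      using vanishes p_supp False unfolding p_eq vanishes_below_rank_def by (metis Suc_leI nat_neq_iff)
    then obtain U where nhd: "open U" "p \<in> U"
      "\<And>X Y. (X, Y) \<in> U \<Longrightarrow> X ** Y \<noteq> 0 \<or> Y ** X \<noteq> 0 \<or> Suc r \<le> col_rank X"
      using eventually_off_lower_strata[of X0 Y0 "Suc r"] unfolding eventually_nhds p_eq by force
    show thesis
      by (intro that[OF nhd(1,2)] reducible_to_if_vanishes vanishes_below_rank_if_supported_off)
        (use nhd(3) in blast)+
  qed
qed

lemma reducible_to_Suc: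
  fixes \<phi> :: "('a^'n^'n) \<times> ('a^'n^'n) \<Rightarrow> complex"
  assumes vanishes: "vanishes_below_rank r \<phi>" and r_range: "1 \<le> r" "r < CARD('n)"
  shows "reducible_to (Suc r) (phi_tilde \<mu> \<phi>) (zeta_coeff \<phi>)"
proof -
  define good where "good \<psi> \<longleftrightarrow> \<psi> \<in> Cc_infty \<and> reducible_to (Suc r) (phi_tilde \<mu> \<psi>) (zeta_coeff \<psi>)"
    for \<psi> :: "('a^'n^'n) \<times> ('a^'n^'n) \<Rightarrow> complex"
  have smooth: "\<phi> \<in> Cc_infty" using vanishes by (rule vanishes_below_rank_Cc_infty)
  have "good \<phi>"
  proof (rule clopen_restriction_induct[where P = good])
    show "compact {p. \<phi> p \<noteq> 0}" using smooth by (rule Cc_infty_compact_support)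
    show "good (\<lambda>_. 0)"
      by (simp add: good_def Cc_infty_zero reducible_to_if_vanishes vanishes_below_rank_zero)
    show "good (\<lambda>p. \<psi> p + \<psi>' p)" if "good \<psi>" "good \<psi>'" for \<psi> \<psi>'
      using that by (simp add: good_def Cc_infty_add reducible_to_phi_tilde_add)
    fix p assume "\<phi> p \<noteq> 0"
    then obtain U where nhd: "open U" "p \<in> U" "\<And>\<psi>. \<psi> \<in> Cc_infty \<Longrightarrow>
        (\<And>p. \<psi> p \<noteq> 0 \<Longrightarrow> p \<in> U) \<Longrightarrow> reducible_to (Suc r) (phi_tilde \<mu> \<psi>) (zeta_coeff \<psi>)"
      using reducible_to_Suc_locally[OF vanishes r_range] by metis
    have "good (\<lambda>p. if p \<in> A then \<phi> p else 0)" if clopen_A: "open A" "closed A" "A \<subseteq> U" for A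
      unfolding good_def
      using clopen_A(3)
      by (intro conjI nhd(3) Cc_infty_clopen_restriction[OF smooth clopen_A(1,2)])
        (auto split: if_splits)
    then show "\<exists>U. open U \<and> p \<in> U \<and> (\<forall>A. open A \<longrightarrow> closed A \<longrightarrow> A \<subseteq> U \<longrightarrow>
        good (\<lambda>p. if p \<in> A then \<phi> p else 0))"
      using nhd(1,2) by blast
  qed
  then show ?thesis by (simp add: good_def)
qed

lemma reducible_to_if_vanishes_at_0:
  fixes \<phi> :: "('a^'n^'n) \<times> ('a^'n^'n) \<Rightarrow> complex"
  assumes "vanishes_below_rank 1 \<phi>" "1 \<le> r" "r \<le> CARD('n)"
  shows "reducible_to r (phi_tilde \<mu> \<phi>) (zeta_coeff \<phi>)"
  using assms(2,3)
proof (induction r rule: nat_induct_at_least)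
  case base
  show ?case using assms(1) by (rule reducible_to_if_vanishes)
next
  case (Suc r)
  have "reducible_to r (phi_tilde \<mu> \<phi>) (zeta_coeff \<phi>)" using Suc by simp
  then show ?case by (rule reducible_to_trans) (use Suc in \<open>simp add: reducible_to_Suc\<close>)
qed

subsection \<open>Functions supported on invertible matrices\<close>

lemma top_stratum_support:
  fixes \<psi> :: "('a^'n^'n) \<times> ('a^'n^'n) \<Rightarrow> complex"
  assumes vanishes: "vanishes_below_rank CARD('n) \<psi>"
  shows "{h. \<psi> (h, 0) \<noteq> 0} \<subseteq> GL" "compact {h. \<psi> (h, 0) \<noteq> 0}"
proof -
  show "{h. \<psi> (h, 0) \<noteq> 0} \<subseteq> GL"
  proof
    fix h assume "h \<in> {h. \<psi> (h, 0) \<noteq> 0}"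
    then have "\<not> col_rank h < CARD('n)"
      using vanishes unfolding vanishes_below_rank_def
      by (metis (mono_tags) mem_Collect_eq times0_left times0_right)
    then show "h \<in> GL" by (simp add: col_rank_less_iff)
  qed
  have "compact ({p. \<psi> p \<noteq> 0} \<inter> snd -` {0})"
    using vanishes_below_rank_Cc_infty[OF vanishes]
    by (intro compact_Int_closed Cc_infty_compact_support closed_vimage continuous_intros) auto
  then have "compact (fst ` ({p. \<psi> p \<noteq> 0} \<inter> snd -` {0}))"
    by (intro compact_continuous_image continuous_intros)
  also have "fst ` ({p. \<psi> p \<noteq> 0} \<inter> snd -` {0}) = {h. \<psi> (h, 0) \<noteq> 0}" by force
  finally show "compact {h. \<psi> (h, 0) \<noteq> 0}" .
qed

lemma top_stratum_zeta_coeff: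
  fixes \<psi> :: "('a^'n^'n) \<times> ('a^'n^'n) \<Rightarrow> complex"
  assumes vanishes: "vanishes_below_rank CARD('n) \<psi>"
  shows "finite {k. zeta_coeff \<psi> k \<noteq> 0}" "Sum_any (zeta_coeff \<psi>) = (LINT h|\<mu>. \<psi> (h, 0))"
proof -
  define F where "F = (\<lambda>h. val (det h)) ` {h. \<psi> (h, 0) \<noteq> 0}"
  have finite_F: "finite F"
    unfolding F_def
  proof (rule finite_image_if_locally_constant[OF top_stratum_support(2)[OF vanishes]])
    fix h assume "h \<in> {h. \<psi> (h, 0) \<noteq> 0}"
    then have "det h \<noteq> 0" using top_stratum_support(1)[OF vanishes] by (auto simp: GL_iff_det)
    then show "\<forall>\<^sub>F x in nhds h. val (det x) = val (det h)"
      by (intro eventually_compose_filterlim[OF val_locally_constant] tendsto_intros filterlim_ident)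
  qed
  have supp: "{k. zeta_coeff \<psi> k \<noteq> 0} \<subseteq> F"
  proof
    fix k assume "k \<in> {k. zeta_coeff \<psi> k \<noteq> 0}"
    then have "(LINT h|\<mu>. (if val (det h) = k then \<psi> (h, 0) else 0)) \<noteq> (LINT h|\<mu>. 0)"
      by (simp add: zeta_coeff_def)
    then have "(\<lambda>h. if val (det h) = k then \<psi> (h, 0) else 0) \<noteq> (\<lambda>h. 0)" by metis
    then show "k \<in> F" unfolding F_def by (auto simp: fun_eq_iff split: if_splits)
  qed
  then show "finite {k. zeta_coeff \<psi> k \<noteq> 0}" using finite_F by (rule finite_subset)
  have "Sum_any (zeta_coeff \<psi>) = (\<Sum>k\<in>F. zeta_coeff \<psi> k)"
    by (rule Sum_any.expand_superset[OF finite_F supp])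
  also have "\<dots> = (LINT h|\<mu>. (\<Sum>k\<in>F. (if val (det h) = k then \<psi> (h, 0) else 0)))"
    unfolding zeta_coeff_def
    by (intro Bochner_Integration.integral_sum[symmetric] integrable_zeta_integrand
        vanishes_below_rank_Cc_infty[OF vanishes])
  also have "\<dots> = (LINT h|\<mu>. \<psi> (h, 0))"
    using finite_F by (intro Bochner_Integration.integral_cong) (auto simp: F_def)
  finally show "Sum_any (zeta_coeff \<psi>) = (LINT h|\<mu>. \<psi> (h, 0))" .
qed

lemma top_stratum_invertible_locally:
  fixes \<psi> :: "('a^'n^'n) \<times> ('a^'n^'n) \<Rightarrow> complex"
  assumes vanishes: "vanishes_below_rank CARD('n) \<psi>" and nonzero: "\<psi> (X0, Y0) \<noteq> 0"
    and orth: "X0 ** Y0 = 0" "Y0 ** X0 = 0"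
  shows "\<forall>\<^sub>F p in nhds (X0, Y0). \<psi> (fst p, 0) \<noteq> 0"
proof -
  have smooth: "\<psi> \<in> Cc_infty" using vanishes by (rule vanishes_below_rank_Cc_infty)
  have "X0 \<in> GL"
    using vanishes nonzero orth col_rank_less_iff[of X0] by (auto simp: vanishes_below_rank_def)
  then have "Y0 = matrix_inv X0 ** (X0 ** Y0)" by (simp add: matrix_mul_assoc matrix_inv_left_right)
  then have "\<psi> (X0, 0) \<noteq> 0" using nonzero orth by simp
  moreover have "((\<lambda>p. (fst p, 0 :: 'a^'n^'n)) \<longlongrightarrow> (X0, 0)) (nhds (X0, Y0))"
    using tendsto_fst[OF filterlim_ident, of "(X0, Y0)"] by (intro tendsto_intros) simp
  then have "\<forall>\<^sub>F p in nhds (X0, Y0). \<psi> (fst p, 0) = \<psi> (X0, 0)"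
    by (rule eventually_compose_filterlim[OF Cc_infty_eventually_eq[OF smooth]])
  ultimately show ?thesis by (auto elim: eventually_mono)
qed

lemma eventually_products_ne_scalar:
  fixes X0 Y0 :: "'a^'n^'n"
  assumes "\<not> (X0 ** Y0 = 0 \<and> Y0 ** X0 = 0)"
  shows "\<forall>\<^sub>F (p, t) in nhds (X0, Y0) \<times>\<^sub>F nhds 0.
    \<not> (fst p ** snd p = t *\<^sub>m mat 1 \<and> snd p ** fst p = t *\<^sub>m mat 1)"
proof -
  let ?F = "nhds (X0, Y0) \<times>\<^sub>F nhds (0 :: 'a)"
  have "((\<lambda>x. fst (fst x)) \<longlongrightarrow> X0) ?F" "((\<lambda>x. snd (fst x)) \<longlongrightarrow> Y0) ?F"
    using tendsto_fst[OF filterlim_fst] tendsto_snd[OF filterlim_fst] by fastforce+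
  then have "((\<lambda>x. (fst (fst x) ** snd (fst x) - snd x *\<^sub>m mat 1,
        snd (fst x) ** fst (fst x) - snd x *\<^sub>m mat 1))
      \<longlongrightarrow> (X0 ** Y0 - 0 *\<^sub>m mat 1, Y0 ** X0 - 0 *\<^sub>m mat 1)) ?F"
    by (intro tendsto_intros filterlim_snd)
  then have "\<forall>\<^sub>F x in ?F.
      (fst (fst x) ** snd (fst x) - snd x *\<^sub>m mat 1, snd (fst x) ** fst (fst x) - snd x *\<^sub>m mat 1) \<noteq> 0"
    using assms by (intro tendsto_imp_eventually_ne) (auto simp: zero_prod_def)
  then show ?thesis by eventually_elim (auto simp: zero_prod_def)
qed

lemma top_stratum_eventually_invertible:
  fixes \<psi> :: "('a^'n^'n) \<times> ('a^'n^'n) \<Rightarrow> complex"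
  assumes vanishes: "vanishes_below_rank CARD('n) \<psi>"
  shows "\<forall>\<^sub>F t in nhds 0. \<forall>X Y. X ** Y = t *\<^sub>m mat 1 \<longrightarrow> Y ** X = t *\<^sub>m mat 1 \<longrightarrow> \<psi> (X, Y) \<noteq> 0 \<longrightarrow> \<psi> (X, 0) \<noteq> 0"
proof -
  have "\<forall>\<^sub>F t in nhds 0. \<forall>p\<in>{p. \<psi> p \<noteq> 0}. fst p ** snd p = t *\<^sub>m mat 1 \<and>
      snd p ** fst p = t *\<^sub>m mat 1 \<longrightarrow> \<psi> (fst p, 0) \<noteq> 0"
  proof (rule compact_eventually_all)
    show "compact {p. \<psi> p \<noteq> 0}"
      by (intro Cc_infty_compact_support vanishes_below_rank_Cc_infty[OF vanishes])
    fix p0 assume nonzero: "p0 \<in> {p. \<psi> p \<noteq> 0}"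
    obtain X0 Y0 where p0: "p0 = (X0, Y0)" by fastforce
    show "\<forall>\<^sub>F (p, t) in nhds p0 \<times>\<^sub>F nhds 0. fst p ** snd p = t *\<^sub>m mat 1 \<and>
        snd p ** fst p = t *\<^sub>m mat 1 \<longrightarrow> \<psi> (fst p, 0) \<noteq> 0"
    proof (cases "X0 ** Y0 = 0 \<and> Y0 ** X0 = 0")
      case True
      then have "\<forall>\<^sub>F p in nhds p0. \<psi> (fst p, 0) \<noteq> 0"
        using top_stratum_invertible_locally[OF vanishes] nonzero unfolding p0 by blast
      then have "\<forall>\<^sub>F x in nhds p0 \<times>\<^sub>F nhds (0 :: 'a). \<psi> (fst (fst x), 0) \<noteq> 0"
        by (rule eventually_compose_filterlim[OF _ filterlim_fst])
      then show ?thesis by eventually_elim (simp add: case_prod_unfold)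
    next
      case False
      from eventually_products_ne_scalar[OF False] show ?thesis
        unfolding p0 by eventually_elim (auto simp: case_prod_unfold)
    qed
  qed
  then show ?thesis by eventually_elim auto
qed

lemma top_stratum_eventually_eq:
  fixes \<psi> :: "('a^'n^'n) \<times> ('a^'n^'n) \<Rightarrow> complex"
  assumes vanishes: "vanishes_below_rank CARD('n) \<psi>"
  shows "\<forall>\<^sub>F t in nhds 0. \<forall>h\<in>{h. \<psi> (h, 0) \<noteq> 0}. \<psi> (h, t *\<^sub>m matrix_inv h) = \<psi> (h, 0)"
proof (rule compact_eventually_all[OF top_stratum_support(2)[OF vanishes]])
  have smooth: "\<psi> \<in> Cc_infty" using vanishes by (rule vanishes_below_rank_Cc_infty)
  fix h :: "'a^'n^'n" assume "h \<in> {h. \<psi> (h, 0) \<noteq> 0}"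
  then have h_GL: "h \<in> GL" using top_stratum_support(1)[OF vanishes] by blast
  let ?F = "nhds h \<times>\<^sub>F nhds (0 :: 'a)"
  have "((\<lambda>x. (fst x, snd x *\<^sub>m matrix_inv (fst x))) \<longlongrightarrow> (h, 0 *\<^sub>m matrix_inv h)) ?F"
    by (intro tendsto_intros filterlim_fst filterlim_snd h_GL)
  then have "\<forall>\<^sub>F x in ?F. \<psi> (fst x, snd x *\<^sub>m matrix_inv (fst x)) = \<psi> (h, 0 *\<^sub>m matrix_inv h)"
    by (rule eventually_compose_filterlim[OF Cc_infty_eventually_eq[OF smooth]])
  moreover have "((\<lambda>x. (fst x, 0 :: 'a^'n^'n)) \<longlongrightarrow> (h, 0)) ?F" by (intro tendsto_intros filterlim_fst)
  then have "\<forall>\<^sub>F x in ?F. \<psi> (fst x, 0) = \<psi> (h, 0)"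
    by (rule eventually_compose_filterlim[OF Cc_infty_eventually_eq[OF smooth]])
  ultimately show "\<forall>\<^sub>F (x, t) in ?F. \<psi> (x, t *\<^sub>m matrix_inv x) = \<psi> (x, 0)"
    by eventually_elim (simp add: case_prod_unfold)
qed

lemma top_stratum_integrand_germ:
  fixes \<psi> :: "('a^'n^'n) \<times> ('a^'n^'n) \<Rightarrow> complex"
  assumes vanishes: "vanishes_below_rank CARD('n) \<psi>"
  shows "\<forall>\<^sub>F t in nhds 0. \<forall>h\<in>GL. \<psi> (h, t *\<^sub>m matrix_inv h) = \<psi> (h, 0)"
  using top_stratum_eventually_eq[OF vanishes] top_stratum_eventually_invertible[OF vanishes]
proof eventually_elim
  case (elim t)
  show ?case
  proof
    fix h :: "'a^'n^'n" assume h_GL: "h \<in> GL"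
    have "h ** (t *\<^sub>m matrix_inv h) = t *\<^sub>m mat 1" "(t *\<^sub>m matrix_inv h) ** h = t *\<^sub>m mat 1"
      using h_GL by (simp_all add: mat_algebra matrix_inv_left_right)
    then show "\<psi> (h, t *\<^sub>m matrix_inv h) = \<psi> (h, 0)" using elim by (cases "\<psi> (h, 0) = 0") auto
  qed
qed

lemma top_stratum_germ:
  fixes \<psi> :: "('a^'n^'n) \<times> ('a^'n^'n) \<Rightarrow> complex"
  assumes vanishes: "vanishes_below_rank CARD('n) \<psi>"
  shows "\<forall>\<^sub>F t in at 0. phi_tilde \<mu> \<psi> t = (LINT h|\<mu>. \<psi> (h, 0))"
  unfolding eventually_at_filter
  using top_stratum_integrand_germ[OF vanishes]
proof eventually_elim
  case (elim t)
  show ?case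
  proof (intro impI)
    assume t_nz: "t \<noteq> 0"
    define g where "g = inverse t *\<^sub>m (mat 1 :: 'a^'n^'n)"
    have g_GL: "g \<in> GL" using t_nz by (simp add: g_def GL_scale_mat GL_one)
    have "phi_tilde \<mu> \<psi> t = (LINT h|\<mu>. \<psi> (t *\<^sub>m (g ** h), matrix_inv (g ** h)))"
      unfolding phi_tilde_eq using g_GL vanishes_below_rank_Cc_infty[OF vanishes]
      by (intro integral_left_mult[symmetric] measurable_if_continuous_on_GL
          continuous_on_phi_tilde_integrand)
    also have "\<dots> = (LINT h|\<mu>. \<psi> (h, 0))"
      using t_nz elim by (intro Bochner_Integration.integral_cong)
        (simp_all add: g_def scale_mat_mult_left scale_mat_scale_mat matrix_inv_scale_mat space_mu)
    finally show "phi_tilde \<mu> \<psi> t = (LINT h|\<mu>. \<psi> (h, 0))" .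
  qed
qed

end

context uniformized
begin

subsection \<open>Right ideals of integral matrices\<close>

definition right_ideal_above :: "int \<Rightarrow> ('a^'n^'n) set \<Rightarrow> bool" where
  "right_ideal_above N J \<longleftrightarrow> lattice N \<subseteq> J \<and> J \<subseteq> lattice 0 \<and>
    (\<forall>x\<in>J. \<forall>y\<in>J. x + y \<in> J) \<and> (\<forall>x\<in>J. \<forall>y\<in>lattice 0. x ** y \<in> J)"

lemma
  assumes "right_ideal_above N J"
  shows right_ideal_above_lattice: "x \<in> lattice N \<Longrightarrow> x \<in> J"
    and right_ideal_above_integral: "x \<in> J \<Longrightarrow> x \<in> lattice 0"
    and right_ideal_above_add: "x \<in> J \<Longrightarrow> y \<in> J \<Longrightarrow> x + y \<in> J"
    and right_ideal_above_mult: "x \<in> J \<Longrightarrow> y \<in> lattice 0 \<Longrightarrow> x ** y \<in> J"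
  using assms by (auto simp: right_ideal_above_def)

lemma right_ideal_above_lattice_self: "0 \<le> N \<Longrightarrow> right_ideal_above N (lattice N)"
  by (auto simp: right_ideal_above_def lattice_add lattice_mult_integral_right intro: lattice_antimono)

lemma right_ideal_above_Inter:
  "0 \<le> N \<Longrightarrow> (\<And>J. J \<in> S \<Longrightarrow> right_ideal_above N J) \<Longrightarrow> right_ideal_above N (lattice 0 \<inter> \<Inter>S)"
  by (auto simp: right_ideal_above_def lattice_add lattice_mult_integral_left intro: lattice_antimono)
    blast+

lemma right_ideal_above_adjoin:
  assumes level: "0 \<le> N" and h_integral: "h \<in> lattice 0"
  shows "right_ideal_above N {h ** a + c | a c. a \<in> lattice 0 \<and> c \<in> lattice N}"
      (is "right_ideal_above N ?J")
proof -
  have in_J: "x \<in> ?J" if "x = h ** a + c" "a \<in> lattice 0" "c \<in> lattice N" for x a c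
    using that by blast
  have "x \<in> ?J" if "x \<in> lattice N" for x using that by (intro in_J[of x 0 x]) simp_all
  moreover have "?J \<subseteq> lattice 0"
    using level h_integral
    by (auto intro!: lattice_add lattice_mult_integral_left intro: lattice_antimono)
  moreover have "x + y \<in> ?J" if xy_mem: "x \<in> ?J" "y \<in> ?J" for x y
  proof -
    obtain a c a' c' where "x = h ** a + c" "y = h ** a' + c'"
      "a \<in> lattice 0" "a' \<in> lattice 0" "c \<in> lattice N" "c' \<in> lattice N" using xy_mem by blast
    then show ?thesis by (intro in_J[of _ "a + a'" "c + c'"]) (simp_all add: mat_algebra lattice_add)
  qed
  moreover have "x ** y \<in> ?J" if xy_mem: "x \<in> ?J" "y \<in> lattice 0" for x y
  proof -
    obtain a c where "x = h ** a + c" "a \<in> lattice 0" "c \<in> lattice N" using xy_mem by blast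
    then show ?thesis
      using xy_mem(2) by (intro in_J[of _ "a ** y" "c ** y"])
        (simp_all add: mat_algebra lattice_mult_integral_left lattice_mult_integral_right)
  qed
  ultimately show ?thesis unfolding right_ideal_above_def by blast
qed

lemma replace_column_in_right_ideal:
  fixes g x :: "'a^'n^'n"
  assumes ideal: "right_ideal_above N J" and g_in_J: "g \<in> J" and x_in_J: "x \<in> J"
  shows "(\<chi> i j. if j = k then x $ i $ l else g $ i $ j) \<in> J"
proof -
  define E1 :: "'a^'n^'n" where "E1 = (\<chi> i j. if i = j then of_bool (j \<noteq> k) else 0)"
  define E2 :: "'a^'n^'n" where "E2 = (\<chi> i j. if i = l then of_bool (j = k) else 0)"
  have "g ** E1 + x ** E2 = (\<chi> i j. if j = k then x $ i $ l else g $ i $ j)"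
    by (simp add: vec_eq_iff matrix_matrix_mult_def E1_def E2_def if_distrib[of "(*) _"] cong: if_cong)
  moreover have "E1 \<in> lattice 0" "E2 \<in> lattice 0" by (auto simp: lattice_def E1_def E2_def)
  ultimately show ?thesis
    using right_ideal_above_add[OF ideal] right_ideal_above_mult[OF ideal] g_in_J x_in_J by metis
qed

text \<open>Replacing a column of \<open>g\<close> by a column of \<open>x\<close> stays inside the ideal, so Cramer's rule bounds
  the entries of the quotient.\<close>

lemma right_ideal_generated_by_max_det:
  fixes g :: "'a^'n^'n"
  assumes ideal: "right_ideal_above N J" and g_in_J: "g \<in> J" "g \<in> GL"
    and max: "\<And>h. h \<in> J \<Longrightarrow> v (det h) \<le> v (det g)"
  shows "x \<in> J \<longleftrightarrow> matrix_inv g ** x \<in> lattice 0"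
proof
  assume x_in_J: "x \<in> J"
  show "matrix_inv g ** x \<in> lattice 0"
    unfolding lattice_def
  proof (intro CollectI allI)
    fix k l
    have "v ((matrix_inv g ** x) $ k $ l * det g) \<le> v (det g)"
      using max[OF replace_column_in_right_ideal[OF ideal g_in_J(1) x_in_J, of k l]]
      by (simp add: det_replace_column g_in_J(2))
    then show "v ((matrix_inv g ** x) $ k $ l) \<le> q 0"
      using g_in_J(2) by (simp add: v_mult GL_iff_det)
  qed
next
  assume "matrix_inv g ** x \<in> lattice 0"
  then have "g ** (matrix_inv g ** x) \<in> J" by (rule right_ideal_above_mult[OF ideal g_in_J(1)])
  then show "x \<in> J" using g_in_J(2) by (simp add: matrix_mul_assoc matrix_inv_left_right)
qed

lemma right_ideal_above_principal:
  fixes J :: "('a^'n^'n) set"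
  assumes ideal: "right_ideal_above N J"
  shows "\<exists>g\<in>GL. \<forall>x. x \<in> J \<longleftrightarrow> matrix_inv g ** x \<in> lattice 0"
proof -
  have "(\<pi> powi N) *\<^sub>m mat 1 \<in> J"
    using scale_unif_powi_in_lattice_iff[of N "mat 1" 0]
    by (intro right_ideal_above_lattice[OF ideal]) simp
  moreover have "(\<pi> powi N) *\<^sub>m mat 1 \<in> (GL :: ('a^'n^'n) set)"
    by (simp add: GL_scale_mat GL_one)
  ultimately obtain g where g_max: "g \<in> J \<inter> GL" "\<And>h. h \<in> J \<inter> GL \<Longrightarrow> nat (val (det g)) \<le> nat (val (det h))"
    using ex_has_least_nat[of "\<lambda>h. h \<in> J \<inter> GL" _ "\<lambda>h. nat (val (det h))"] by blast
  have val: "v (det h) = q (val (det h))" "0 \<le> val (det h)" if "h \<in> J \<inter> GL" for h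
  proof -
    show eq: "v (det h) = q (val (det h))" using that by (intro v_eq_q_val) (simp add: GL_iff_det)
    have "v (det h) \<le> q 0" using that v_det_le_1[OF right_ideal_above_integral[OF ideal]] by simp
    then show "0 \<le> val (det h)" unfolding eq by (simp only: q_le_iff)
  qed
  have "v (det h) \<le> v (det g)" if "h \<in> J" for h
  proof (cases "h \<in> GL")
    case True
    then have "h \<in> J \<inter> GL" using that by simp
    then show ?thesis using g_max(2)[of h] val(1)[OF g_max(1)] val[of h] by simp
  qed (simp add: GL_iff_det)
  then show ?thesis using right_ideal_generated_by_max_det[OF ideal] g_max(1) by blast
qed

lemma finite_right_ideals_above: "finite {J :: ('a^'n^'n) set. right_ideal_above N J}"
proof -
  obtain R :: "('a^'n^'n) set" where transversal: "transversal R (lattice 0) (lattice N)"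
    using ex_transversal[OF compact_lattice add_subgroup_lattice open_lattice] by blast
  have determined: "x \<in> J \<longleftrightarrow> (\<exists>r\<in>R \<inter> J. x - r \<in> lattice N)" if ideal: "right_ideal_above N J" for x J
  proof
    assume x_in_J: "x \<in> J"
    then obtain r where rep: "r \<in> R" "x - r \<in> lattice N"
      using transversal right_ideal_above_integral[OF ideal] unfolding transversal_def by blast
    then have "r - x \<in> J"
      using right_ideal_above_lattice[OF ideal] add_subgroup_minus_commute[OF add_subgroup_lattice]
      by blast
    then have "r \<in> J" using right_ideal_above_add[OF ideal x_in_J] by fastforce
    then show "\<exists>r\<in>R \<inter> J. x - r \<in> lattice N" using rep by blast
  next
    assume "\<exists>r\<in>R \<inter> J. x - r \<in> lattice N"
    then obtain r where "r \<in> J" "x - r \<in> J" using right_ideal_above_lattice[OF ideal] by blast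
    then show "x \<in> J" using right_ideal_above_add[OF ideal, of r "x - r"] by simp
  qed
  then have "inj_on ((\<inter>) R) {J. right_ideal_above N J}"
    by (intro inj_onI set_eqI) (metis mem_Collect_eq)
  moreover have "finite (((\<inter>) R) ` {J. right_ideal_above N J})"
    by (rule finite_subset[of _ "Pow R"]) (use transversal in \<open>auto simp: transversal_def\<close>)
  ultimately show ?thesis by (rule finite_imageD[rotated])
qed

definition proper_right_ideals :: "int \<Rightarrow> ('a^'n^'n) set set" where
  "proper_right_ideals N = {J. right_ideal_above N J \<and> mat 1 \<notin> J}"

lemma finite_proper_right_ideals: "finite (proper_right_ideals N)"
  using finite_right_ideals_above by (rule finite_subset[rotated]) (auto simp: proper_right_ideals_def)

lemma matrix_inv_GL_int:
  fixes h :: "'a^'n^'n"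
  assumes "h \<in> GL_int" shows "matrix_inv h \<in> lattice 0"
proof -
  have h_integral: "h \<in> lattice 0" "h \<in> GL" "v (det h) = 1" using assms GL_int_subset_GL
    by (auto simp: GL_int_def)
  have "(mat 1 :: 'a^'n^'n) \<in> lattice 0 \<longleftrightarrow> matrix_inv h ** mat 1 \<in> lattice 0"
    by (rule right_ideal_generated_by_max_det[OF right_ideal_above_lattice_self[OF order_refl]
      h_integral(1,2)])
      (simp add: h_integral(3) v_det_le_1)
  then show ?thesis by simp
qed

lemma GL_int_iff_notin_proper_right_ideals:
  fixes h :: "'a^'n^'n"
  assumes level: "0 \<le> N" "\<And>c. c \<in> lattice N \<Longrightarrow> mat 1 + c \<in> (GL_int :: ('a^'n^'n) set)"
  shows "h \<in> GL_int \<longleftrightarrow> h \<in> lattice 0 \<and> (\<forall>J\<in>proper_right_ideals N. h \<notin> J)"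
proof (intro iffI conjI ballI notI)
  fix J assume h_mem: "h \<in> GL_int" "h \<in> J" and proper: "J \<in> proper_right_ideals N"
  have "h ** matrix_inv h \<in> J"
    using proper h_mem(2) matrix_inv_GL_int[OF h_mem(1)]
    by (auto simp: proper_right_ideals_def right_ideal_above_def)
  moreover have "h \<in> GL" using h_mem(1) GL_int_subset_GL by blast
  ultimately show False using proper by (simp add: proper_right_ideals_def matrix_inv_left_right)
next
  assume h_mem: "h \<in> lattice 0 \<and> (\<forall>J\<in>proper_right_ideals N. h \<notin> J)"
  define J where "J = {h ** a + c | a c. a \<in> lattice 0 \<and> c \<in> lattice N}"
  have "h ** mat 1 + 0 \<in> J" unfolding J_def using one_in_lattice zero_in_lattice by blast
  then have "h \<in> J" by simp
  moreover have "right_ideal_above N J" unfolding J_def using h_mem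
    by (intro right_ideal_above_adjoin level(1)) simp
  ultimately have "mat 1 \<in> J" using h_mem by (auto simp: proper_right_ideals_def)
  then obtain a c where one_eq: "mat 1 = h ** a + c" "a \<in> lattice 0" "c \<in> lattice N"
    unfolding J_def by blast
  have "h ** a = mat 1 + - c" by (simp add: one_eq(1))
  then have "v (det (h ** a)) = 1" using level(2)[of "- c"] one_eq(3) by (simp add: GL_int_def)
  then have "v (det h) * v (det a) = 1" by (simp add: det_mul v_mult)
  then have "1 \<le> v (det h)"
    using mult_left_le[OF v_det_le_1[OF one_eq(2)] v_nonneg[of "det h"]] by simp
  then show "h \<in> GL_int" using h_mem v_det_le_1[of h] by (auto simp: GL_int_def)
qed (simp_all add: GL_int_def)

lemma ex_congruence_level:
  obtains N where "0 < N" "\<And>c. c \<in> lattice N \<Longrightarrow> mat 1 + c \<in> (GL_int :: ('a^'n^'n) set)"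
    "mat 1 \<notin> (lattice N :: ('a^'n^'n) set)"
proof -
  have "\<forall>\<^sub>F h in nhds (mat 1 + 0). h \<in> (GL_int :: ('a^'n^'n) set)"
    by (intro eventually_nhds_in_open open_GL_int) (simp add: GL_int_def)
  then have "\<forall>\<^sub>F c in nhds 0. mat 1 + c \<in> (GL_int :: ('a^'n^'n) set)"
    by (rule eventually_compose_filterlim) (intro tendsto_intros filterlim_ident)
  then obtain N where level: "\<And>c. c \<in> lattice N \<Longrightarrow> mat 1 + c \<in> (GL_int :: ('a^'n^'n) set)"
    using ex_lattice_subset_nhd by blast
  have "(0 :: 'a^'n^'n) \<notin> GL_int" by (simp add: GL_int_def det_0[unfolded mat_0])
  then have one_notin: "mat 1 \<notin> (lattice N :: ('a^'n^'n) set)" using level[of "- mat 1"] by auto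
  then have "0 < N" using lattice_antimono[of "mat 1 :: 'a^'n^'n" 0 N] by force
  then show thesis using level one_notin by (rule that)
qed

end

subsection \<open>Values at 1 of rational generating functions\<close>

lemma finite_support_shift:
  fixes f :: "int \<Rightarrow> 'c::zero"
  assumes "finite {k. f k \<noteq> 0}" shows "finite {k. f (k + e) \<noteq> 0}"
proof -
  have "{k. f (k + e) \<noteq> 0} = (\<lambda>k. k - e) ` {k. f k \<noteq> 0}" by (force simp: image_iff)
  then show ?thesis using assms by simp
qed

lemma Sum_any_shift: "Sum_any (\<lambda>k::int. f (k + e)) = Sum_any f"
proof (rule Sum_any.reindex_cong[symmetric])
  show "bij (\<lambda>k::int. k + e)" by (rule bij_plus_right)
qed (simp add: fun_eq_iff)

definition moment :: "(int \<Rightarrow> 'c::comm_ring_1) \<Rightarrow> 'c" where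
  "moment f = Sum_any (\<lambda>k. of_int k * f k)"

lemma moment_shift:
  fixes f :: "int \<Rightarrow> 'c::comm_ring_1"
  assumes "finite {k. f k \<noteq> 0}"
  shows "moment (\<lambda>k. f (k + e)) = moment f - of_int e * Sum_any f"
proof -
  have fin: "finite {k. of_int k * f k \<noteq> 0}" "finite {k. - of_int e * f k \<noteq> 0}"
    using assms by (auto elim!: rev_finite_subset)
  have "moment (\<lambda>k. f (k + e)) = Sum_any (\<lambda>k. of_int (k + e - e) * f (k + e))"
    by (simp add: moment_def)
  also have "\<dots> = Sum_any (\<lambda>k. of_int (k - e) * f k)"
    by (rule Sum_any_shift[of "\<lambda>k. of_int (k - e) * f k"])
  also have "\<dots> = Sum_any (\<lambda>k. of_int k * f k + - of_int e * f k)" by (simp add: algebra_simps)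
  also have "\<dots> = moment f - of_int e * Sum_any f"
    unfolding Sum_any.distrib[OF fin] moment_def
    using Sum_any_right_distrib[OF assms, of "- of_int e"] by simp
  finally show ?thesis .
qed

definition shift_sum :: "'i set \<Rightarrow> ('i \<Rightarrow> 'c::comm_ring_1) \<Rightarrow> ('i \<Rightarrow> int) \<Rightarrow> (int \<Rightarrow> 'c) \<Rightarrow> int \<Rightarrow> 'c" where
  "shift_sum I s e f k = (\<Sum>i\<in>I. s i * f (k + e i))"

lemma shift_sum_shift_diff:
  "shift_sum I s e (shift_diff (\<lambda>k. k + d) \<kappa> f) = shift_diff (\<lambda>k. k + d) \<kappa> (shift_sum I s e f)"
  by (simp add: shift_sum_def shift_diff_def fun_eq_iff sum_subtractf sum_distrib_left algebra_simps)

lemma Sum_any_sum: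
  assumes "finite I" "\<And>i. i \<in> I \<Longrightarrow> finite {x. g i x \<noteq> 0}"
  shows "finite {x. (\<Sum>i\<in>I. g i x) \<noteq> 0}" "Sum_any (\<lambda>x. \<Sum>i\<in>I. g i x) = (\<Sum>i\<in>I. Sum_any (g i))"
proof -
  have fin: "finite (\<Union>i\<in>I. {x. g i x \<noteq> 0})" using assms by simp
  have supp: "{x. (\<Sum>i\<in>I. g i x) \<noteq> 0} \<subseteq> (\<Union>i\<in>I. {x. g i x \<noteq> 0})" by (auto intro: ccontr sum.neutral)
  then show "finite {x. (\<Sum>i\<in>I. g i x) \<noteq> 0}" using fin by (rule finite_subset)
  have "Sum_any (\<lambda>x. \<Sum>i\<in>I. g i x) = (\<Sum>x\<in>(\<Union>i\<in>I. {x. g i x \<noteq> 0}). \<Sum>i\<in>I. g i x)"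
    by (rule Sum_any.expand_superset[OF fin supp])
  also have "\<dots> = (\<Sum>i\<in>I. \<Sum>x\<in>(\<Union>i\<in>I. {x. g i x \<noteq> 0}). g i x)" by (rule sum.swap)
  also have "\<dots> = (\<Sum>i\<in>I. Sum_any (g i))"
    by (intro sum.cong refl Sum_any.expand_superset[symmetric, OF fin]) auto
  finally show "Sum_any (\<lambda>x. \<Sum>i\<in>I. g i x) = (\<Sum>i\<in>I. Sum_any (g i))" .
qed

lemma shift_sum_finite_support:
  fixes f :: "int \<Rightarrow> 'c::comm_ring_1"
  assumes finite_I: "finite I" and finite_supp: "finite {k. f k \<noteq> 0}"
  shows "finite {k. shift_sum I s e f k \<noteq> 0}"
    and "Sum_any (shift_sum I s e f) = sum s I * Sum_any f"
    and "moment (shift_sum I s e f) = sum s I * moment f - (\<Sum>i\<in>I. s i * of_int (e i)) * Sum_any f"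
proof -
  have shift: "finite {k. f (k + e i) \<noteq> 0}" "finite {k. of_int k * f (k + e i) \<noteq> 0}"
    "finite {k. s i * f (k + e i) \<noteq> 0}" "finite {k. s i * (of_int k * f (k + e i)) \<noteq> 0}" for i
    using finite_support_shift[OF finite_supp, of "e i"] by (auto elim!: rev_finite_subset)
  show "finite {k. shift_sum I s e f k \<noteq> 0}"
    unfolding shift_sum_def by (rule Sum_any_sum(1)[OF finite_I shift(3)])
  show "Sum_any (shift_sum I s e f) = sum s I * Sum_any f"
    unfolding shift_sum_def[abs_def] Sum_any_sum(2)[OF finite_I shift(3)]
    by (simp add: Sum_any_right_distrib[OF shift(1), symmetric] Sum_any_shift sum_distrib_right)
  have "moment (shift_sum I s e f) = Sum_any (\<lambda>k. \<Sum>i\<in>I. s i * (of_int k * f (k + e i)))"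
    by (simp add: moment_def shift_sum_def sum_distrib_left mult.left_commute)
  also have "\<dots> = (\<Sum>i\<in>I. s i * moment (\<lambda>k. f (k + e i)))"
    unfolding Sum_any_sum(2)[OF finite_I shift(4)] moment_def
    by (intro sum.cong refl Sum_any_right_distrib[OF shift(2), symmetric])
  also have "\<dots> = sum s I * moment f - (\<Sum>i\<in>I. s i * of_int (e i)) * Sum_any f"
    unfolding moment_shift[OF finite_supp]
    by (simp add: right_diff_distrib sum_subtractf sum_distrib_right mult.assoc)
  finally show "moment (shift_sum I s e f) = sum s I * moment f - (\<Sum>i\<in>I. s i * of_int (e i)) * Sum_any f" .
qed

text \<open>\<open>c\<close> is the value at \<open>z = 1\<close> of \<open>\<Sum> a k z ^ k\<close> when some product of factors \<open>z ^ - e - \<kappa>\<close> with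
  \<open>\<kappa> \<noteq> 1\<close> turns this series into a Laurent polynomial.\<close>

inductive value_at_1 :: "(int \<Rightarrow> complex) \<Rightarrow> complex \<Rightarrow> bool" where
  finite_support: "finite {k. a k \<noteq> 0} \<Longrightarrow> value_at_1 a (Sum_any a)"
| step: "\<kappa> \<noteq> 1 \<Longrightarrow> value_at_1 (shift_diff (\<lambda>k. k + e) \<kappa> a) ((1 - \<kappa>) * c) \<Longrightarrow> value_at_1 a c"

lemma shift_diff_as_shift_sum:
  "shift_diff (\<lambda>k. k + e) \<kappa> a = shift_sum UNIV (\<lambda>b. if b then 1 else - \<kappa>) (\<lambda>b. if b then e else 0) a"
  by (simp add: shift_diff_def shift_sum_def fun_eq_iff UNIV_bool)

lemma shift_diff_finite_support:
  fixes a :: "int \<Rightarrow> 'c::comm_ring_1"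
  assumes "finite {k. a k \<noteq> 0}"
  shows "finite {k. shift_diff (\<lambda>k. k + e) \<kappa> a k \<noteq> 0}"
    and "Sum_any (shift_diff (\<lambda>k. k + e) \<kappa> a) = (1 - \<kappa>) * Sum_any a"
    and "moment (shift_diff (\<lambda>k. k + e) \<kappa> a) = (1 - \<kappa>) * moment a - of_int e * Sum_any a"
  unfolding shift_diff_as_shift_sum using assms
  by (simp_all add: shift_sum_finite_support UNIV_bool)

lemma value_at_1_shift_diff: "value_at_1 a c \<Longrightarrow> value_at_1 (shift_diff (\<lambda>k. k + e) \<kappa> a) ((1 - \<kappa>) * c)"
proof (induction rule: value_at_1.induct)
  case (finite_support a)
  show ?case
    using value_at_1.finite_support[OF shift_diff_finite_support(1)[OF finite_support]]
    by (simp only: shift_diff_finite_support(2)[OF finite_support])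
next
  case (step \<rho> d a c)
  have "shift_diff (\<lambda>k. k + e) \<kappa> (shift_diff (\<lambda>k. k + d) \<rho> a)
      = shift_diff (\<lambda>k. k + d) \<rho> (shift_diff (\<lambda>k. k + e) \<kappa> a)"
    by (rule shift_diff_commute) simp
  then have "value_at_1 (shift_diff (\<lambda>k. k + d) \<rho> (shift_diff (\<lambda>k. k + e) \<kappa> a)) ((1 - \<rho>) * ((1 - \<kappa>) * c))"
    using step.IH by (simp only: mult.left_commute)
  then show ?case by (rule value_at_1.step[OF step(1)])
qed

lemma value_at_1_cmult: "value_at_1 a c \<Longrightarrow> value_at_1 (\<lambda>k. b * a k) (b * c)"
proof (induction rule: value_at_1.induct)
  case (finite_support a)
  have "finite {k. b * a k \<noteq> 0}" using finite_support by (auto elim!: rev_finite_subset)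
  then show ?case
    unfolding Sum_any_right_distrib[OF finite_support] by (rule value_at_1.finite_support)
next
  case (step \<kappa> e a c)
  show ?case
    by (rule value_at_1.step[OF step(1)],
      use step.IH in \<open>simp only: shift_diff_cmult mult.left_commute\<close>)
qed

lemma value_at_1_add_finite_support:
  assumes "value_at_1 a c" "finite {k. b k \<noteq> 0}"
  shows "value_at_1 (\<lambda>k. b k + a k) (Sum_any b + c)"
  using assms
proof (induction arbitrary: b rule: value_at_1.induct)
  case (finite_support a)
  have "{k. b k + a k \<noteq> 0} \<subseteq> {k. a k \<noteq> 0} \<union> {k. b k \<noteq> 0}" by auto
  then have "finite {k. b k + a k \<noteq> 0}" using finite_support by (rule finite_subset[OF _ finite_UnI])
  then show ?case
    unfolding Sum_any.distrib[OF finite_support(2,1), symmetric] by (rule value_at_1.finite_support)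
next
  case (step \<kappa> e a c)
  show ?case
    by (rule value_at_1.step[OF step(1)],
      use step.IH[OF shift_diff_finite_support(1)[OF step.prems]] in
        \<open>simp only: shift_diff_add shift_diff_finite_support(2)[OF step.prems] distrib_left\<close>)
qed

lemma value_at_1_add: "value_at_1 a c \<Longrightarrow> value_at_1 b d \<Longrightarrow> value_at_1 (\<lambda>k. a k + b k) (c + d)"
proof (induction arbitrary: b d rule: value_at_1.induct)
  case (finite_support a)
  show ?case using finite_support(2,1) by (rule value_at_1_add_finite_support)
next
  case (step \<kappa> e a c)
  show ?case
    by (rule value_at_1.step[OF step(1)],
      use step.IH[OF value_at_1_shift_diff[OF step.prems]] in \<open>simp only: shift_diff_add distrib_left\<close>)
qed

text \<open>The product rule for the derivative at \<open>z = 1\<close> of a multiple \<open>D u\<close> with \<open>D 1 = 0\<close>.\<close>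

lemma moment_shift_sum_if_value_at_1:
  assumes "value_at_1 a c" "finite I" "sum s I = 0" "finite {k. shift_sum I s e a k \<noteq> 0}"
  shows "Sum_any (shift_sum I s e a) = 0 \<and> moment (shift_sum I s e a) = - (\<Sum>i\<in>I. s i * of_int (e i)) * c"
  using assms(1,4)
proof (induction rule: value_at_1.induct)
  case (finite_support a)
  then show ?case by (simp add: shift_sum_finite_support assms(2,3))
next
  case (step \<kappa> d a c)
  note fin = shift_diff_finite_support[OF step.prems, where \<kappa> = \<kappa> and e = d]
  have factor_nz: "1 - \<kappa> \<noteq> 0" using step(1) by simp
  have IH: "(1 - \<kappa>) * Sum_any (shift_sum I s e a) = 0" "(1 - \<kappa>) * moment (shift_sum I s e a)
      - of_int d * Sum_any (shift_sum I s e a) = - (\<Sum>i\<in>I. s i * of_int (e i)) * ((1 - \<kappa>) * c)"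
    using step.IH fin by (simp_all add: shift_sum_shift_diff)
  then have total: "Sum_any (shift_sum I s e a) = 0" using factor_nz by simp
  have "(1 - \<kappa>) * moment (shift_sum I s e a) = (1 - \<kappa>) * (- (\<Sum>i\<in>I. s i * of_int (e i)) * c)"
    using IH(2) by (simp add: total mult.left_commute)
  then show ?case using total factor_nz by (metis mult_cancel_left)
qed

subsection \<open>The zeta integral of the integral matrices\<close>

lemma sum_alternating_Pow:
  fixes \<J> :: "'b set set"
  assumes "finite \<J>"
  shows "(\<Sum>S\<in>Pow \<J>. (- 1) ^ card S * of_bool (x \<in> \<Inter>S)) = (of_bool (x \<notin> \<Union>\<J>) :: 'c::comm_ring_1)"
proof -
  have "(- 1) ^ card S * of_bool (x \<in> \<Inter>S) = (\<Prod>J\<in>S. - of_bool (x \<in> J) :: 'c)" if "S \<in> Pow \<J>" for S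
  proof -
    have "finite S" using that assms finite_subset by blast
    then show ?thesis by (induction S rule: finite_induct) auto
  qed
  then have "(\<Sum>S\<in>Pow \<J>. (- 1) ^ card S * of_bool (x \<in> \<Inter>S)) = (\<Prod>J\<in>\<J>. - of_bool (x \<in> J) + (1 :: 'c))"
    unfolding prod_add[OF assms] by (intro sum.cong) simp_all
  also have "\<dots> = of_bool (x \<notin> \<Union>\<J>)"
    using assms by (auto intro!: prod.neutral prod_zero)
  finally show ?thesis .
qed

lemma sum_alternating_card_Pow:
  assumes "finite A" "A \<noteq> {}" shows "(\<Sum>S\<in>Pow A. (- 1) ^ card S) = (0 :: 'c::comm_ring_1)"
  using prod_add[OF assms(1), of "\<lambda>_. - 1 :: 'c" "\<lambda>_. 1"] assms
  by (simp add: card_gt_0_iff power_0_left)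

context test_functions
begin

lemma shift_sum_zeta_coeff:
  assumes smooth: "\<phi> \<in> Cc_infty" and g_GL: "\<And>i. i \<in> I \<Longrightarrow> g i \<in> GL"
  shows "shift_sum I s (\<lambda>i. val (det (g i))) (zeta_coeff \<phi>)
    = zeta_coeff (\<lambda>p. \<Sum>i\<in>I. s i * translate (g i) (mat 1) \<phi> p)"
proof
  fix k
  have "zeta_coeff (\<lambda>p. \<Sum>i\<in>I. s i * translate (g i) (mat 1) \<phi> p) k
      = (\<Sum>i\<in>I. s i * zeta_coeff (translate (g i) (mat 1) \<phi>) k)"
    using assms by (simp add: zeta_coeff_sum Cc_infty_cmult zeta_coeff_cmult Cc_infty_translate GL_one)
  then show "shift_sum I s (\<lambda>i. val (det (g i))) (zeta_coeff \<phi>) k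
      = zeta_coeff (\<lambda>p. \<Sum>i\<in>I. s i * translate (g i) (mat 1) \<phi> p) k"
    using assms by (simp add: shift_sum_def zeta_coeff_translate)
qed

lemma zeta_coeff_cong:
  "(\<And>h. h \<in> GL \<Longrightarrow> \<phi> (h, 0) = \<psi> (h, 0)) \<Longrightarrow> zeta_coeff \<phi> = zeta_coeff \<psi>"
  unfolding zeta_coeff_def[abs_def]
  by (intro ext Bochner_Integration.integral_cong) (auto simp: space_mu)

lemma zeta_coeff_if_indicator_GL_int:
  assumes "\<And>h. h \<in> GL \<Longrightarrow> \<phi> (h, 0) = of_bool (h \<in> GL_int)"
  shows "zeta_coeff \<phi> = (\<lambda>k. if k = 0 then of_real (measure \<mu> GL_int) else 0)"
proof
  fix k
  have val: "val (det h) = 0" if "h \<in> GL_int" for h :: "'a^'n^'n"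
    using that by (intro val_eqI) (simp add: GL_int_def)
  have "zeta_coeff \<phi> k = (LINT h|\<mu>. of_bool (k = 0) * complex_of_real (indicator GL_int h))"
    unfolding zeta_coeff_def
    using val by (intro Bochner_Integration.integral_cong) (auto simp: assms space_mu indicator_def)
  also have "\<dots> = of_bool (k = 0) * complex_of_real (measure \<mu> GL_int)"
    by (simp add: space_mu Int_absorb2[OF GL_int_subset_GL])
  finally show "zeta_coeff \<phi> k = (if k = 0 then of_real (measure \<mu> GL_int) else 0)" by simp
qed

lemma measure_GL_int_pos: "0 < measure \<mu> (GL_int :: ('a^'n^'n) set)"
proof -
  have "mat 1 \<in> (GL_int :: ('a^'n^'n) set)" by (simp add: GL_int_def)
  then have "0 < emeasure \<mu> (GL_int :: ('a^'n^'n) set)"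
    using open_GL_int GL_int_subset_GL by (intro emeasure_open_pos) auto
  moreover have "emeasure \<mu> (GL_int :: ('a^'n^'n) set) < \<infinity>"
    using compact_GL_int GL_int_subset_GL by (rule emeasure_compact_finite)
  ultimately show ?thesis by (simp add: measure_def enn2real_positive_iff)
qed

definition integral_indicator :: "('a^'n^'n) \<times> ('a^'n^'n) \<Rightarrow> complex" where
  "integral_indicator p = of_bool (p \<in> lattice 0 \<times> lattice 0)"

lemma Cc_infty_integral_indicator: "integral_indicator \<in> Cc_infty"
proof (rule Cc_inftyI)
  show "compact (lattice 0 \<times> lattice 0)" by (intro compact_Times compact_lattice)
  show "\<forall>\<^sub>F y in nhds x. integral_indicator y = integral_indicator x" for x :: "('a^'n^'n) \<times> ('a^'n^'n)"
    using eventually_mem_clopen_iff[of "lattice 0 \<times> lattice 0" x]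
    by (auto simp: integral_indicator_def open_Times closed_Times open_lattice closed_lattice
        elim!: eventually_mono)
qed (auto simp: integral_indicator_def split: if_splits)

text \<open>Inclusion-exclusion over the proper right ideals, whose intersections are all principal.\<close>

lemma indicator_GL_int_as_sum_of_translates:
  obtains I :: "('a^'n^'n) set set set" and s g where "finite I" "sum s I = 0" "\<And>S. S \<in> I \<Longrightarrow> g S \<in> GL"
    "\<And>h. (\<Sum>S\<in>I. s S * translate (g S) (mat 1) integral_indicator (h, 0)) = of_bool (h \<in> GL_int)"
proof -
  obtain N where level: "0 < N" "\<And>c. c \<in> lattice N \<Longrightarrow> mat 1 + c \<in> (GL_int :: ('a^'n^'n) set)"
      "mat 1 \<notin> (lattice N :: ('a^'n^'n) set)"
    using ex_congruence_level by blast
  define \<J> where "\<J> = (proper_right_ideals N :: ('a^'n^'n) set set)"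
  have finite_J: "finite \<J>" unfolding \<J>_def by (rule finite_proper_right_ideals)
  have "lattice N \<in> \<J>"
    using level(1,3) by (simp add: \<J>_def proper_right_ideals_def right_ideal_above_lattice_self)
  then have sum_0: "(\<Sum>S\<in>Pow \<J>. (- 1) ^ card S) = (0 :: complex)"
    using finite_J by (intro sum_alternating_card_Pow) auto
  have "\<exists>g\<in>GL. \<forall>x. x \<in> lattice 0 \<inter> \<Inter>S \<longleftrightarrow> matrix_inv g ** x \<in> lattice 0" if "S \<in> Pow \<J>" for S
    using that level(1) by (intro right_ideal_above_principal[of N] right_ideal_above_Inter)
      (auto simp: \<J>_def proper_right_ideals_def)
  then obtain g where generator: "\<And>S. S \<in> Pow \<J> \<Longrightarrow> g S \<in> GL"
    "\<And>S x. S \<in> Pow \<J> \<Longrightarrow> x \<in> lattice 0 \<inter> \<Inter>S \<longleftrightarrow> matrix_inv (g S) ** x \<in> lattice 0"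
    by metis
  have "(\<Sum>S\<in>Pow \<J>. (- 1) ^ card S * translate (matrix_inv (g S)) (mat 1) integral_indicator (h, 0))
      = of_bool (h \<in> GL_int)" for h
  proof -
    have "translate (matrix_inv (g S)) (mat 1) integral_indicator (h, 0)
        = of_bool (h \<in> lattice 0) * of_bool (h \<in> \<Inter>S)" if "S \<in> Pow \<J>" for S
      by (simp add: translate_def integral_indicator_def generator(2)[OF that, symmetric]
          flip: of_bool_conj)
    then have "(\<Sum>S\<in>Pow \<J>. (- 1) ^ card S * translate (matrix_inv (g S)) (mat 1) integral_indicator (h, 0))
        = of_bool (h \<in> lattice 0) * (\<Sum>S\<in>Pow \<J>. (- 1) ^ card S * of_bool (h \<in> \<Inter>S))"
      unfolding sum_distrib_left by (intro sum.cong refl) (simp only: mult.left_commute)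
    also have "\<dots> = of_bool (h \<in> lattice 0) * of_bool (h \<notin> \<Union>\<J>)"
      unfolding sum_alternating_Pow[OF finite_J] ..
    also have "\<dots> = of_bool (h \<in> GL_int)"
      using GL_int_iff_notin_proper_right_ideals[OF less_imp_le[OF level(1)] level(2), of h]
      by (simp add: \<J>_def)
    finally show ?thesis .
  qed
  then show thesis
    using finite_J sum_0 generator(1)
    by (intro that[of "Pow \<J>" "\<lambda>S. (- 1) ^ card S" "\<lambda>S. matrix_inv (g S)"])
      (simp_all add: matrix_inv_GL)
qed

lemma zeta_coeff_integral_indicator_annihilated:
  obtains I :: "('a^'n^'n) set set set" and s e where "finite I" "sum s I = 0"
    "shift_sum I s e (zeta_coeff integral_indicator) = (\<lambda>k. if k = 0 then of_real (measure \<mu> GL_int) else 0)"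
proof -
  obtain I :: "('a^'n^'n) set set set" and s g where annihilator: "finite I" "sum s I = 0"
    "\<And>S. S \<in> I \<Longrightarrow> g S \<in> GL"
    "\<And>h. (\<Sum>S\<in>I. s S * translate (g S) (mat 1) integral_indicator (h, 0)) = of_bool (h \<in> GL_int)"
    using indicator_GL_int_as_sum_of_translates by blast
  have "zeta_coeff (\<lambda>p. \<Sum>S\<in>I. s S * translate (g S) (mat 1) integral_indicator p)
      = (\<lambda>k. if k = 0 then of_real (measure \<mu> GL_int) else 0)"
    by (rule zeta_coeff_if_indicator_GL_int) (rule annihilator(4))
  then show thesis
    using shift_sum_zeta_coeff[OF Cc_infty_integral_indicator, of I g s] annihilator(3)
    by (intro that[OF annihilator(1,2)]) simp
qed

subsection \<open>Conclusion\<close>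

lemma reducible_to_top_value_at_1:
  assumes "reducible_to CARD('n) f a"
  shows "\<exists>c. value_at_1 a c \<and> ((\<forall>\<^sub>F t in at 0. f t = 0) \<longrightarrow> c = 0)"
  using assms
proof induction
  case (base \<psi> f)
  have "value_at_1 (zeta_coeff \<psi>) (LINT h|\<mu>. \<psi> (h, 0))"
    using value_at_1.finite_support[OF top_stratum_zeta_coeff(1)[OF base(1)]]
    unfolding top_stratum_zeta_coeff(2)[OF base(1)] .
  moreover have "(LINT h|\<mu>. \<psi> (h, 0)) = 0" if "\<forall>\<^sub>F t in at 0. f t = 0"
  proof -
    have "\<forall>\<^sub>F t in at (0::'a). (LINT h|\<mu>. \<psi> (h, 0)) = 0"
      using that base(2) top_stratum_germ[OF base(1)] by eventually_elim simp
    then show ?thesis by (simp add: eventually_const)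
  qed
  ultimately show ?case by blast
next
  case (step g \<kappa> f a)
  obtain c where c_value: "value_at_1 (shift_diff (\<lambda>k. k + hecke_degree g) \<kappa> a) c"
    "(\<forall>\<^sub>F t in at 0. shift_diff ((*) \<pi>) \<kappa> f t = 0) \<longrightarrow> c = 0"
    using step.IH by blast
  have "value_at_1 (shift_diff (\<lambda>k. k + hecke_degree g) \<kappa> a) ((1 - \<kappa>) * (c / (1 - \<kappa>)))"
    using c_value(1) step(2) by simp
  then have "value_at_1 a (c / (1 - \<kappa>))" by (rule value_at_1.step[OF step(2)])
  moreover have "c / (1 - \<kappa>) = 0" if "\<forall>\<^sub>F t in at 0. f t = 0"
  proof -
    have "\<forall>\<^sub>F t in at 0. shift_diff ((*) \<pi>) \<kappa> f t = shift_diff ((*) \<pi>) \<kappa> (\<lambda>_. 0) t"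
      by (rule shift_diff_eventually_cong[OF filterlim_mult_unif that])
    then show ?thesis using c_value(2) by (simp add: shift_diff_def)
  qed
  ultimately show ?case by blast
qed

lemma value_at_1_if_vanishes_below_1:
  fixes \<phi> :: "('a^'n^'n) \<times> ('a^'n^'n) \<Rightarrow> complex"
  assumes "vanishes_below_rank 1 \<phi>"
  shows "\<exists>c. value_at_1 (zeta_coeff \<phi>) c \<and> ((\<forall>\<^sub>F t in at 0. phi_tilde \<mu> \<phi> t = 0) \<longrightarrow> c = 0)"
  by (intro reducible_to_top_value_at_1 reducible_to_if_vanishes_at_0 assms) (simp_all add: Suc_leI)

lemma vanishes_below_rank_1I:
  "\<phi> \<in> Cc_infty \<Longrightarrow> (\<And>Y. \<phi> (0, Y) = 0) \<Longrightarrow> vanishes_below_rank 1 \<phi>"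
  by (simp add: vanishes_below_rank_def col_rank_eq_0_iff)

lemma hecke_degree_one: "hecke_degree (mat 1) = int CARD('n)"
proof -
  have "v (det (\<pi> *\<^sub>m (mat 1 :: 'a^'n^'n))) = q (int CARD('n))"
    by (simp add: det_scale_mat v_power)
  then show ?thesis unfolding hecke_degree_def by (rule val_eqI)
qed

lemma value_at_1_if_germ_vanishes:
  fixes \<phi> :: "('a^'n^'n) \<times> ('a^'n^'n) \<Rightarrow> complex"
  assumes smooth: "\<phi> \<in> Cc_infty" and germ: "\<forall>\<^sub>F t in at 0. phi_tilde \<mu> \<phi> t = 0"
  shows "value_at_1 (shift_diff (\<lambda>k. k + int CARD('n)) 1 (zeta_coeff \<phi>)) 0"
proof -
  have "vanishes_below_rank 1 (hecke_diff (mat 1) 1 \<phi>)"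
    by (intro vanishes_below_rank_1I Cc_infty_hecke_diff smooth GL_one)
      (simp add: hecke_diff_def translate_def matrix_inv_one)
  moreover have "\<forall>\<^sub>F t in at 0. phi_tilde \<mu> (hecke_diff (mat 1) 1 \<phi>) t = 0"
  proof -
    have "\<forall>\<^sub>F t in at 0. 0 = phi_tilde \<mu> \<phi> t" using germ by eventually_elim simp
    from germ_hecke_diff[OF smooth GL_one this, of 1] show ?thesis
      by eventually_elim (simp add: shift_diff_def)
  qed
  ultimately have "value_at_1 (zeta_coeff (hecke_diff (mat 1) 1 \<phi>)) 0"
    using value_at_1_if_vanishes_below_1 by blast
  then show ?thesis
    unfolding zeta_coeff_hecke_diff[OF smooth GL_one] hecke_degree_one .
qed

lemma Cc_infty_slice:
  fixes \<phi> :: "('a^'n^'n) \<times> ('a^'n^'n) \<Rightarrow> complex"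
  assumes smooth: "\<phi> \<in> Cc_infty"
  shows "(\<lambda>p. \<phi> (fst p, 0) * of_bool (snd p \<in> (lattice 0 :: ('a^'n^'n) set))) \<in> Cc_infty"
proof (rule Cc_inftyI)
  show "compact (fst ` {p. \<phi> p \<noteq> 0} \<times> lattice 0)"
    by (intro compact_Times compact_lattice compact_continuous_image continuous_intros
        Cc_infty_compact_support smooth)
  fix x :: "('a^'n^'n) \<times> ('a^'n^'n)"
  have "((\<lambda>y. (fst y, 0)) \<longlongrightarrow> (fst x, 0 :: 'a^'n^'n)) (nhds x)"
    by (intro tendsto_intros filterlim_ident)
  then have "\<forall>\<^sub>F y in nhds x. \<phi> (fst y, 0) = \<phi> (fst x, 0)"
    by (rule eventually_compose_filterlim[OF Cc_infty_eventually_eq[OF smooth]])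
  moreover have "\<forall>\<^sub>F y in nhds x. snd y \<in> lattice 0 \<longleftrightarrow> snd x \<in> lattice 0"
    by (rule eventually_compose_filterlim[OF eventually_mem_clopen_iff[OF open_lattice closed_lattice]])
      (intro tendsto_intros filterlim_ident)
  ultimately show "\<forall>\<^sub>F y in nhds x. \<phi> (fst y, 0) * of_bool (snd y \<in> lattice 0)
      = \<phi> (fst x, 0) * of_bool (snd x \<in> lattice 0)"
    by eventually_elim simp
qed (force simp: mem_Times_iff)

lemma value_at_1_zeta_coeff_minus_integral_indicator:
  fixes \<phi> :: "('a^'n^'n) \<times> ('a^'n^'n) \<Rightarrow> complex"
  assumes smooth: "\<phi> \<in> Cc_infty"
  shows "\<exists>c. value_at_1 (\<lambda>k. zeta_coeff \<phi> k - \<phi> (0, 0) * zeta_coeff integral_indicator k) c"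
proof -
  define slice where "slice p = \<phi> (fst p, 0) * of_bool (snd p \<in> lattice 0)"
      for p :: "('a^'n^'n) \<times> ('a^'n^'n)"
  have slice: "slice \<in> Cc_infty" unfolding slice_def[abs_def] using smooth by (rule Cc_infty_slice)
  have cmult: "(\<lambda>p. \<phi> (0, 0) * integral_indicator p) \<in> Cc_infty"
    by (intro Cc_infty_cmult Cc_infty_integral_indicator)
  have "vanishes_below_rank 1 (\<lambda>p. slice p - \<phi> (0, 0) * integral_indicator p)"
    by (intro vanishes_below_rank_1I Cc_infty_diff slice cmult)
      (simp add: slice_def integral_indicator_def)
  moreover have "zeta_coeff slice = zeta_coeff \<phi>" by (rule zeta_coeff_cong) (simp add: slice_def)
  then have "zeta_coeff (\<lambda>p. slice p - \<phi> (0, 0) * integral_indicator p)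
      = (\<lambda>k. zeta_coeff \<phi> k - \<phi> (0, 0) * zeta_coeff integral_indicator k)"
    using zeta_coeff_diff[OF slice cmult] by (simp add: fun_eq_iff zeta_coeff_cmult)
  ultimately show ?thesis
    using value_at_1_if_vanishes_below_1[of "\<lambda>p. slice p - \<phi> (0, 0) * integral_indicator p"] by auto
qed

lemma not_value_at_1_integral_indicator:
  "\<not> value_at_1 (shift_diff (\<lambda>k. k + int CARD('n)) 1 (zeta_coeff integral_indicator)) 0"
proof (rule notI)
  assume at_1: "value_at_1 (shift_diff (\<lambda>k. k + int CARD('n)) 1 (zeta_coeff integral_indicator)) 0"
  define \<delta> :: "int \<Rightarrow> complex" where "\<delta> k = (if k = 0 then of_real (measure \<mu> GL_int) else 0)" for k
  obtain I :: "('a^'n^'n) set set set" and s e where annihilator: "finite I" "sum s I = 0"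
    "shift_sum I s e (zeta_coeff integral_indicator) = \<delta>"
    using zeta_coeff_integral_indicator_annihilated unfolding \<delta>_def[abs_def] by blast
  have supp: "finite {k. \<delta> k \<noteq> 0}" by (rule finite_subset[of _ "{0}"]) (auto simp: \<delta>_def)
  have sum_\<delta>: "Sum_any \<delta> = of_real (measure \<mu> GL_int)"
    by (subst Sum_any.expand_superset[of "{0}"]) (auto simp: \<delta>_def)
  have moment_\<delta>: "moment \<delta> = 0"
    unfolding moment_def by (subst Sum_any.expand_superset[of "{0}"]) (auto simp: \<delta>_def)
  have "finite {k. shift_diff (\<lambda>k. k + int CARD('n)) 1 \<delta> k \<noteq> 0}"
    using supp by (rule shift_diff_finite_support)
  then have "moment (shift_diff (\<lambda>k. k + int CARD('n)) 1 \<delta>) = 0"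
    using moment_shift_sum_if_value_at_1[OF at_1 annihilator(1,2), of e]
    by (simp add: shift_sum_shift_diff annihilator(3))
  then have "of_nat CARD('n) * complex_of_real (measure \<mu> GL_int) = 0"
    by (simp add: shift_diff_finite_support(3)[OF supp] sum_\<delta> moment_\<delta>)
  then show False using measure_GL_int_pos by simp
qed

lemma eq_0_at_0_if_germ_vanishes:
  fixes \<phi> :: "('a^'n^'n) \<times> ('a^'n^'n) \<Rightarrow> complex"
  assumes smooth: "\<phi> \<in> Cc_infty" and germ: "\<forall>\<^sub>F t in at 0. phi_tilde \<mu> \<phi> t = 0"
  shows "\<phi> (0, 0) = 0"
proof (rule ccontr)
  assume nonzero: "\<phi> (0, 0) \<noteq> 0"
  let ?T = "shift_diff (\<lambda>k. k + int CARD('n)) (1 :: complex)" and ?a = "\<phi> (0, 0)"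
  obtain c where "value_at_1 (\<lambda>k. zeta_coeff \<phi> k - ?a * zeta_coeff integral_indicator k) c"
    using value_at_1_zeta_coeff_minus_integral_indicator[OF smooth] by blast
  then have "value_at_1 (?T (\<lambda>k. zeta_coeff \<phi> k - ?a * zeta_coeff integral_indicator k)) 0"
    using value_at_1_shift_diff[where \<kappa> = 1] by fastforce
  then have "value_at_1 (\<lambda>k. - 1 * ?T (\<lambda>k. zeta_coeff \<phi> k - ?a * zeta_coeff integral_indicator k) k) 0"
    using value_at_1_cmult[where b = "- 1"] by fastforce
  then have "value_at_1 (\<lambda>k. ?T (zeta_coeff \<phi>) k
      + - 1 * ?T (\<lambda>k. zeta_coeff \<phi> k - ?a * zeta_coeff integral_indicator k) k) 0"
    using value_at_1_add[OF value_at_1_if_germ_vanishes[OF smooth germ]] by fastforce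
  then have "value_at_1 (\<lambda>k. inverse ?a * (?a * ?T (zeta_coeff integral_indicator) k)) 0"
    using value_at_1_cmult[where b = "inverse ?a" and c = 0]
    by (fastforce simp: shift_diff_def algebra_simps)
  then show False using nonzero not_value_at_1_integral_indicator by (simp add: mult.assoc[symmetric])
qed

end

theorem theoremA9:
  fixes \<phi> :: "('a::{nonarch_local_field,field_char_0} ^ 'n ^ 'n) \<times> ('a ^ 'n ^ 'n) \<Rightarrow> complex"
    and \<mu> :: "('a ^ 'n ^ 'n) measure"
  assumes "haar_measure_GL \<mu>"
    and "\<phi> \<in> Cc_infty"
    and "\<exists>U. open U \<and> 0 \<in> U \<and> (\<forall>t\<in>U. t \<noteq> 0 \<longrightarrow> phi_tilde \<mu> \<phi> t = 0)"
  shows "\<phi> 0 = 0"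
proof -
  obtain v :: "'a \<Rightarrow> real" where "nonarch_valuation v"
    using ex_nonarch_valuation by blast
  then interpret nonarch_valuation v .
  obtain \<pi> where "\<pi> \<noteq> 0" "v \<pi> < 1" "\<And>x. v x < 1 \<Longrightarrow> v x \<le> v \<pi>"
    using ex_uniformizer by blast
  then interpret test_functions v \<pi> \<mu>
    by unfold_locales (use assms(1) in auto)
  have "\<forall>\<^sub>F t in at 0. phi_tilde \<mu> \<phi> t = 0"
    unfolding eventually_at_topological using assms(3) by blast
  then have "\<phi> (0, 0) = 0"
    by (rule eq_0_at_0_if_germ_vanishes[OF assms(2)])
  then show ?thesis by (simp add: zero_prod_def)
qed

end
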